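(* The subspace $\mathfrak g^{-1,1}$ (denoted $\mathfrak g^{-1,1}_B,\mathfrak g^{-1,1}_C,\mathfrak g^{-1,1}_D$ for $\mathfrak g=\mathfrak{so}(2l+1,\mathbb C)$, $\mathfrak{sp}(2l,\mathbb C)$, $\mathfrak{so}(2l,\mathbb C)$ respectively) can be decomposed as the following direct sum of vector subspaces: $$\mathfrak g^{-1,1}_B=\mathfrak u^B_{1,0}+\mathfrak u^B_{2,1}+\dots+\mathfrak u^B_{m,m-1}+\mathfrak u^{B,c}_{m,m-1}+\mathfrak y_{m,m-1},$$ $$\mathfrak g^{-1,1}_C=\mathfrak u^C_{1,0}+\mathfrak u^C_{2,1}+\dots+\mathfrak u^C_{m,m-1}+\mathfrak u^{C,c}_{m+1,m},$$ $$\mathfrak g^{-1,1}_D=\mathfrak u^D_{1,0}+\mathfrak u^D_{2,1}+\dots+\mathfrak u^D_{m,m-1}+\mathfrak u^{D,c}_{m,m-1}.$$ The members $\mathfrak u^{(B,C,D)}_{k+1,k}$ for $0\le k\le m-1$, $\mathfrak u^{(B,D),c}_{m,m-1}$ and $\mathfrak u^{C,c}_{m+1,m}$ are expressed in terms of Harish-Chandra coordinates by the root vectors of the sets of roots $\theta^{(B,C,D)}_{k+1,k}$ for $0\le k\le m-1$, $\theta^{(B,D),c}_{m,m-1}$ and $\theta^{C,c}_{m+1,m}$ respectively, and can be naturally identified with the tangent space at a base point of a Grassmannian of type (A) for the first two kinds of subspaces, and of a Grassmannian of type (C) for the last one. The subspace $\mathfrak y_{m,m-1}$ corresponds to the set of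 roots $\theta^{B,d}_{m,m-1}$.
   Context: **Setting.** Fix a weight $n$ and Hodge numbers $f_i:=h^{n-i,i}$. Type (D): $n=2m$, $\dim V=2l$, $\mathfrak g=\mathfrak{so}(2l,\mathbb C)$, $f_m$ even. Type (B): $n=2m$, $\dim V=2l+1$, $\mathfrak g=\mathfrak{so}(2l+1,\mathbb C)$, $f_m$ odd. Type (C): $n=2m+1$, $\dim V=2l$, $\mathfrak g=\mathfrak{sp}(2l,\mathbb C)$. In the standard basis $(e_i)$ of $V_{\mathbb C}$, $\mathfrak g$ consists of the block matrices (D) $\begin{pmatrix}A&B\\ C&-A^t\end{pmatrix}$, $B,C$ antisymmetric; (C) $\begin{pmatrix}A&B\\ C&-A^t\end{pmatrix}$, $B,C$ symmetric; (B) $\begin{pmatrix}A&x&B\\ y^t&0&-x^t\\ C&-y&-A^t\end{pmatrix}$, $B,C$ antisymmetric, $x,y\in\mathbb C^l$ ($A,B,C$ are $l\times l$). The Cartan subalgebra is the diagonal one and $\varepsilon_i(h)=h_{ii}$, $1\le i\le l$. **Index sets and base point.** Divide $\{1,\dots,l\}$ into consecutive intervals $\mathcal I_0,\mathcal I_2,\dots,\mathcal I_1,\mathcal I_3,\dots$ (even indices $\le m$ first, then odd indices $\le m$, each increasing), $|\mathcal I_k|=f_k$ for $k<m$, $|\mathcal I_m|=f_m$ in type (C), $|\mathcal I_m|=[f_m/2]$ in types (B), (D). Put $s=l$ in types (C), (D), $s=l+1$ in type (B), and $\mathcal I_{n-k}=\mathcal I_k+s$ for $k<m$ (also $k=m$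 in type (C)). The base Hodge decomposition has $V^{n-k,k}$ spanned by $e_i$, $i\in\mathcal I_k$, except that in types (B), (D) $V^{m,m}$ is spanned by $e_i$, $i\in\mathcal I_m\cup(\mathcal I_m+s)$ (and $e_{l+1}$ in type (B)). $\mathfrak g^{-1,1}$ is the space of $g\in\mathfrak g$ with $g(V^{p,q})\subset V^{p-1,q+1}$ for all $p+q=n$. **Blocks and roots.** $\mathfrak u_{k+1,k}$ is the subspace of $\mathfrak g$ of elements with nonzero entries only in rows $\mathcal I_{k+1}$, columns $\mathcal I_k$ of $A$ (and correspondingly in $-A^t$). In types (B), (D), $\mathfrak u^c_{m,m-1}$ is the subspace with nonzero entries only in rows $\mathcal I_m+s$, columns $\mathcal I_{m-1}$ of $C$ and the symmetric block; in type (C), $\mathfrak u^c_{m+1,m}$ is the subspace with nonzero entries only in rows $\mathcal I_m+l$, columns $\mathcal I_m$ of $C$. In type (B), $\mathfrak y_{m,m-1}$ is the subspace with nonzero entries only in row $l+1$, columns $\mathcal I_{m-1}$, and the symmetric entries of $-y$. Superscripts $B,C,D$ indicate the type. The sets of roots are $\theta_{k+1,k}=\{-\varepsilon_{i_1}+\varepsilon_{i_2}: i_1\in\mathcal I_k,\ i_2\in\mathcal I_{k+1}\}$; $\theta^c_{m,m-1}=\{-\varepsilon_{i_1}-\varepsilon_{i_2}: i_1\in\mathcal I_{m-1},\ i_2\in\mathcal I_m\}$ in types (B), (D); $\theta^{C,c}_{m+1,m}=\{-\varepsilon_{i_1}-\varepsilon_{i_2}: i_1,i_2\in\mathcal I_m\}$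 (including the long roots $-2\varepsilon_{i_1}$); $\theta^{B,d}_{m,m-1}=\{-\varepsilon_{i_1}: i_1\in\mathcal I_{m-1}\}$. A Grassmannian of type (A) is an ordinary Grassmannian, a flag manifold $SL(h,\mathbb C)/$maximal parabolic; a Grassmannian of type (C) is the Lagrangian Grassmannian of $Sp(2r,\mathbb C)$. The tangent space at the base point is identified with the opposite unipotent radical of the parabolic. *)

theory Defs
  imports Complex_Main "HOL-Library.FuncSet" "HOL-Library.Function_Algebras"
begin

text \<open>
  Vectors and matrices are functions on \<open>nat\<close> supported on \<open>{1..N}\<close>, resp. on \<open>{1..N} \<times> {1..N}\<close>;
  indices start at 1, and the size \<open>N\<close> is an explicit argument wherever it matters. Addition,
  negation, \<open>0\<close> and finite sums are the pointwise ones of \<open>Function_Algebras\<close>, and the notions of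
  subspace, span, dimension and linear map are those of \<open>Vector_Spaces\<close>.
\<close>

type_synonym cvec = "nat \<Rightarrow> complex"
type_synonym cmat = "nat \<Rightarrow> nat \<Rightarrow> complex"

definition scale_vec :: "complex \<Rightarrow> cvec \<Rightarrow> cvec" where
  "scale_vec c v = (\<lambda>i. c * v i)"

definition scale_mat :: "complex \<Rightarrow> cmat \<Rightarrow> cmat" where
  "scale_mat c X = (\<lambda>i j. c * X i j)"

global_interpretation cvec: vector_space scale_vec
  by unfold_locales (auto simp: scale_vec_def fun_eq_iff algebra_simps)

global_interpretation cmat: vector_space scale_mat
  by unfold_locales (auto simp: scale_mat_def fun_eq_iff algebra_simps)

definition vecs :: "nat \<Rightarrow> cvec set" where
  "vecs N = {v. \<forall>i. v i \<noteq> 0 \<longrightarrow> i \<in> {1..N}}"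

definition mats :: "nat \<Rightarrow> cmat set" where
  "mats N = {X. \<forall>i j. X i j \<noteq> 0 \<longrightarrow> i \<in> {1..N} \<and> j \<in> {1..N}}"

definition unit_vector :: "nat \<Rightarrow> cvec" where
  "unit_vector i = (\<lambda>j. if j = i then 1 else 0)"

definition unit_matrix :: "nat \<Rightarrow> nat \<Rightarrow> cmat" where
  "unit_matrix a b = (\<lambda>i j. if i = a \<and> j = b then 1 else 0)"

definition mat_vec :: "nat \<Rightarrow> cmat \<Rightarrow> cvec \<Rightarrow> cvec" where
  "mat_vec N X v = (\<lambda>i. \<Sum>j=1..N. X i j * v j)"

definition mat_mult :: "nat \<Rightarrow> cmat \<Rightarrow> cmat \<Rightarrow> cmat" where
  "mat_mult N X Y = (\<lambda>i j. \<Sum>k=1..N. X i k * Y k j)"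

definition bracket :: "nat \<Rightarrow> cmat \<Rightarrow> cmat \<Rightarrow> cmat" where
  "bracket N X Y = mat_mult N X Y - mat_mult N Y X"

definition coord_subspace :: "nat set \<Rightarrow> cvec set" where
  "coord_subspace J = cvec.span (unit_vector ` J)"

definition direct_sum :: "cmat set \<Rightarrow> cmat set list \<Rightarrow> bool" where
  "direct_sum U Ws \<longleftrightarrow>
     (\<forall>k<length Ws. cmat.subspace (Ws ! k)) \<and>
     U = {(\<Sum>k<length Ws. x k) | x. \<forall>k<length Ws. x k \<in> Ws ! k} \<and>
     (\<forall>x. (\<forall>k<length Ws. x k \<in> Ws ! k) \<and> (\<Sum>k<length Ws. x k) = 0
          \<longrightarrow> (\<forall>k<length Ws. x k = 0))"


section \<open>Matrix Lie algebras, roots and parabolic subalgebras\<close>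

definition lie_subalgebra :: "nat \<Rightarrow> cmat set \<Rightarrow> cmat set \<Rightarrow> bool" where
  "lie_subalgebra N a g \<longleftrightarrow>
     cmat.subspace a \<and> a \<subseteq> g \<and> (\<forall>X\<in>a. \<forall>Y\<in>a. bracket N X Y \<in> a)"

definition cartan :: "cmat set \<Rightarrow> cmat set" where
  "cartan g = {H \<in> g. \<forall>i j. i \<noteq> j \<longrightarrow> H i j = 0}"

text \<open>
  A weight is a function on all matrices, of which only the values on the Cartan subalgebra matter.
\<close>

definition eps :: "nat \<Rightarrow> cmat \<Rightarrow> complex" where
  "eps i H = H i i"

definition root_space :: "nat \<Rightarrow> cmat set \<Rightarrow> (cmat \<Rightarrow> complex) \<Rightarrow> cmat set" where
  "root_space N g \<alpha> = {X \<in> g. \<forall>H\<in>cartan g. bracket N H X = scale_mat (\<alpha> H) X}"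

definition is_root :: "nat \<Rightarrow> cmat set \<Rightarrow> (cmat \<Rightarrow> complex) \<Rightarrow> bool" where
  "is_root N g \<alpha> \<longleftrightarrow> (\<exists>H\<in>cartan g. \<alpha> H \<noteq> 0) \<and> root_space N g \<alpha> \<noteq> {0}"

text \<open>
  The coordinates \<open>z\<^sub>\<alpha>\<close> (\<open>\<alpha> \<in> \<Theta>\<close>) of \<open>\<Sum> z\<^sub>\<alpha> e\<^sub>\<alpha>\<close> are global linear coordinates on \<open>U\<close>, for every
  choice of root vectors \<open>e\<^sub>\<alpha>\<close>. In particular the root spaces are lines contained in \<open>U\<close>.
\<close>

definition root_coordinates ::
    "nat \<Rightarrow> cmat set \<Rightarrow> (cmat \<Rightarrow> complex) set \<Rightarrow> cmat set \<Rightarrow> bool" where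
  "root_coordinates N g \<Theta> U \<longleftrightarrow>
     finite \<Theta> \<and> (\<forall>\<alpha>\<in>\<Theta>. is_root N g \<alpha>) \<and>
     (\<forall>e. (\<forall>\<alpha>\<in>\<Theta>. e \<alpha> \<in> root_space N g \<alpha> \<and> e \<alpha> \<noteq> 0) \<longrightarrow>
        bij_betw (\<lambda>z. \<Sum>\<alpha>\<in>\<Theta>. scale_mat (z \<alpha>) (e \<alpha>)) (extensional \<Theta>) U)"

definition stabilizer :: "nat \<Rightarrow> cmat set \<Rightarrow> cvec set \<Rightarrow> cmat set" where
  "stabilizer N g W = {X \<in> g. \<forall>v\<in>W. mat_vec N X v \<in> W}"

text \<open>
  For a parabolic subalgebra \<open>p\<close> containing the Cartan subalgebra, the unipotent radical of \<open>p\<close> is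
  the sum of the root spaces \<open>g\<^sub>\<alpha> \<subseteq> p\<close> with \<open>g\<^bsub>-\<alpha>\<^esub>\<close> not contained in \<open>p\<close>; the opposite one is the
  sum of the corresponding \<open>g\<^bsub>-\<alpha>\<^esub>\<close>. It is the tangent space of the flag manifold at its base point.
\<close>

definition opposite_unipotent_radical :: "nat \<Rightarrow> cmat set \<Rightarrow> cmat set \<Rightarrow> cmat set" where
  "opposite_unipotent_radical N g p =
     cmat.span (\<Union>{root_space N g (- \<alpha>) | \<alpha>.
        is_root N g \<alpha> \<and> root_space N g \<alpha> \<subseteq> p \<and> \<not> root_space N g (- \<alpha>) \<subseteq> p})"

definition lie_embedding ::
    "nat \<Rightarrow> cmat set \<Rightarrow> nat \<Rightarrow> cmat set \<Rightarrow> (cmat \<Rightarrow> cmat) \<Rightarrow> bool" where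
  "lie_embedding N' a N g \<phi> \<longleftrightarrow>
     Vector_Spaces.linear scale_mat scale_mat \<phi> \<and> inj_on \<phi> a \<and> \<phi> ` a \<subseteq> g \<and>
     (\<forall>X\<in>a. \<forall>Y\<in>a. \<phi> (bracket N' X Y) = bracket N (\<phi> X) (\<phi> Y))"


section \<open>The classical Lie algebras\<close>

datatype lie_type = TypeB | TypeC | TypeD

fun dim_V :: "lie_type \<Rightarrow> nat \<Rightarrow> nat" where
  "dim_V TypeB l = 2 * l + 1"
| "dim_V TypeC l = 2 * l"
| "dim_V TypeD l = 2 * l"

text \<open>The distance between an index in \<open>{1..l}\<close> and the dual index.\<close>

fun shift :: "lie_type \<Rightarrow> nat \<Rightarrow> nat" where
  "shift TypeB l = l + 1"
| "shift TypeC l = l"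
| "shift TypeD l = l"

fun classical_lie :: "lie_type \<Rightarrow> nat \<Rightarrow> cmat set" where
  "classical_lie TypeD l = {X \<in> mats (2 * l). \<forall>i\<in>{1..l}. \<forall>j\<in>{1..l}.
      X (l + i) (l + j) = - X j i \<and>
      X i (l + j) = - X j (l + i) \<and>
      X (l + i) j = - X (l + j) i}"
| "classical_lie TypeC l = {X \<in> mats (2 * l). \<forall>i\<in>{1..l}. \<forall>j\<in>{1..l}.
      X (l + i) (l + j) = - X j i \<and>
      X i (l + j) = X j (l + i) \<and>
      X (l + i) j = X (l + j) i}"
| "classical_lie TypeB l = {X \<in> mats (2 * l + 1).
      X (l + 1) (l + 1) = 0 \<and>
      (\<forall>i\<in>{1..l}.
         X (l + 1) (l + 1 + i) = - X i (l + 1) \<and>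
         X (l + 1 + i) (l + 1) = - X (l + 1) i) \<and>
      (\<forall>i\<in>{1..l}. \<forall>j\<in>{1..l}.
         X (l + 1 + i) (l + 1 + j) = - X j i \<and>
         X i (l + 1 + j) = - X j (l + 1 + i) \<and>
         X (l + 1 + i) j = - X (l + 1 + j) i)}"

definition sl :: "nat \<Rightarrow> cmat set" where
  "sl h = {X \<in> mats h. (\<Sum>i=1..h. X i i) = 0}"


section \<open>The Hodge decomposition\<close>

fun weight :: "lie_type \<Rightarrow> nat \<Rightarrow> nat" where
  "weight TypeB m = 2 * m"
| "weight TypeC m = 2 * m + 1"
| "weight TypeD m = 2 * m"

definition hodge_setting :: "lie_type \<Rightarrow> nat \<Rightarrow> nat \<Rightarrow> (nat \<Rightarrow> nat) \<Rightarrow> bool" where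
  "hodge_setting t l m f \<longleftrightarrow>
     (\<forall>i\<le>weight t m. f (weight t m - i) = f i) \<and>
     (\<Sum>i\<le>weight t m. f i) = dim_V t l \<and>
     (t = TypeB \<longrightarrow> odd (f m)) \<and> (t = TypeD \<longrightarrow> even (f m))"

context
  fixes t :: lie_type and l m :: nat and f :: "nat \<Rightarrow> nat"
begin

definition block_size :: "nat \<Rightarrow> nat" where
  "block_size k = (if k = m \<and> t \<noteq> TypeC then f m div 2 else f k)"

text \<open>The number of indices preceding the interval with index \<open>k \<le> m\<close>.\<close>

definition block_start :: "nat \<Rightarrow> nat" where
  "block_start k =
     (if even k then \<Sum>j | j < k \<and> even j. block_size j
      else (\<Sum>j | j \<le> m \<and> even j. block_size j) + (\<Sum>j | j < k \<and> odd j. block_size j))"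

text \<open>
  The intervals \<open>I\<^sub>k\<close> for \<open>k \<le> m\<close>, and the shifted ones \<open>I\<^bsub>n-k\<^esub> = I\<^sub>k + s\<close> beyond the middle.
\<close>

definition index_set :: "nat \<Rightarrow> nat set" where
  "index_set k =
     (if k \<le> m then {block_start k + 1..block_start k + block_size k}
      else if k \<le> weight t m then
        (\<lambda>i. i + shift t l) ` {block_start (weight t m - k) + 1..
           block_start (weight t m - k) + block_size (weight t m - k)}
      else {})"

definition shifted :: "nat set \<Rightarrow> nat set" where
  "shifted J = (\<lambda>i. i + shift t l) ` J"

text \<open>\<open>hodge_space k\<close> is the summand of bidegree \<open>(n - k, k)\<close>; it is zero for \<open>k > n\<close>.\<close>

definition hodge_space :: "nat \<Rightarrow> cvec set" where
  "hodge_space k = coord_subspace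
     (if k = m \<and> t \<noteq> TypeC
      then index_set m \<union> shifted (index_set m) \<union> (if t = TypeB then {l + 1} else {})
      else index_set k)"

definition g_minus :: "cmat set" where
  "g_minus = {X \<in> classical_lie t l.
     \<forall>k\<le>weight t m. \<forall>v\<in>hodge_space k. mat_vec (dim_V t l) X v \<in> hodge_space (k + 1)}"


section \<open>Blocks and sets of roots\<close>

definition supported_in :: "(nat \<times> nat) set \<Rightarrow> cmat set" where
  "supported_in P = {X \<in> classical_lie t l. \<forall>i j. X i j \<noteq> 0 \<longrightarrow> (i, j) \<in> P}"

text \<open>\<open>u_block k\<close> has rows \<open>I\<^bsub>k+1\<^esub>\<close> and columns \<open>I\<^sub>k\<close>.\<close>

definition u_block :: "nat \<Rightarrow> cmat set" where
  "u_block k = supported_in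
     (index_set (k + 1) \<times> index_set k \<union>
      shifted (index_set k) \<times> shifted (index_set (k + 1)))"

text \<open>The block \<open>u\<^sup>c\<close> of types (B) and (D), and then that of type (C).\<close>

definition uc_block :: "cmat set" where
  "uc_block = supported_in
     (shifted (index_set m) \<times> index_set (m - 1) \<union>
      shifted (index_set (m - 1)) \<times> index_set m)"

definition ucC_block :: "cmat set" where
  "ucC_block = supported_in (shifted (index_set m) \<times> index_set m)"

definition y_block :: "cmat set" where
  "y_block = supported_in
     ({l + 1} \<times> index_set (m - 1) \<union> shifted (index_set (m - 1)) \<times> {l + 1})"

definition theta :: "nat \<Rightarrow> (cmat \<Rightarrow> complex) set" where
  "theta k = {- eps i + eps j | i j. i \<in> index_set k \<and> j \<in> index_set (k + 1)}"

definition theta_c :: "(cmat \<Rightarrow> complex) set" where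
  "theta_c = {- eps i - eps j | i j. i \<in> index_set (m - 1) \<and> j \<in> index_set m}"

definition theta_cC :: "(cmat \<Rightarrow> complex) set" where
  "theta_cC = {- eps i - eps j | i j. i \<in> index_set m \<and> j \<in> index_set m}"

definition theta_d :: "(cmat \<Rightarrow> complex) set" where
  "theta_d = {- eps i | i. i \<in> index_set (m - 1)}"


section \<open>Embeddings of the Lie algebras of the Grassmannians\<close>

definition dual_index :: "nat \<Rightarrow> nat" where
  "dual_index i = (if i \<le> l then i + shift t l else if i > shift t l then i - shift t l else i)"

text \<open>
  \<open>join_blocks r p q\<close> maps \<open>1, \<dots>, r\<close> to \<open>p + 1, \<dots>, p + r\<close> and \<open>r + 1, r + 2, \<dots>\<close> to
  \<open>q + 1, q + 2, \<dots>\<close>.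
\<close>

definition join_blocks :: "nat \<Rightarrow> nat \<Rightarrow> nat \<Rightarrow> nat \<Rightarrow> nat" where
  "join_blocks r p q a = (if a \<le> r then p + a else q + (a - r))"

text \<open>
  \<open>embed_sl h \<iota>\<close> lets \<open>sl(h)\<close> act on the span of the \<open>e\<^bsub>\<iota> a\<^esub>\<close> (an isotropic subspace in all the
  applications) and contragrediently on the span of the dual basis vectors.
\<close>

definition embed_sl :: "nat \<Rightarrow> (nat \<Rightarrow> nat) \<Rightarrow> cmat \<Rightarrow> cmat" where
  "embed_sl h \<iota> X = (\<Sum>a=1..h. \<Sum>b=1..h. scale_mat (X a b)
     (unit_matrix (\<iota> a) (\<iota> b) - unit_matrix (dual_index (\<iota> b)) (dual_index (\<iota> a))))"

definition embed_sp :: "nat \<Rightarrow> (nat \<Rightarrow> nat) \<Rightarrow> cmat \<Rightarrow> cmat" where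
  "embed_sp r \<iota> X = (\<Sum>a=1..2*r. \<Sum>b=1..2*r. scale_mat (X a b) (unit_matrix (\<iota> a) (\<iota> b)))"

definition u_embedding :: "nat \<Rightarrow> cmat \<Rightarrow> cmat" where
  "u_embedding k = embed_sl (block_size k + block_size (k + 1))
     (join_blocks (block_size k) (block_start k) (block_start (k + 1)))"

definition uc_embedding :: "cmat \<Rightarrow> cmat" where
  "uc_embedding = embed_sl (block_size (m - 1) + block_size m)
     (join_blocks (block_size (m - 1)) (block_start (m - 1)) (shift t l + block_start m))"

definition ucC_embedding :: "cmat \<Rightarrow> cmat" where
  "ucC_embedding = embed_sp (block_size m)
     (join_blocks (block_size m) (block_start m) (shift t l + block_start m))"

end


section \<open>Grassmannians\<close>

definition grassmannian :: "nat \<Rightarrow> nat \<Rightarrow> cvec set set" where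
  "grassmannian r h = {W. cvec.subspace W \<and> W \<subseteq> vecs h \<and> cvec.dim W = r}"

definition symplectic_form :: "nat \<Rightarrow> cvec \<Rightarrow> cvec \<Rightarrow> complex" where
  "symplectic_form r v w = (\<Sum>i=1..r. v i * w (r + i) - v (r + i) * w i)"

definition lagrangian_grassmannian :: "nat \<Rightarrow> cvec set set" where
  "lagrangian_grassmannian r = {W. cvec.subspace W \<and>
     W = {v \<in> vecs (2 * r). \<forall>w\<in>W. symplectic_form r v w = 0}}"

definition base_point :: "nat \<Rightarrow> cvec set" where
  "base_point r = coord_subspace {1..r}"

definition upper_triangular_borel :: "nat \<Rightarrow> cmat set" where
  "upper_triangular_borel h = {X \<in> sl h. \<forall>i j. j < i \<longrightarrow> X i j = 0}"

definition maximal_parabolic :: "nat \<Rightarrow> cmat set \<Rightarrow> bool" where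
  "maximal_parabolic h p \<longleftrightarrow>
     lie_subalgebra h p (sl h) \<and> upper_triangular_borel h \<subseteq> p \<and> p \<noteq> sl h \<and>
     (\<forall>q. lie_subalgebra h q (sl h) \<and> p \<subseteq> q \<longrightarrow> q = p \<or> q = sl h)"

text \<open>
  \<open>W\<close> is the base point, so the parabolic subalgebra is the stabilizer of \<open>W\<close>. If \<open>r = 0\<close> or
  \<open>r = h\<close> then the Grassmannian is a point and no parabolic subalgebra is involved.
\<close>

definition tangent_grassmannian_A ::
    "nat \<Rightarrow> cmat set \<Rightarrow> cmat set \<Rightarrow> nat \<Rightarrow> nat \<Rightarrow> (cmat \<Rightarrow> cmat) \<Rightarrow> bool" where
  "tangent_grassmannian_A N g U r h \<phi> \<longleftrightarrow>
     (let W = base_point r; p = stabilizer h (sl h) W in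
        W \<in> grassmannian r h \<and>
        (0 < r \<and> r < h \<longrightarrow> maximal_parabolic h p) \<and>
        lie_embedding h (sl h) N g \<phi> \<and> \<phi> ` cartan (sl h) \<subseteq> cartan g \<and>
        \<phi> ` opposite_unipotent_radical h (sl h) p = U)"

definition tangent_grassmannian_C ::
    "nat \<Rightarrow> cmat set \<Rightarrow> cmat set \<Rightarrow> nat \<Rightarrow> (cmat \<Rightarrow> cmat) \<Rightarrow> bool" where
  "tangent_grassmannian_C N g U r \<phi> \<longleftrightarrow>
     (let W = base_point r; sp = classical_lie TypeC r; p = stabilizer (2 * r) sp W in
        W \<in> lagrangian_grassmannian r \<and>
        lie_embedding (2 * r) sp N g \<phi> \<and> \<phi> ` cartan sp \<subseteq> cartan g \<and>
        \<phi> ` opposite_unipotent_radical (2 * r) sp p = U)"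

end

theory Submission
  imports Defs
begin

text \<open>
  All objects of the theorem are described by the positions of nonzero matrix entries. In each type
  the Lie algebra consists of the matrices that are skew for a bilinear form pairing \<open>e\<^sub>i\<close> with a dual
  basis vector, so the entry at \<open>(i, j)\<close> determines the entry at the mirror position formed by the
  duals of \<open>j\<close> and \<open>i\<close>, and there is no other relation between entries (\<open>classical_lie_iff\<close>). A set
  of positions closed under mirroring therefore cuts out a subspace, and a partition of the positions
  into such sets cuts out a direct sum (\<open>direct_sum_supported_in\<close>).

  The Hodge decomposition partitions the basis, so lying in \<open>g\<^bsup>-1,1\<^esup>\<close> is a condition on positions: the
  row index must be one step beyond the column index (\<open>g_minus_eq_supported_in\<close>). A step below the
  middle is mirrored by a step above it, and together they form a block \<open>u\<^bsub>k+1,k\<^esub>\<close>. In even weight the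
  middle space consists of \<open>I\<^sub>m\<close>, its shifted copy and, in type (B), the self-dual vector; the step into
  it splits accordingly into \<open>u\<^bsub>m,m-1\<^esub>\<close>, \<open>u\<^sup>c\<close> and \<open>y\<close>. In odd weight the middle step goes from
  \<open>I\<^sub>m\<close> to its own dual and gives \<open>u\<^sup>c\<close> (\<open>hodge_steps_BD\<close>, \<open>hodge_steps_C\<close>).

  The Cartan subalgebra is diagonal and acts on each position by a scalar. Two off-diagonal positions
  carry the same weight only if they are equal or mirror images (\<open>position_weight_unique\<close>), so a root
  vector has one free entry, and the coordinates with respect to root vectors are these entries up to
  nonzero factors (\<open>root_coordinates_supported_in\<close>).

  For the Grassmannians, a diagonal matrix that is constant on the base point and on its complement
  grades the Lie algebra, which shows that the opposite unipotent radical is the block of matrices from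
  the base point to the complement (\<open>opposite_unipotent_radical_eq_block\<close>). For type (A) the two
  intervals that index the rows and columns of a block span an isotropic subspace of \<open>V\<close>, on which
  \<open>sl\<close> acts together with the contragredient action on the dual vectors; for type (C) they span a
  symplectic subspace. Both actions carry the block of the Grassmannian to the given block
  (\<open>tangent_grassmannian_A_embed_sl\<close>, \<open>tangent_grassmannian_C_embed_sp\<close>).
\<close>

section \<open>Entries and supports of matrices\<close>

lemma sum_mat_apply: "(\<Sum>x\<in>A. F x) i j = (\<Sum>x\<in>A. (F x :: cmat) i j)"
  by (induction A rule: infinite_finite_induct) auto

lemma sum_vec_apply: "(\<Sum>x\<in>A. F x) i = (\<Sum>x\<in>A. (F x :: cvec) i)"
  by (induction A rule: infinite_finite_induct) auto

lemma subspace_mats: "cmat.subspace (mats N)"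
  unfolding cmat.subspace_def mats_def scale_mat_def
  by (auto, (metis add.right_neutral)+)

lemma matrix_eq_sum_units:
  assumes "finite P" and "\<And>i j. X i j \<noteq> 0 \<Longrightarrow> (i, j) \<in> P"
  shows "X = (\<Sum>(a, b)\<in>P. scale_mat (X a b) (unit_matrix a b))"
proof (intro ext)
  fix i j
  have "(\<Sum>(a, b)\<in>P. scale_mat (X a b) (unit_matrix a b)) i j
      = (\<Sum>p\<in>P. if p = (i, j) then X i j else 0)"
    unfolding sum_mat_apply
    by (intro sum.cong) (auto simp: scale_mat_def unit_matrix_def split: if_splits)
  also have "\<dots> = X i j"
    using assms by auto
  finally show "X i j = (\<Sum>(a, b)\<in>P. scale_mat (X a b) (unit_matrix a b)) i j" ..
qed

lemma unit_matrix_in_mats: "a \<in> {1..N} \<Longrightarrow> b \<in> {1..N} \<Longrightarrow> unit_matrix a b \<in> mats N"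
  by (auto simp: mats_def unit_matrix_def)

lemma mat_vec_unit_vector: "b \<in> {1..N} \<Longrightarrow> mat_vec N X (unit_vector b) = (\<lambda>i. X i b)"
  by (auto simp: mat_vec_def unit_vector_def if_distrib cong: if_cong)

lemma coord_subspace_eq:
  assumes "finite J"
  shows "coord_subspace J = {v. \<forall>i. v i \<noteq> 0 \<longrightarrow> i \<in> J}"
proof
  have "cvec.subspace {v. \<forall>i. v i \<noteq> 0 \<longrightarrow> i \<in> J}"
    unfolding cvec.subspace_def scale_vec_def by (auto, metis add.right_neutral)
  then show "coord_subspace J \<subseteq> {v. \<forall>i. v i \<noteq> 0 \<longrightarrow> i \<in> J}"
    unfolding coord_subspace_def by (intro cvec.span_minimal) (auto simp: unit_vector_def split: if_splits)
next
  show "{v. \<forall>i. v i \<noteq> 0 \<longrightarrow> i \<in> J} \<subseteq> coord_subspace J"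
  proof
    fix v :: cvec
    assume v: "v \<in> {v. \<forall>i. v i \<noteq> 0 \<longrightarrow> i \<in> J}"
    have "v = (\<Sum>j\<in>J. scale_vec (v j) (unit_vector j))"
    proof
      fix i
      have "(\<Sum>j\<in>J. scale_vec (v j) (unit_vector j)) i = (\<Sum>j\<in>J. if j = i then v i else 0)"
        unfolding sum_vec_apply by (intro sum.cong) (auto simp: scale_vec_def unit_vector_def)
      then show "v i = (\<Sum>j\<in>J. scale_vec (v j) (unit_vector j)) i"
        using v assms by auto
    qed
    also have "\<dots> \<in> coord_subspace J"
      unfolding coord_subspace_def
      by (intro cvec.span_sum cvec.span_scale cvec.span_base imageI)
    finally show "v \<in> coord_subspace J" .
  qed
qed

lemma unit_vector_in_coord_subspace:
  "i \<in> J \<Longrightarrow> unit_vector i \<in> coord_subspace J"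
  unfolding coord_subspace_def by (intro cvec.span_base imageI)

lemma bracket_diagonal:
  assumes H: "\<And>i j. i \<noteq> j \<Longrightarrow> H i j = 0" and X: "X \<in> mats N"
  shows "bracket N H X = (\<lambda>i j. (H i i - H j j) * X i j)"
proof (intro ext)
  fix i j
  have "(\<Sum>k=1..N. H i k * X k j) = (\<Sum>k=1..N. if k = i then H i i * X i j else 0)"
    by (intro sum.cong) (auto simp: H)
  moreover have "(\<Sum>k=1..N. X i k * H k j) = (\<Sum>k=1..N. if k = j then X i j * H j j else 0)"
    by (intro sum.cong) (auto simp: H)
  ultimately show "bracket N H X i j = (H i i - H j j) * X i j"
    using X unfolding bracket_def mat_mult_def mats_def by (auto simp: algebra_simps)
qed

text \<open>
  The Cartan subalgebra is diagonal, hence it acts on the position \<open>(i, j)\<close> by the scalar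
  \<open>H i i - H j j\<close>; membership in a root space only restricts the positions of nonzero entries.
\<close>

lemma root_space_iff:
  assumes "g \<subseteq> mats N"
  shows "X \<in> root_space N g \<alpha> \<longleftrightarrow>
    X \<in> g \<and> (\<forall>H\<in>cartan g. \<forall>i j. X i j \<noteq> 0 \<longrightarrow> \<alpha> H = H i i - H j j)"
proof -
  have "bracket N H X = scale_mat (\<alpha> H) X \<longleftrightarrow>
      (\<forall>i j. X i j \<noteq> 0 \<longrightarrow> \<alpha> H = H i i - H j j)"
    if "X \<in> g" "H \<in> cartan g" for H
  proof -
    have "bracket N H X = (\<lambda>i j. (H i i - H j j) * X i j)"
      using that assms by (intro bracket_diagonal) (auto simp: cartan_def)
    then show ?thesis
      by (simp add: scale_mat_def fun_eq_iff) (metis mult_cancel_right)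
  qed
  then show ?thesis
    unfolding root_space_def by auto
qed


section \<open>The orthogonal and symplectic Lie algebras\<close>

text \<open>
  The three families of block matrices are treated at once: each is the Lie algebra of a bilinear
  form pairing \<open>e\<^sub>i\<close> with the dual basis vector, up to the sign \<open>form_sign\<close>.
\<close>

definition form_sign :: "lie_type \<Rightarrow> nat \<Rightarrow> nat \<Rightarrow> complex" where
  "form_sign t l i = (if t = TypeC \<and> i > l then -1 else 1)"

lemma form_sign_square: "form_sign t l i * form_sign t l i = 1"
  by (simp add: form_sign_def)

lemma dual_index_in: "i \<in> {1..dim_V t l} \<Longrightarrow> dual_index t l i \<in> {1..dim_V t l}"
  by (cases t) (auto simp: dual_index_def)

lemma dual_index_dual: "i \<in> {1..dim_V t l} \<Longrightarrow> dual_index t l (dual_index t l i) = i"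
  by (cases t) (auto simp: dual_index_def)

lemma dual_index_inj:
  "i \<in> {1..dim_V t l} \<Longrightarrow> j \<in> {1..dim_V t l} \<Longrightarrow>
    dual_index t l i = dual_index t l j \<longleftrightarrow> i = j"
  by (metis dual_index_dual)

lemma form_sign_dual:
  "i \<in> {1..dim_V t l} \<Longrightarrow> j \<in> {1..dim_V t l} \<Longrightarrow>
    form_sign t l (dual_index t l i) * form_sign t l (dual_index t l j)
      = form_sign t l i * form_sign t l j"
  by (cases t) (auto simp: dual_index_def form_sign_def)

lemma ball_index_C: "(\<forall>i\<in>{1..2 * l}. P i) \<longleftrightarrow> (\<forall>i\<in>{1..l}. P i \<and> P (l + i :: nat))"
proof -
  have "{1..2 * l} = {1..l} \<union> (\<lambda>i. l + i) ` {1..l}"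
    by auto
  then show ?thesis by (simp only: ball_Un ball_simps) blast
qed

lemma ball_index_B:
  "(\<forall>i\<in>{1..2 * l + 1}. P i) \<longleftrightarrow> P (l + 1) \<and> (\<forall>i\<in>{1..l}. P i \<and> P (l + 1 + i :: nat))"
proof -
  have "(\<lambda>i. l + 1 + i) ` {1..l} = {l + 2..2 * l + 1}"
    by (subst image_add_atLeastAtMost) auto
  then have "{1..2 * l + 1} = {l + 1} \<union> {1..l} \<union> (\<lambda>i. l + 1 + i) ` {1..l}"
    by auto
  then show ?thesis by (simp only: ball_Un ball_simps) blast
qed

text \<open>
  The block conditions of each type say that \<open>X\<close> is the negative of its adjoint for the form. The sign
  only matters for the off-diagonal blocks of type (C); in type (B) the middle entry vanishes because
  it is its own negative.
\<close>

lemma classical_lie_iff: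
  "X \<in> classical_lie t l \<longleftrightarrow> X \<in> mats (dim_V t l) \<and>
    (\<forall>i\<in>{1..dim_V t l}. \<forall>j\<in>{1..dim_V t l}. X (dual_index t l j) (dual_index t l i)
        = - (form_sign t l i * form_sign t l j * X i j))"
proof (cases t)
  case TypeB
  show ?thesis
    unfolding TypeB dim_V.simps classical_lie.simps mem_Collect_eq ball_index_B
    by (simp add: dual_index_def form_sign_def eq_neg_iff_add_eq_0 add.commute cong: conj_cong) blast
next
  case TypeC
  show ?thesis
    unfolding TypeC dim_V.simps classical_lie.simps mem_Collect_eq ball_index_C
    by (simp add: dual_index_def form_sign_def eq_neg_iff_add_eq_0 add.commute cong: conj_cong) blast
next
  case TypeD
  show ?thesis
    unfolding TypeD dim_V.simps classical_lie.simps mem_Collect_eq ball_index_C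
    by (simp add: dual_index_def form_sign_def eq_neg_iff_add_eq_0 add.commute cong: conj_cong) blast
qed

lemma dual_index_eq_iff:
  assumes "x \<in> {1..dim_V t l}" "y \<in> {1..dim_V t l}"
  shows "dual_index t l x = y \<longleftrightarrow> x = dual_index t l y"
  using assms dual_index_dual by metis

lemma classical_lie_dual:
  "X \<in> classical_lie t l \<Longrightarrow> i \<in> {1..dim_V t l} \<Longrightarrow> j \<in> {1..dim_V t l} \<Longrightarrow>
    X (dual_index t l j) (dual_index t l i) = - (form_sign t l i * form_sign t l j * X i j)"
  by (simp add: classical_lie_iff)

lemma classical_lie_mats: "classical_lie t l \<subseteq> mats (dim_V t l)"
  by (auto simp: classical_lie_iff)

lemma classical_lie_index:
  "X \<in> classical_lie t l \<Longrightarrow> X i j \<noteq> 0 \<Longrightarrow> i \<in> {1..dim_V t l} \<and> j \<in> {1..dim_V t l}"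
  using classical_lie_mats by (fastforce simp: mats_def)

lemma subspace_classical_lie: "cmat.subspace (classical_lie t l)"
  unfolding cmat.subspace_def
proof (intro conjI ballI allI)
  show "0 \<in> classical_lie t l"
    by (simp add: classical_lie_iff mats_def)
next
  fix X Y assume "X \<in> classical_lie t l" "Y \<in> classical_lie t l"
  then show "X + Y \<in> classical_lie t l"
    using cmat.subspace_add[OF subspace_mats]
    by (simp add: classical_lie_iff algebra_simps)
next
  fix c X assume "X \<in> classical_lie t l"
  then show "scale_mat c X \<in> classical_lie t l"
    using cmat.subspace_scale[OF subspace_mats]
    by (simp add: classical_lie_iff) (simp add: scale_mat_def algebra_simps)
qed

lemma cartan_dual:
  assumes "H \<in> cartan (classical_lie t l)" and "i \<in> {1..dim_V t l}"
  shows "H (dual_index t l i) (dual_index t l i) = - H i i"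
  using classical_lie_dual[of H t l i i] assms form_sign_square[of t l i]
  by (auto simp: cartan_def)

text \<open>
  The projection of a matrix unit to the orthogonal or symplectic Lie algebra, up to a factor 2. At
  off-diagonal positions the nonzero ones are the root vectors.
\<close>

definition sym_unit :: "lie_type \<Rightarrow> nat \<Rightarrow> nat \<Rightarrow> nat \<Rightarrow> cmat" where
  "sym_unit t l a b = unit_matrix a b - scale_mat (form_sign t l a * form_sign t l b)
     (unit_matrix (dual_index t l b) (dual_index t l a))"

lemma sym_unit_in_classical_lie:
  assumes a: "a \<in> {1..dim_V t l}" and b: "b \<in> {1..dim_V t l}"
  shows "sym_unit t l a b \<in> classical_lie t l"
  unfolding classical_lie_iff
proof (intro conjI ballI)
  show "sym_unit t l a b \<in> mats (dim_V t l)"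
    unfolding sym_unit_def using assms
    by (intro cmat.subspace_diff[OF subspace_mats] cmat.subspace_scale[OF subspace_mats]
        unit_matrix_in_mats dual_index_in)
next
  fix i j assume i: "i \<in> {1..dim_V t l}" and j: "j \<in> {1..dim_V t l}"
  note eqs = dual_index_eq_iff[OF i b] dual_index_eq_iff[OF j a] dual_index_inj[OF i a] dual_index_inj[OF j b]
  define p where "p = form_sign t l a * form_sign t l b"
  have pp: "p * p = 1"
    by (simp add: p_def form_sign_def)
  define C1 C2 where "C1 \<longleftrightarrow> i = a \<and> j = b" and "C2 \<longleftrightarrow> i = dual_index t l b \<and> j = dual_index t l a"
  have p: "form_sign t l i * form_sign t l j = p" if "C1 \<or> C2"
    using that form_sign_dual[OF b a] unfolding C1_def C2_def p_def by (metis mult.commute)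
  have "sym_unit t l a b (dual_index t l j) (dual_index t l i)
      = (if C2 then 1 else 0) - p * (if C1 then 1 else 0)"
    unfolding sym_unit_def scale_mat_def unit_matrix_def minus_apply eqs p_def C1_def C2_def
    by (simp add: conj_commute)
  moreover have "sym_unit t l a b i j = (if C1 then 1 else 0) - p * (if C2 then 1 else 0)"
    unfolding sym_unit_def scale_mat_def unit_matrix_def minus_apply p_def C1_def C2_def by simp
  ultimately show "sym_unit t l a b (dual_index t l j) (dual_index t l i)
      = - (form_sign t l i * form_sign t l j * sym_unit t l a b i j)"
    using p pp by (cases C1; cases C2) (simp_all add: right_diff_distrib)
qed

text \<open>
  Elements of the Lie algebra are fixed by the symmetry, so expanding one in matrix units and
  symmetrizing every term doubles it. Hence the Lie algebra is spanned by the \<open>sym_unit\<close>.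
\<close>

lemma classical_lie_eq_sum_sym_units:
  assumes X: "X \<in> classical_lie t l" and P: "finite P" "\<And>i j. X i j \<noteq> 0 \<Longrightarrow> (i, j) \<in> P"
  shows "scale_mat 2 X = (\<Sum>(a, b)\<in>{(a, b) \<in> P. X a b \<noteq> 0}. scale_mat (X a b) (sym_unit t l a b))"
    (is "_ = sum _ ?S")
proof -
  let ?\<sigma> = "dual_index t l"
  have idx: "a \<in> {1..dim_V t l}" "b \<in> {1..dim_V t l}" if "(a, b) \<in> ?S" for a b
    using classical_lie_index[OF X, of a b] that by auto
  have sw: "X (?\<sigma> b) (?\<sigma> a) = - (form_sign t l a * form_sign t l b * X a b)" if "(a, b) \<in> ?S" for a b
    using classical_lie_dual[OF X] idx[OF that] by blast
  have nz: "form_sign t l a \<noteq> 0" for a by (simp add: form_sign_def)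
  have inv: "?\<sigma> (?\<sigma> a) = a" "?\<sigma> (?\<sigma> b) = b" if "(a, b) \<in> ?S" for a b
    using idx[OF that] dual_index_dual by auto
  have tau: "(?\<sigma> b, ?\<sigma> a) \<in> ?S" if "(a, b) \<in> ?S" for a b
    using sw[OF that] P(2)[of "?\<sigma> b" "?\<sigma> a"] that nz by auto
  have signs: "form_sign t l (?\<sigma> b) * (form_sign t l (?\<sigma> a) * (form_sign t l a * form_sign t l b)) = 1"
    if "(a, b) \<in> ?S" for a b
  proof -
    have "form_sign t l (?\<sigma> b) * (form_sign t l (?\<sigma> a) * (form_sign t l a * form_sign t l b))
        = form_sign t l b * form_sign t l a * (form_sign t l a * form_sign t l b)"
      using form_sign_dual[OF idx(2)[OF that] idx(1)[OF that]] by (simp only: mult.assoc[symmetric])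
    also have "\<dots> = (form_sign t l a * form_sign t l a) * (form_sign t l b * form_sign t l b)"
      by (simp only: ac_simps)
    finally show ?thesis by (simp add: form_sign_square)
  qed
  have eq: "X = (\<Sum>(a, b)\<in>?S. scale_mat (X a b) (unit_matrix a b))"
    by (rule matrix_eq_sum_units) (auto intro: finite_subset[OF _ P(1)] P(2))
  also have "\<dots> = (\<Sum>(a, b)\<in>?S. scale_mat (- (form_sign t l a * form_sign t l b * X a b))
      (unit_matrix (?\<sigma> b) (?\<sigma> a)))"
  proof (rule sum.reindex_bij_witness[of _ "\<lambda>(a, b). (?\<sigma> b, ?\<sigma> a)" "\<lambda>(a, b). (?\<sigma> b, ?\<sigma> a)"])
    fix p assume p: "p \<in> ?S"
    obtain a b where ab: "p = (a, b)" by (cases p)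
    note p = p[unfolded ab]
    show "(case case p of (a, b) \<Rightarrow> (?\<sigma> b, ?\<sigma> a) of (a, b) \<Rightarrow> (?\<sigma> b, ?\<sigma> a)) = p"
      "(case case p of (a, b) \<Rightarrow> (?\<sigma> b, ?\<sigma> a) of (a, b) \<Rightarrow> (?\<sigma> b, ?\<sigma> a)) = p"
      using inv[OF p] by (simp_all add: ab)
    show "(case p of (a, b) \<Rightarrow> (?\<sigma> b, ?\<sigma> a)) \<in> ?S" "(case p of (a, b) \<Rightarrow> (?\<sigma> b, ?\<sigma> a)) \<in> ?S"
      using tau[OF p] by (simp_all add: ab)
    have "- (form_sign t l (?\<sigma> b) * form_sign t l (?\<sigma> a) * X (?\<sigma> b) (?\<sigma> a)) = X a b"
      using signs[OF p] by (simp add: sw[OF p] mult.assoc[symmetric])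
    then show "(case case p of (a, b) \<Rightarrow> (?\<sigma> b, ?\<sigma> a) of (a, b) \<Rightarrow>
        scale_mat (- (form_sign t l a * form_sign t l b * X a b)) (unit_matrix (?\<sigma> b) (?\<sigma> a)))
        = (case p of (a, b) \<Rightarrow> scale_mat (X a b) (unit_matrix a b))"
      using inv[OF p] by (simp add: ab del: cmat.scale_minus_left)
  qed
  finally have "X + X = (\<Sum>(a, b)\<in>?S. scale_mat (X a b) (unit_matrix a b))
      + (\<Sum>(a, b)\<in>?S. scale_mat (- (form_sign t l a * form_sign t l b * X a b))
      (unit_matrix (?\<sigma> b) (?\<sigma> a)))"
    using eq by simp
  also have "\<dots> = (\<Sum>(a, b)\<in>?S. scale_mat (X a b) (sym_unit t l a b))"
    unfolding sum.distrib[symmetric]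
    by (intro sum.cong) (auto simp: sym_unit_def scale_mat_def fun_eq_iff algebra_simps)
  finally show ?thesis
    by (simp add: scale_mat_def fun_eq_iff)
qed


section \<open>Root vectors as coordinates\<close>

lemma sym_unit_in_root_space:
  assumes a: "a \<in> {1..dim_V t l}" and b: "b \<in> {1..dim_V t l}"
    and \<alpha>: "\<And>H. H \<in> cartan (classical_lie t l) \<Longrightarrow> \<alpha> H = H a a - H b b"
  shows "sym_unit t l a b \<in> root_space (dim_V t l) (classical_lie t l) \<alpha>"
  unfolding root_space_iff[OF classical_lie_mats]
proof (intro conjI ballI allI impI)
  show "sym_unit t l a b \<in> classical_lie t l"
    using a b by (rule sym_unit_in_classical_lie)
next
  fix H i j assume H: "H \<in> cartan (classical_lie t l)" and "sym_unit t l a b i j \<noteq> 0"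
  then have "(i, j) = (a, b) \<or> (i, j) = (dual_index t l b, dual_index t l a)"
    by (auto simp: sym_unit_def unit_matrix_def scale_mat_def split: if_splits)
  then show "\<alpha> H = H i i - H j j"
    using \<alpha>[OF H] cartan_dual[OF H a] cartan_dual[OF H b] by auto
qed

text \<open>
  At a position that is its own mirror image the two terms cancel in types (B) and (D) but add up in
  type (C), where they give the long roots.
\<close>

lemma sym_unit_nonzero:
  assumes "a \<in> {1..dim_V t l}" "b \<in> {1..dim_V t l}" "a = dual_index t l b \<Longrightarrow> t = TypeC"
  shows "sym_unit t l a b a b \<noteq> 0"
proof (cases "a = dual_index t l b")
  case True
  then have "t = TypeC" using assms by simp
  then have "form_sign t l a * form_sign t l b = -1"
    using True assms(2) by (auto simp: form_sign_def dual_index_def)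
  then show ?thesis
    using True dual_index_dual[OF assms(2)]
    by (simp add: sym_unit_def unit_matrix_def scale_mat_def)
next
  case False
  then show ?thesis by (auto simp: sym_unit_def unit_matrix_def scale_mat_def)
qed

lemma sym_unit_diag_in_cartan:
  assumes "k \<in> {1..dim_V t l}"
  shows "sym_unit t l k k \<in> cartan (classical_lie t l)"
  unfolding cartan_def mem_Collect_eq
proof (intro conjI allI impI)
  show "sym_unit t l k k i j = 0" if "i \<noteq> j" for i j
    using that by (auto simp: sym_unit_def unit_matrix_def scale_mat_def)
qed (rule sym_unit_in_classical_lie[OF assms assms])

lemma sym_unit_diag:
  "sym_unit t l k k i i = (if i = k then 1 else 0) - (if i = dual_index t l k then 1 else 0)"
  by (simp add: sym_unit_def unit_matrix_def scale_mat_def form_sign_square)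

text \<open>
  Different positions carry the same root only if they are related by the symmetry of the Lie
  algebra. It suffices to evaluate the weights on the diagonal matrices \<open>sym_unit t l k k\<close>, where
  \<open>weight_coeff\<close> gives the coefficients of the weight of the basis vector \<open>e\<^sub>x\<close>: the coefficient at
  \<open>x\<close> is positive unless \<open>x\<close> is the self-dual index of type (B).
\<close>

definition weight_coeff :: "lie_type \<Rightarrow> nat \<Rightarrow> nat \<Rightarrow> nat \<Rightarrow> complex" where
  "weight_coeff t l x k = (if x = k then 1 else 0) - (if x = dual_index t l k then 1 else 0)"

lemma weight_coeff_dual:
  "x \<in> {1..dim_V t l} \<Longrightarrow> k \<in> {1..dim_V t l} \<Longrightarrow>
    weight_coeff t l (dual_index t l x) k = - weight_coeff t l x k"
  using dual_index_eq_iff[of x t l k] dual_index_inj[of x t l k] by (simp add: weight_coeff_def)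

lemma weight_coeff_cases:
  shows weight_coeff_self: "dual_index t l x \<noteq> x \<Longrightarrow> weight_coeff t l x x = 1"
    and weight_coeff_nonneg: "x \<noteq> dual_index t l k \<Longrightarrow> weight_coeff t l x k \<in> {0, 1}"
    and weight_coeff_nonpos: "x \<noteq> k \<Longrightarrow> weight_coeff t l x k \<in> {0, -1}"
  by (simp_all add: weight_coeff_def)

lemma weight_coeff_inj:
  assumes x: "x \<in> {1..dim_V t l}" and y: "y \<in> {1..dim_V t l}"
    and eq: "\<And>k. k \<in> {1..dim_V t l} \<Longrightarrow> weight_coeff t l x k = weight_coeff t l y k"
  shows "x = y"
proof (cases "dual_index t l x = x \<and> dual_index t l y = y")
  case True
  then show ?thesis
    using x y by (cases t) (auto simp: dual_index_def split: if_splits)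
next
  case False
  then have "weight_coeff t l y x = 1 \<or> weight_coeff t l x y = 1"
    using eq[OF x] eq[OF y] weight_coeff_self[of t l x] weight_coeff_self[of t l y] by metis
  then show ?thesis
    using weight_coeff_nonpos[of y x t l] weight_coeff_nonpos[of x y t l] by fastforce
qed

lemma weight_coeff_pair_unique_nonfixed:
  assumes I: "b \<in> {1..dim_V t l}" "c \<in> {1..dim_V t l}" "d \<in> {1..dim_V t l}"
    and a: "a \<in> {1..dim_V t l}" "dual_index t l a \<noteq> a" and ab: "b \<noteq> dual_index t l a"
    and eq: "\<And>k. k \<in> {1..dim_V t l} \<Longrightarrow>
      weight_coeff t l a k + weight_coeff t l b k = weight_coeff t l c k + weight_coeff t l d k"
  shows "(c = a \<and> d = b) \<or> (c = b \<and> d = a)"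
proof -
  have "c = a \<or> d = a"
    using eq[OF a(1)] weight_coeff_self[OF a(2)] weight_coeff_nonneg[OF ab]
      weight_coeff_nonpos[of c a t l] weight_coeff_nonpos[of d a t l] by force
  then show ?thesis
  proof
    assume "c = a"
    then have "d = b"
      using eq by (intro weight_coeff_inj[OF I(3) I(1)]) auto
    then show ?thesis using \<open>c = a\<close> by simp
  next
    assume "d = a"
    then have "c = b"
      using eq by (intro weight_coeff_inj[OF I(2) I(1)]) (auto simp: add.commute)
    then show ?thesis using \<open>d = a\<close> by simp
  qed
qed

lemma weight_coeff_pair_unique:
  assumes I: "a \<in> {1..dim_V t l}" "b \<in> {1..dim_V t l}" "c \<in> {1..dim_V t l}" "d \<in> {1..dim_V t l}"
    and ab: "b \<noteq> dual_index t l a"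
    and eq: "\<And>k. k \<in> {1..dim_V t l} \<Longrightarrow>
      weight_coeff t l a k + weight_coeff t l b k = weight_coeff t l c k + weight_coeff t l d k"
  shows "(c = a \<and> d = b) \<or> (c = b \<and> d = a)"
proof (cases "dual_index t l a = a")
  case False
  show ?thesis
    by (rule weight_coeff_pair_unique_nonfixed[OF I(2-4) I(1) False ab eq])
next
  case True
  have "dual_index t l b \<noteq> b"
    using True I ab by (cases t) (auto simp: dual_index_def split: if_splits)
  moreover have "a \<noteq> dual_index t l b"
    using ab dual_index_dual[OF I(2)] by auto
  ultimately have "(c = b \<and> d = a) \<or> (c = a \<and> d = b)"
    using eq by (intro weight_coeff_pair_unique_nonfixed[OF I(1,3,4) I(2)]) (simp_all add: add.commute)
  then show ?thesis by blast
qed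

lemma position_weight_unique:
  assumes a: "a \<in> {1..dim_V t l}" and b: "b \<in> {1..dim_V t l}"
    and c: "c \<in> {1..dim_V t l}" and d: "d \<in> {1..dim_V t l}"
    and "a \<noteq> b"
    and eq: "\<And>H. H \<in> cartan (classical_lie t l) \<Longrightarrow> H a a - H b b = H c c - H d d"
  shows "(c, d) = (a, b) \<or> (c, d) = (dual_index t l b, dual_index t l a)"
proof -
  let ?\<sigma> = "dual_index t l"
  have "weight_coeff t l a k + weight_coeff t l (?\<sigma> b) k
      = weight_coeff t l c k + weight_coeff t l (?\<sigma> d) k" if "k \<in> {1..dim_V t l}" for k
    using eq[OF sym_unit_diag_in_cartan[OF that]] b d that
    by (simp add: sym_unit_diag weight_coeff_dual) (simp add: weight_coeff_def)
  moreover have "?\<sigma> b \<noteq> ?\<sigma> a"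
    using a b \<open>a \<noteq> b\<close> by (simp add: dual_index_inj)
  ultimately have "(c = a \<and> ?\<sigma> d = ?\<sigma> b) \<or> (c = ?\<sigma> b \<and> ?\<sigma> d = a)"
    using a c by (intro weight_coeff_pair_unique[OF a dual_index_in[OF b] c dual_index_in[OF d]])
  then show ?thesis
    using dual_index_inj[OF d b] dual_index_eq_iff[OF d a] by simp
qed

lemma subspace_supported_in: "cmat.subspace (supported_in t l P)"
proof -
  have "cmat.subspace {X. \<forall>i j. X i j \<noteq> 0 \<longrightarrow> (i, j) \<in> P}"
    unfolding cmat.subspace_def scale_mat_def by (auto, metis add.right_neutral)
  moreover have "supported_in t l P = classical_lie t l \<inter> {X. \<forall>i j. X i j \<noteq> 0 \<longrightarrow> (i, j) \<in> P}"
    by (auto simp: supported_in_def)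
  ultimately show ?thesis
    by (simp add: cmat.subspace_inter subspace_classical_lie)
qed

text \<open>
  A set \<open>Q\<close> of positions may contain both members of a symmetric pair, as happens for the block of
  the Lagrangian Grassmannian; each root is then evaluated at one chosen position. A combination of
  root vectors has as its entry there the coefficient times a nonzero number, and an element of the
  Lie algebra supported in \<open>Q\<close> and its mirror image is determined by these entries.
\<close>

lemma root_coordinates_supported_in:
  assumes Q: "Q \<subseteq> {1..dim_V t l} \<times> {1..dim_V t l}"
    and offdiag: "\<And>a b. (a, b) \<in> Q \<Longrightarrow> a \<noteq> b"
    and selfdual: "\<And>a b. (a, b) \<in> Q \<Longrightarrow> a = dual_index t l b \<Longrightarrow> t = TypeC"
    and \<omega>: "\<And>a b H. (a, b) \<in> Q \<Longrightarrow> H \<in> cartan (classical_lie t l) \<Longrightarrow> \<omega> (a, b) H = H a a - H b b"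
    and sym: "\<And>a b. (a, b) \<in> Q \<Longrightarrow> (dual_index t l b, dual_index t l a) \<in> Q \<Longrightarrow>
      \<omega> (dual_index t l b, dual_index t l a) = \<omega> (a, b)"
  shows "root_coordinates (dim_V t l) (classical_lie t l) (\<omega> ` Q)
    (supported_in t l (Q \<union> (\<lambda>(a, b). (dual_index t l b, dual_index t l a)) ` Q))"
    (is "root_coordinates ?N ?g ?\<Theta> (supported_in t l ?P)")
proof -
  let ?\<sigma> = "dual_index t l"
  define row col where "row \<alpha> = fst (inv_into Q \<omega> \<alpha>)" and "col \<alpha> = snd (inv_into Q \<omega> \<alpha>)" for \<alpha>
  have pos: "(row \<alpha>, col \<alpha>) \<in> Q" "\<omega> (row \<alpha>, col \<alpha>) = \<alpha>" if "\<alpha> \<in> ?\<Theta>" for \<alpha>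
    using inv_into_into[OF that] f_inv_into_f[OF that] by (simp_all add: row_def col_def)
  have in_N: "row \<alpha> \<in> {1..?N}" "col \<alpha> \<in> {1..?N}" if "\<alpha> \<in> ?\<Theta>" for \<alpha>
    using pos(1)[OF that] Q by auto
  have weight: "\<alpha> H = H (row \<alpha>) (row \<alpha>) - H (col \<alpha>) (col \<alpha>)"
    if "\<alpha> \<in> ?\<Theta>" "H \<in> cartan ?g" for \<alpha> H
    using \<omega>[OF pos(1)[OF that(1)] that(2)] pos(2)[OF that(1)] by simp
  have finite: "finite ?\<Theta>"
    using finite_subset[OF Q] by simp
  have mirror: "X (?\<sigma> (col \<alpha>)) (?\<sigma> (row \<alpha>)) = 0 \<longleftrightarrow> X (row \<alpha>) (col \<alpha>) = 0"
    if "X \<in> ?g" "\<alpha> \<in> ?\<Theta>" for X \<alpha>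
    using classical_lie_dual[OF that(1) in_N[OF that(2)]] by (auto simp: form_sign_def)
  have support: "(i, j) = (row \<alpha>, col \<alpha>) \<or> (i, j) = (?\<sigma> (col \<alpha>), ?\<sigma> (row \<alpha>))"
    if X: "X \<in> root_space ?N ?g \<alpha>" "X i j \<noteq> 0" and \<alpha>: "\<alpha> \<in> ?\<Theta>" for X \<alpha> i j
  proof (rule position_weight_unique[OF in_N[OF \<alpha>] _ _ offdiag[OF pos(1)[OF \<alpha>]]])
    have "X \<in> ?g" using X by (simp add: root_space_def)
    then show "i \<in> {1..?N}" "j \<in> {1..?N}"
      using classical_lie_index X(2) by blast+
  next
    fix H assume "H \<in> cartan ?g"
    then show "H (row \<alpha>) (row \<alpha>) - H (col \<alpha>) (col \<alpha>) = H i i - H j j"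
      using X weight[OF \<alpha>] unfolding root_space_iff[OF classical_lie_mats] by fastforce
  qed
  have nonzero: "X (row \<alpha>) (col \<alpha>) \<noteq> 0"
    if X: "X \<in> root_space ?N ?g \<alpha>" "X \<noteq> 0" and \<alpha>: "\<alpha> \<in> ?\<Theta>" for X \<alpha>
  proof -
    have "X \<in> ?g" using X by (simp add: root_space_def)
    moreover obtain i j where "X i j \<noteq> 0" using X(2) by (auto simp: fun_eq_iff)
    ultimately show ?thesis
      using support[OF X(1) _ \<alpha>] mirror[OF _ \<alpha>] by (metis Pair_inject)
  qed
  have separate: "\<alpha> = \<beta>"
    if "\<alpha> \<in> ?\<Theta>" "\<beta> \<in> ?\<Theta>" and
      "(row \<beta>, col \<beta>) = (row \<alpha>, col \<alpha>) \<or> (row \<beta>, col \<beta>) = (?\<sigma> (col \<alpha>), ?\<sigma> (row \<alpha>))" for \<alpha> \<beta>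
    using that(3)
  proof
    assume "(row \<beta>, col \<beta>) = (row \<alpha>, col \<alpha>)"
    then show ?thesis
      using pos(2)[OF that(1)] pos(2)[OF that(2)] by simp
  next
    assume eq: "(row \<beta>, col \<beta>) = (?\<sigma> (col \<alpha>), ?\<sigma> (row \<alpha>))"
    have "\<alpha> = \<omega> (row \<alpha>, col \<alpha>)"
      by (rule pos(2)[OF that(1), symmetric])
    also have "\<dots> = \<omega> (?\<sigma> (col \<alpha>), ?\<sigma> (row \<alpha>))"
      by (rule sym[OF pos(1)[OF that(1)] pos(1)[OF that(2), unfolded eq], symmetric])
    also have "\<dots> = \<beta>"
      by (rule pos(2)[OF that(2), unfolded eq])
    finally show ?thesis .
  qed
  have is_root: "is_root ?N ?g \<alpha>" if \<alpha>: "\<alpha> \<in> ?\<Theta>" for \<alpha>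
    unfolding is_root_def
  proof
    show "\<exists>H\<in>cartan ?g. \<alpha> H \<noteq> 0"
    proof (rule ccontr)
      assume "\<not> ?thesis"
      then have "sym_unit t l k k (row \<alpha>) (row \<alpha>) = sym_unit t l k k (col \<alpha>) (col \<alpha>)"
        if "k \<in> {1..?N}" for k
        using sym_unit_diag_in_cartan[OF that] weight[OF \<alpha>] by fastforce
      then have "row \<alpha> = col \<alpha>"
        by (intro weight_coeff_inj[OF in_N[OF \<alpha>]]) (simp add: sym_unit_diag weight_coeff_def)
      then show False
        using offdiag[OF pos(1)[OF \<alpha>]] by simp
    qed
    have "sym_unit t l (row \<alpha>) (col \<alpha>) \<in> root_space ?N ?g \<alpha>"
      using in_N[OF \<alpha>] weight[OF \<alpha>] by (rule sym_unit_in_root_space)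
    moreover have "sym_unit t l (row \<alpha>) (col \<alpha>) \<noteq> 0"
      using sym_unit_nonzero[OF in_N[OF \<alpha>] selfdual[OF pos(1)[OF \<alpha>]]] by auto
    ultimately show "root_space ?N ?g \<alpha> \<noteq> {0}" by auto
  qed
  have bij: "bij_betw (\<lambda>z. \<Sum>\<alpha>\<in>?\<Theta>. scale_mat (z \<alpha>) (e \<alpha>)) (extensional ?\<Theta>) (supported_in t l ?P)"
    if e: "\<And>\<alpha>. \<alpha> \<in> ?\<Theta> \<Longrightarrow> e \<alpha> \<in> root_space ?N ?g \<alpha> \<and> e \<alpha> \<noteq> 0" for e
  proof -
    let ?S = "\<lambda>z. \<Sum>\<alpha>\<in>?\<Theta>. scale_mat (z \<alpha>) (e \<alpha>)"
    have entry: "?S z (row \<beta>) (col \<beta>) = z \<beta> * e \<beta> (row \<beta>) (col \<beta>)" if \<beta>: "\<beta> \<in> ?\<Theta>" for z \<beta>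
    proof -
      have "e \<alpha> (row \<beta>) (col \<beta>) = 0" if "\<alpha> \<in> ?\<Theta>" "\<alpha> \<noteq> \<beta>" for \<alpha>
        using e[OF that(1)] support[of "e \<alpha>" \<alpha>] separate[OF that(1) \<beta>] that by blast
      then have "?S z (row \<beta>) (col \<beta>)
          = (\<Sum>\<alpha>\<in>?\<Theta>. if \<alpha> = \<beta> then z \<beta> * e \<beta> (row \<beta>) (col \<beta>) else 0)"
        unfolding sum_mat_apply by (intro sum.cong) (auto simp: scale_mat_def)
      then show ?thesis using finite \<beta> by simp
    qed
    have e_in: "e \<alpha> \<in> supported_in t l ?P" if "\<alpha> \<in> ?\<Theta>" for \<alpha>
      using e[OF that] support[of "e \<alpha>" \<alpha>] that pos(1)[OF that]
      unfolding supported_in_def root_space_def by force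
    have S_in: "?S z \<in> supported_in t l ?P" for z
      by (intro cmat.subspace_sum cmat.subspace_scale subspace_supported_in e_in)
    have nz: "e \<alpha> (row \<alpha>) (col \<alpha>) \<noteq> 0" if "\<alpha> \<in> ?\<Theta>" for \<alpha>
      using e[OF that] nonzero[OF _ _ that] by blast
    show ?thesis
      unfolding bij_betw_def
    proof
      show "inj_on ?S (extensional ?\<Theta>)"
      proof (rule inj_onI)
        fix z w assume zw: "z \<in> extensional ?\<Theta>" "w \<in> extensional ?\<Theta>" and eq: "?S z = ?S w"
        have "z \<beta> = w \<beta>" if "\<beta> \<in> ?\<Theta>" for \<beta>
          using entry[OF that, of z] entry[OF that, of w] eq nz[OF that] by simp
        then show "z = w"
          using zw by (intro extensionalityI)
      qed
      show "?S ` extensional ?\<Theta> = supported_in t l ?P"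
      proof
        show "?S ` extensional ?\<Theta> \<subseteq> supported_in t l ?P"
          using S_in by blast
        show "supported_in t l ?P \<subseteq> ?S ` extensional ?\<Theta>"
        proof
          fix X assume X: "X \<in> supported_in t l ?P"
          define z where "z = restrict (\<lambda>\<alpha>. X (row \<alpha>) (col \<alpha>) / e \<alpha> (row \<alpha>) (col \<alpha>)) ?\<Theta>"
          define D where "D = X - ?S z"
          have D: "D \<in> supported_in t l ?P"
            unfolding D_def by (intro cmat.subspace_diff[OF subspace_supported_in] X S_in)
          then have Dg: "D \<in> ?g" by (simp add: supported_in_def)
          have D0: "D (row \<beta>) (col \<beta>) = 0" if "\<beta> \<in> ?\<Theta>" for \<beta>
            using entry[OF that, of z] nz[OF that] that by (simp add: D_def z_def)
          have DQ: "D a b = 0" if ab: "(a, b) \<in> Q" for a b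
          proof -
            have \<alpha>: "\<omega> (a, b) \<in> ?\<Theta>" (is "?\<alpha> \<in> _") using ab by blast
            have "(a, b) = (row ?\<alpha>, col ?\<alpha>) \<or> (a, b) = (?\<sigma> (col ?\<alpha>), ?\<sigma> (row ?\<alpha>))"
            proof (rule position_weight_unique[OF in_N[OF \<alpha>] _ _ offdiag[OF pos(1)[OF \<alpha>]]])
              show "a \<in> {1..?N}" "b \<in> {1..?N}" using ab Q by auto
            next
              fix H assume "H \<in> cartan ?g"
              then show "H (row ?\<alpha>) (row ?\<alpha>) - H (col ?\<alpha>) (col ?\<alpha>) = H a a - H b b"
                using \<omega>[OF ab] weight[OF \<alpha>] by simp
            qed
            then show ?thesis
              using D0[OF \<alpha>] mirror[OF Dg \<alpha>] by auto
          qed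
          have "D i j = 0" for i j
          proof (rule ccontr)
            assume nz: "D i j \<noteq> 0"
            with D have "(i, j) \<in> ?P" by (auto simp: supported_in_def)
            then obtain a b where ab: "(a, b) \<in> Q" "(i, j) = (a, b) \<or> (i, j) = (?\<sigma> b, ?\<sigma> a)"
              by auto
            then have "a \<in> {1..?N}" "b \<in> {1..?N}" using Q by auto
            from classical_lie_dual[OF Dg this] DQ[OF ab(1)] ab(2) nz
            show False by auto
          qed
          then have "D = 0" by (simp add: fun_eq_iff)
          then have "X = ?S z" by (simp add: D_def)
          moreover have "z \<in> extensional ?\<Theta>" by (simp add: z_def)
          ultimately show "X \<in> ?S ` extensional ?\<Theta>" by (rule image_eqI)
        qed
      qed
    qed
  qed
  show ?thesis
    unfolding root_coordinates_def
  proof (intro conjI ballI allI impI)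
    show "finite ?\<Theta>" by (rule finite)
    show "is_root ?N ?g \<alpha>" if "\<alpha> \<in> ?\<Theta>" for \<alpha>
      by (rule is_root[OF that])
    show "bij_betw (\<lambda>z. \<Sum>\<alpha>\<in>?\<Theta>. scale_mat (z \<alpha>) (e \<alpha>)) (extensional ?\<Theta>) (supported_in t l ?P)"
      if "\<forall>\<alpha>\<in>?\<Theta>. e \<alpha> \<in> root_space ?N ?g \<alpha> \<and> e \<alpha> \<noteq> 0" for e
      by (rule bij) (rule bspec[OF that])
  qed
qed

section \<open>Grassmannians and their tangent spaces\<close>

lemma mat_mult_unit_left:
  "b \<in> {1..N} \<Longrightarrow> mat_mult N (unit_matrix a b) X = (\<lambda>i j. if i = a then X b j else 0)"
  by (auto simp: mat_mult_def unit_matrix_def fun_eq_iff if_distrib[of "\<lambda>x. x * _"] cong: if_cong)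

lemma bracket_units:
  assumes "a \<in> {1..N}" "b \<in> {1..N}" "c \<in> {1..N}" "a \<noteq> c"
  shows "bracket N (unit_matrix a b) (unit_matrix b c) = unit_matrix a c"
  using assms by (auto simp: bracket_def mat_mult_unit_left fun_eq_iff) (auto simp: unit_matrix_def)

lemma subspace_sl: "cmat.subspace (sl h)"
proof -
  have "cmat.subspace {X :: cmat. (\<Sum>i=1..h. X i i) = 0}"
    unfolding cmat.subspace_def scale_mat_def
    by (auto simp: sum.distrib sum_distrib_left[symmetric])
  moreover have "sl h = mats h \<inter> {X. (\<Sum>i=1..h. X i i) = 0}"
    by (auto simp: sl_def)
  ultimately show ?thesis
    using cmat.subspace_inter[OF subspace_mats] by simp
qed

lemma sl_mats: "sl h \<subseteq> mats h"
  by (auto simp: sl_def)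

lemma bracket_in_mats:
  assumes "X \<in> mats N" "Y \<in> mats N"
  shows "bracket N X Y \<in> mats N"
proof -
  have "mat_mult N X Y \<in> mats N" if "X \<in> mats N" "Y \<in> mats N" for X Y
    unfolding mats_def mem_Collect_eq
  proof (intro allI impI)
    fix i j assume "mat_mult N X Y i j \<noteq> 0"
    then obtain k where "X i k * Y k j \<noteq> 0"
      unfolding mat_mult_def by (metis (no_types, lifting) sum.neutral)
    then show "i \<in> {1..N} \<and> j \<in> {1..N}"
      using that by (auto simp: mats_def)
  qed
  then show ?thesis
    unfolding bracket_def using assms by (intro cmat.subspace_diff[OF subspace_mats])
qed

lemma bracket_in_sl:
  assumes "X \<in> mats h" "Y \<in> mats h"
  shows "bracket h X Y \<in> sl h"
proof -
  have "(\<Sum>i=1..h. \<Sum>k=1..h. X i k * Y k i) = (\<Sum>i=1..h. \<Sum>k=1..h. Y i k * X k i)"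
    by (subst sum.swap) (simp add: mult.commute)
  then show ?thesis
    using bracket_in_mats[OF assms] by (simp add: sl_def bracket_def mat_mult_def sum_subtractf)
qed

lemma unit_matrix_in_sl: "a \<in> {1..h} \<Longrightarrow> b \<in> {1..h} \<Longrightarrow> a \<noteq> b \<Longrightarrow> unit_matrix a b \<in> sl h"
  by (auto simp: sl_def unit_matrix_in_mats) (auto simp: unit_matrix_def intro!: sum.neutral)

lemma base_point_eq: "base_point r = {v. \<forall>i. v i \<noteq> 0 \<longrightarrow> i \<in> {1..r}}"
  unfolding base_point_def by (rule coord_subspace_eq) simp

lemma stabilizer_base_point_iff:
  assumes g: "g \<subseteq> mats h" and r: "r \<le> h"
  shows "X \<in> stabilizer h g (base_point r) \<longleftrightarrow>
    X \<in> g \<and> (\<forall>i j. (i, j) \<in> {r + 1..h} \<times> {1..r} \<longrightarrow> X i j = 0)"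
proof safe
  assume X: "X \<in> stabilizer h g (base_point r)"
  then show "X \<in> g" by (simp add: stabilizer_def)
  fix i j assume ij: "i \<in> {r + 1..h}" "j \<in> {1..r}"
  have "unit_vector j \<in> base_point r"
    using ij by (simp add: base_point_eq unit_vector_def)
  then have "mat_vec h X (unit_vector j) \<in> base_point r"
    using X by (simp add: stabilizer_def)
  then have "(\<lambda>i. X i j) \<in> base_point r"
    using ij r by (subst (asm) mat_vec_unit_vector) auto
  then show "X i j = 0"
    using ij by (fastforce simp: base_point_eq)
next
  assume X: "X \<in> g" and zero: "\<forall>i j. (i, j) \<in> {r + 1..h} \<times> {1..r} \<longrightarrow> X i j = 0"
  have "i \<in> {1..r}" if v: "v \<in> base_point r" and i: "mat_vec h X v i \<noteq> 0" for v i
  proof -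
    obtain j where "X i j * v j \<noteq> 0"
      using i unfolding mat_vec_def by (metis (no_types, lifting) sum.neutral)
    then have "X i j \<noteq> 0" "j \<in> {1..r}" "i \<in> {1..h}"
      using v X g by (auto simp: base_point_eq mats_def)
    then show ?thesis
      using zero[rule_format, of i j] by (cases "i \<le> r") auto
  qed
  then have "mat_vec h X v \<in> base_point r" if "v \<in> base_point r" for v
    using that by (subst base_point_eq) blast
  then show "X \<in> stabilizer h g (base_point r)"
    using X by (simp add: stabilizer_def)
qed

text \<open>
  The diagonal matrix \<open>G\<close> grades the Lie algebra: it acts by \<open>y - x\<close> exactly on the block mapping the
  base point to its complement, by \<open>x - y\<close> on the opposite block, and by 0 elsewhere. Hence each root
  space lies in one degree, and the roots of the opposite unipotent radical are those of degree
  \<open>y - x\<close>.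
\<close>

lemma opposite_unipotent_radical_eq_block:
  assumes g: "g \<subseteq> mats h" "cmat.subspace g" and r: "r \<le> h"
    and G: "0 < r \<Longrightarrow> r < h \<Longrightarrow> G \<in> cartan g \<and> x \<noteq> y"
      "\<And>i. i \<in> {1..r} \<Longrightarrow> G i i = x" "\<And>i. i \<in> {r + 1..h} \<Longrightarrow> G i i = y"
    and roots: "\<And>a b. (b, a) \<in> {r + 1..h} \<times> {1..r} \<Longrightarrow>
      root_space h g (eps a - eps b) \<noteq> {0} \<and> root_space h g (eps b - eps a) \<noteq> {0}"
    and span: "\<And>X. X \<in> g \<Longrightarrow> (\<forall>i j. X i j \<noteq> 0 \<longrightarrow> (i, j) \<in> {r + 1..h} \<times> {1..r}) \<Longrightarrow>
      X \<in> cmat.span (\<Union>(b, a)\<in>{r + 1..h} \<times> {1..r}. root_space h g (eps b - eps a))"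
  shows "opposite_unipotent_radical h g (stabilizer h g (base_point r))
    = {X \<in> g. \<forall>i j. X i j \<noteq> 0 \<longrightarrow> (i, j) \<in> {r + 1..h} \<times> {1..r}}"
    (is "opposite_unipotent_radical h g ?p = ?U")
proof (cases "0 < r \<and> r < h")
  case False
  \<comment> \<open>The Grassmannian is a point and its stabilizer the whole Lie algebra.\<close>
  then have empty: "{r + 1..h} \<times> {1..r} = {}" using r by auto
  then have "root_space h g \<alpha> \<subseteq> ?p" for \<alpha>
    by (auto simp: stabilizer_base_point_iff[OF g(1) r] root_space_def)
  then have "opposite_unipotent_radical h g ?p = {0}"
    by (simp add: opposite_unipotent_radical_def)
  moreover have "?U = {0}"
    using cmat.subspace_0[OF g(2)] unfolding empty by (auto simp: fun_eq_iff)
  ultimately show ?thesis by simp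
next
  case True
  then have G_cartan: "G \<in> cartan g" and xy: "x \<noteq> y" using G(1) by auto
  have idx: "i \<in> {1..h} \<and> j \<in> {1..h}" if "X \<in> root_space h g \<alpha>" "X i j \<noteq> 0" for X \<alpha> i j
    using that g(1) by (fastforce simp: root_space_def mats_def)
  have degree: "\<alpha> G = G i i - G j j" if "X \<in> root_space h g \<alpha>" "X i j \<noteq> 0" for X \<alpha> i j
    using that G_cartan unfolding root_space_iff[OF g(1)] by blast
  have diag: "G i i = x \<or> G i i = y" if "i \<in> {1..h}" for i
    using G(2)[of i] G(3)[of i] that by (cases "i \<le> r") auto
  have two: "y - x \<noteq> x - y"
    using xy by (simp add: algebra_simps)
  \<comment> \<open>The possible degrees are 0 and the two different numbers \<open>x - y\<close> and \<open>y - x\<close>.\<close>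
  have lower: "(i, j) \<in> {r + 1..h} \<times> {1..r}"
    if "i \<in> {1..h}" "j \<in> {1..h}" "G i i - G j j = y - x" for i j
  proof -
    have "\<not> i \<le> r"
      using diag[OF that(2)] xy G(2)[of i] that two by auto
    moreover have "j \<le> r"
      using diag[OF that(1)] xy G(3)[of j] that two by (cases "j \<le> r") auto
    ultimately show ?thesis using that by auto
  qed
  have lower_degree: "G i i - G j j = y - x" if "(i, j) \<in> {r + 1..h} \<times> {1..r}" for i j
    using that G(2,3) by auto
  show ?thesis
  proof
    have "X \<in> ?U" if X: "X \<in> root_space h g (- \<alpha>)" and not_p: "\<not> root_space h g (- \<alpha>) \<subseteq> ?p" for X \<alpha>
    proof -
      obtain Y where Y: "Y \<in> root_space h g (- \<alpha>)" "Y \<notin> ?p" using not_p by blast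
      then obtain i j where ij: "(i, j) \<in> {r + 1..h} \<times> {1..r}" "Y i j \<noteq> 0"
        unfolding stabilizer_base_point_iff[OF g(1) r] by (auto simp: root_space_def)
      have "(- \<alpha>) G = y - x"
        using degree[OF Y(1) ij(2)] lower_degree[OF ij(1)] by simp
      then have "(k, n) \<in> {r + 1..h} \<times> {1..r}" if "X k n \<noteq> 0" for k n
        using degree[OF X that] idx[OF X that] by (intro lower) auto
      then show ?thesis
        using X by (auto simp: root_space_def)
    qed
    then have "\<Union>{root_space h g (- \<alpha>) | \<alpha>. is_root h g \<alpha> \<and> root_space h g \<alpha> \<subseteq> ?p \<and>
        \<not> root_space h g (- \<alpha>) \<subseteq> ?p} \<subseteq> ?U"
      by blast
    moreover have "cmat.subspace ?U"
    proof -
      have "cmat.subspace {X. \<forall>i j. X i j \<noteq> 0 \<longrightarrow> (i, j) \<in> {r + 1..h} \<times> {1..r}}"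
        unfolding cmat.subspace_def scale_mat_def by (auto, (metis add.right_neutral)+)
      moreover have "?U = g \<inter> {X. \<forall>i j. X i j \<noteq> 0 \<longrightarrow> (i, j) \<in> {r + 1..h} \<times> {1..r}}"
        by blast
      ultimately show ?thesis
        using cmat.subspace_inter[OF g(2)] by simp
    qed
    ultimately show "opposite_unipotent_radical h g ?p \<subseteq> ?U"
      unfolding opposite_unipotent_radical_def by (rule cmat.span_minimal)
  next
    have "root_space h g (eps b - eps a) \<in> {root_space h g (- \<alpha>) | \<alpha>. is_root h g \<alpha> \<and>
        root_space h g \<alpha> \<subseteq> ?p \<and> \<not> root_space h g (- \<alpha>) \<subseteq> ?p}"
      if ba: "(b, a) \<in> {r + 1..h} \<times> {1..r}" for a b
    proof -
      let ?\<alpha> = "eps a - eps b"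
      have neg: "- ?\<alpha> = eps b - eps a" by simp
      have deg: "?\<alpha> G = x - y" and deg_neg: "(- ?\<alpha>) G = y - x"
        using lower_degree[OF ba] by (simp_all add: eps_def algebra_simps)
      have root: "is_root h g ?\<alpha>"
        using roots[OF ba] G_cartan deg xy unfolding is_root_def by force
      have in_p: "root_space h g ?\<alpha> \<subseteq> ?p"
      proof
        fix X assume X: "X \<in> root_space h g ?\<alpha>"
        have "X i j = 0" if "(i, j) \<in> {r + 1..h} \<times> {1..r}" for i j
          using degree[OF X, of i j] lower_degree[OF that] deg two by auto
        then show "X \<in> ?p"
          using X by (auto simp: stabilizer_base_point_iff[OF g(1) r] root_space_def)
      qed
      have "0 \<in> root_space h g (- ?\<alpha>)"
        using cmat.subspace_0[OF g(2)] by (simp add: root_space_iff[OF g(1)])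
      then obtain X where X: "X \<in> root_space h g (- ?\<alpha>)" "X \<noteq> 0"
        using roots[OF ba] unfolding neg by blast
      then obtain i j where ij: "X i j \<noteq> 0" by (auto simp: fun_eq_iff)
      have "(i, j) \<in> {r + 1..h} \<times> {1..r}"
        using idx[OF X(1) ij] degree[OF X(1) ij] deg_neg by (intro lower) simp_all
      then have "X \<notin> ?p"
        using ij unfolding stabilizer_base_point_iff[OF g(1) r] by blast
      then have "\<not> root_space h g (- ?\<alpha>) \<subseteq> ?p"
        using X(1) by blast
      then show ?thesis
        using root in_p by (intro CollectI exI[of _ ?\<alpha>]) (simp only: neg simp_thms)
    qed
    note generator = this
    have "(\<Union>(b, a)\<in>{r + 1..h} \<times> {1..r}. root_space h g (eps b - eps a))
        \<subseteq> \<Union>{root_space h g (- \<alpha>) | \<alpha>. is_root h g \<alpha> \<and> root_space h g \<alpha> \<subseteq> ?p \<and>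
          \<not> root_space h g (- \<alpha>) \<subseteq> ?p}" (is "_ \<subseteq> \<Union>?R")
    proof (rule UN_least)
      fix p assume p: "p \<in> {r + 1..h} \<times> {1..r}"
      obtain b a where ba: "p = (b, a)" by (cases p)
      show "(case p of (b, a) \<Rightarrow> root_space h g (eps b - eps a)) \<subseteq> \<Union>?R"
        unfolding ba prod.case using generator[OF p[unfolded ba]] by (rule Union_upper)
    qed
    then have "cmat.span (\<Union>(b, a)\<in>{r + 1..h} \<times> {1..r}. root_space h g (eps b - eps a))
        \<subseteq> opposite_unipotent_radical h g ?p"
      unfolding opposite_unipotent_radical_def by (rule cmat.span_mono)
    moreover have "?U \<subseteq> cmat.span (\<Union>(b, a)\<in>{r + 1..h} \<times> {1..r}. root_space h g (eps b - eps a))"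
      using span by (intro subsetI) (elim CollectE conjE)
    ultimately show "?U \<subseteq> opposite_unipotent_radical h g ?p"
      by (rule order_trans[rotated])
  qed
qed

text \<open>The root vectors of \<open>sl\<close> are the off-diagonal matrix units, those of \<open>sp\<close> the symmetrized ones.\<close>

lemma opposite_unipotent_radical_sl:
  assumes r: "r \<le> h"
  shows "opposite_unipotent_radical h (sl h) (stabilizer h (sl h) (base_point r))
    = {X \<in> sl h. \<forall>i j. X i j \<noteq> 0 \<longrightarrow> (i, j) \<in> {r + 1..h} \<times> {1..r}}"
proof -
  \<comment> \<open>The grading matrix: constant on the base point and on its complement, with trace 0.\<close>
  define G :: cmat where "G = (\<lambda>i j. if i = j \<and> i \<in> {1..r} then of_nat (h - r)
    else if i = j \<and> i \<in> {r + 1..h} then - of_nat r else 0)"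
  have unit: "unit_matrix a b \<in> root_space h (sl h) (eps a - eps b)"
    if "a \<in> {1..h}" "b \<in> {1..h}" "a \<noteq> b" for a b
    using unit_matrix_in_sl[OF that]
    by (auto simp: root_space_iff[OF sl_mats] eps_def unit_matrix_def split: if_splits)
  have unit_nz: "unit_matrix a b \<noteq> 0" for a b
  proof
    assume "unit_matrix a b = 0"
    then have "unit_matrix a b a b = 0" by simp
    then show False by (simp add: unit_matrix_def)
  qed
  show ?thesis
  proof (rule opposite_unipotent_radical_eq_block[OF sl_mats subspace_sl r,
        where G = G and x = "of_nat (h - r)" and y = "- of_nat r"])
    assume r0: "0 < r" "r < h"
    have "G \<in> cartan (sl h)"
    proof -
      have "(\<Sum>i=1..h. G i i) = (\<Sum>i=1..r. G i i) + (\<Sum>i=r + 1..h. G i i)"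
        using sum.ub_add_nat[of 1 r "\<lambda>i. G i i" "h - r"] r by simp
      also have "\<dots> = (\<Sum>i=1..r. of_nat (h - r)) + (\<Sum>i=r + 1..h. - of_nat r)"
        by (intro arg_cong2[where f = "(+)"] sum.cong) (auto simp: G_def)
      also have "\<dots> = 0"
        by simp
      finally have "G \<in> sl h"
        using r by (auto simp: sl_def mats_def G_def)
      then show ?thesis
        by (auto simp: cartan_def G_def)
    qed
    moreover have "of_nat (h - r) \<noteq> (- of_nat r :: complex)"
      using r0 by (simp add: eq_neg_iff_add_eq_0 flip: of_nat_add)
    ultimately show "G \<in> cartan (sl h) \<and> of_nat (h - r) \<noteq> (- of_nat r :: complex)" ..
  next
    show "G i i = of_nat (h - r)" if "i \<in> {1..r}" for i
      using that by (simp add: G_def)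
    show "G i i = - of_nat r" if "i \<in> {r + 1..h}" for i
      using that by (simp add: G_def)
  next
    fix a b assume "(b, a) \<in> {r + 1..h} \<times> {1..r}"
    then have "a \<in> {1..h}" "b \<in> {1..h}" "a \<noteq> b" using r by auto
    then show "root_space h (sl h) (eps a - eps b) \<noteq> {0} \<and> root_space h (sl h) (eps b - eps a) \<noteq> {0}"
      using unit[of a b] unit[of b a] unit_nz by (metis singletonD)
  next
    fix X assume X: "X \<in> sl h" "\<forall>i j. X i j \<noteq> 0 \<longrightarrow> (i, j) \<in> {r + 1..h} \<times> {1..r}"
    let ?W = "\<Union>(b, a)\<in>{r + 1..h} \<times> {1..r}. root_space h (sl h) (eps b - eps a)"
    have "X = (\<Sum>(b, a)\<in>{r + 1..h} \<times> {1..r}. scale_mat (X b a) (unit_matrix b a))"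
      by (rule matrix_eq_sum_units) (use X in auto)
    also have "\<dots> \<in> cmat.span ?W"
    proof (rule cmat.span_sum)
      fix p assume p: "p \<in> {r + 1..h} \<times> {1..r}"
      obtain b a where ba: "p = (b, a)" by (cases p)
      have "unit_matrix b a \<in> root_space h (sl h) (eps b - eps a)"
        using p r by (intro unit) (auto simp: ba)
      then have "unit_matrix b a \<in> ?W" using p ba by blast
      then show "(case p of (b, a) \<Rightarrow> scale_mat (X b a) (unit_matrix b a)) \<in> cmat.span ?W"
        by (simp add: ba cmat.span_base cmat.span_scale)
    qed
    finally show "X \<in> cmat.span ?W" .
  qed
qed

lemma opposite_unipotent_radical_sp:
  "opposite_unipotent_radical (2 * r) (classical_lie TypeC r)
      (stabilizer (2 * r) (classical_lie TypeC r) (base_point r))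
    = {X \<in> classical_lie TypeC r. \<forall>i j. X i j \<noteq> 0 \<longrightarrow> (i, j) \<in> {r + 1..2 * r} \<times> {1..r}}"
proof -
  have dim: "dim_V TypeC r = 2 * r" by simp
  let ?g = "classical_lie TypeC r"
  define G :: cmat where "G = (\<lambda>i j. if i = j \<and> i \<in> {1..r} then 1
    else if i = j \<and> i \<in> {r + 1..2 * r} then - 1 else 0)"
  have vector: "sym_unit TypeC r a b \<in> root_space (2 * r) ?g (eps a - eps b)"
    if "a \<in> {1..2 * r}" "b \<in> {1..2 * r}" for a b
    using sym_unit_in_root_space[of a TypeC r b "eps a - eps b"] that by (simp add: eps_def)
  have vector_nz: "sym_unit TypeC r a b \<noteq> 0" if "a \<in> {1..2 * r}" "b \<in> {1..2 * r}" for a b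
    using sym_unit_nonzero[of a TypeC r b] that by (metis dim zero_fun_apply)
  show ?thesis
  proof (rule opposite_unipotent_radical_eq_block[where G = G and x = 1 and y = "- 1"])
    show "?g \<subseteq> mats (2 * r)" using classical_lie_mats[of TypeC r] by simp
    show "cmat.subspace ?g" by (rule subspace_classical_lie)
    have "G \<in> ?g"
      unfolding classical_lie_iff dim
    proof (intro conjI ballI)
      show "G \<in> mats (2 * r)" by (auto simp: mats_def G_def)
      fix i j assume ij: "i \<in> {1..2 * r}" "j \<in> {1..2 * r}"
      show "G (dual_index TypeC r j) (dual_index TypeC r i)
          = - (form_sign TypeC r i * form_sign TypeC r j * G i j)"
      proof (cases "i = j")
        case True
        then show ?thesis using ij
          by (cases "i \<le> r") (auto simp: G_def dual_index_def form_sign_def)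
      next
        case False
        then have "dual_index TypeC r j \<noteq> dual_index TypeC r i"
          using dual_index_inj[of i TypeC r j] ij by auto
        then show ?thesis using False by (simp add: G_def)
      qed
    qed
    then show "G \<in> cartan ?g \<and> 1 \<noteq> (- 1 :: complex)" by (auto simp: cartan_def G_def)
  next
    fix a b assume "(b, a) \<in> {r + 1..2 * r} \<times> {1..r}"
    then have ab: "a \<in> {1..2 * r}" "b \<in> {1..2 * r}" by auto
    then show "root_space (2 * r) ?g (eps a - eps b) \<noteq> {0} \<and> root_space (2 * r) ?g (eps b - eps a) \<noteq> {0}"
      using vector[OF ab] vector[OF ab(2,1)] vector_nz[OF ab] vector_nz[OF ab(2,1)] by (metis singletonD)
  next
    fix X assume X: "X \<in> ?g" "\<forall>i j. X i j \<noteq> 0 \<longrightarrow> (i, j) \<in> {r + 1..2 * r} \<times> {1..r}"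
    let ?B = "{r + 1..2 * r} \<times> {1..r}"
    let ?W = "\<Union>(b, a)\<in>?B. root_space (2 * r) ?g (eps b - eps a)"
    have "scale_mat 2 X = (\<Sum>(b, a)\<in>{(b, a) \<in> ?B. X b a \<noteq> 0}. scale_mat (X b a) (sym_unit TypeC r b a))"
      by (rule classical_lie_eq_sum_sym_units[OF X(1)]) (use X(2) in auto)
    also have "\<dots> \<in> cmat.span ?W"
    proof (rule cmat.span_sum)
      fix p assume p: "p \<in> {(b, a) \<in> ?B. X b a \<noteq> 0}"
      obtain b a where ba: "p = (b, a)" by (cases p)
      have "sym_unit TypeC r b a \<in> root_space (2 * r) ?g (eps b - eps a)"
        using p by (intro vector) (auto simp: ba)
      then have "sym_unit TypeC r b a \<in> ?W" using p ba by blast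
      then show "(case p of (b, a) \<Rightarrow> scale_mat (X b a) (sym_unit TypeC r b a)) \<in> cmat.span ?W"
        by (simp add: ba cmat.span_base cmat.span_scale)
    qed
    finally have "scale_mat (1 / 2) (scale_mat 2 X) \<in> cmat.span ?W"
      by (rule cmat.span_scale)
    then show "X \<in> cmat.span ?W" by simp
  qed (auto simp: G_def)
qed

text \<open>
  A subalgebra properly containing the stabilizer contains an element with a nonzero entry at some
  position \<open>(c, d)\<close> of the complementary block; bracketing with diagonal matrices isolates the matrix
  unit at \<open>(c, d)\<close>, and bracketing with matrix units of the stabilizer moves it to every other
  position of the block.
\<close>

lemma maximal_parabolic_stabilizer:
  assumes "0 < r" "r < h"
  shows "maximal_parabolic h (stabilizer h (sl h) (base_point r))" (is "maximal_parabolic h ?p")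
proof -
  let ?B = "{r + 1..h} \<times> {1..r}"
  have r: "r \<le> h" using assms by simp
  note p_iff = stabilizer_base_point_iff[OF sl_mats r]
  have unit_p: "unit_matrix a b \<in> ?p" if "a \<in> {1..h}" "b \<in> {1..h}" "a \<noteq> b" "(a, b) \<notin> ?B" for a b
    using unit_matrix_in_sl[OF that(1-3)] that(4) by (simp add: p_iff) (auto simp: unit_matrix_def)
  have "lie_subalgebra h ?p (sl h)"
    unfolding lie_subalgebra_def
  proof (intro conjI ballI)
    have "cmat.subspace {X :: cmat. \<forall>i j. (i, j) \<in> ?B \<longrightarrow> X i j = 0}"
      unfolding cmat.subspace_def scale_mat_def by auto
    moreover have "?p = sl h \<inter> {X. \<forall>i j. (i, j) \<in> ?B \<longrightarrow> X i j = 0}"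
      by (auto simp: p_iff)
    ultimately show "cmat.subspace ?p"
      using cmat.subspace_inter[OF subspace_sl] by simp
    show "?p \<subseteq> sl h" by (auto simp: stabilizer_def)
    fix X Y assume X: "X \<in> ?p" and Y: "Y \<in> ?p"
    have zero: "mat_mult h X Y i j = 0" if "X \<in> ?p" "Y \<in> ?p" "(i, j) \<in> ?B" for X Y i j
      unfolding mat_mult_def
    proof (rule sum.neutral, rule ballI)
      fix k assume "k \<in> {1..h}"
      then show "X i k * Y k j = 0"
        using that by (cases "k \<le> r") (auto simp: p_iff)
    qed
    have "X \<in> mats h" "Y \<in> mats h" using X Y sl_mats by (auto simp: p_iff)
    then show "bracket h X Y \<in> ?p"
      using zero[OF X Y] zero[OF Y X] bracket_in_sl by (simp add: p_iff bracket_def)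
  qed
  moreover have "upper_triangular_borel h \<subseteq> ?p"
    by (auto simp: upper_triangular_borel_def p_iff)
  moreover have "?p \<noteq> sl h"
  proof
    assume "?p = sl h"
    moreover have "unit_matrix (r + 1) 1 \<in> sl h"
      using assms by (intro unit_matrix_in_sl) auto
    moreover have "(r + 1, 1) \<in> ?B" using assms by auto
    ultimately have "unit_matrix (r + 1) 1 (r + 1) 1 = 0"
      using p_iff by blast
    then show False by (simp add: unit_matrix_def)
  qed
  moreover have "q = sl h" if q: "lie_subalgebra h q (sl h)" "?p \<subseteq> q" and ne: "q \<noteq> ?p" for q
  proof -
    have sub: "cmat.subspace q" "q \<subseteq> sl h" and br: "\<And>X Y. X \<in> q \<Longrightarrow> Y \<in> q \<Longrightarrow> bracket h X Y \<in> q"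
      using q(1) by (auto simp: lie_subalgebra_def)
    define low :: "cmat \<Rightarrow> cmat" where "low X = (\<lambda>i j. if (i, j) \<in> ?B then X i j else 0)" for X
    have low_sl: "low X \<in> sl h" for X
      using r by (auto simp: low_def sl_def mats_def intro!: sum.neutral)
    have low_diff: "X - low X \<in> ?p" if "X \<in> sl h" for X
      unfolding p_iff using cmat.subspace_diff[OF subspace_sl that low_sl] by (simp add: low_def)
    obtain X where "X \<in> q" "X \<notin> ?p" using ne q(2) by blast
    then obtain c d where X: "X \<in> q" "(c, d) \<in> ?B" "X c d \<noteq> 0"
      using sub(2) p_iff by blast
    have cd: "c \<in> {1..h}" "d \<in> {1..h}" "c \<noteq> d" using X(2) r by auto
    have "X - low X \<in> q" using low_diff X(1) sub(2) q(2) by blast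
    from cmat.subspace_diff[OF sub(1) X(1) this] have low_q: "low X \<in> q" by simp
    define D where "D = unit_matrix c c - unit_matrix d d"
    have D_diag: "D i j = 0" if "i \<noteq> j" for i j
      using that by (auto simp: D_def unit_matrix_def)
    have "D \<in> sl h"
      using cmat.subspace_diff[OF subspace_mats unit_matrix_in_mats[OF cd(1,1)] unit_matrix_in_mats[OF cd(2,2)]]
      using cd by (simp add: sl_def D_def sum_subtractf unit_matrix_def)
    then have "D \<in> ?p" using D_diag by (auto simp: p_iff)
    then have D_q: "D \<in> q" using q(2) by blast
    have low_m: "low X \<in> mats h" using low_sl sl_mats by blast
    have b1: "bracket h D (low X) = (\<lambda>i j. (D i i - D j j) * low X i j)"
      using D_diag low_m by (rule bracket_diagonal)
    have b1_q: "bracket h D (low X) \<in> q" using D_q low_q by (rule br)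
    have b1_m: "bracket h D (low X) \<in> mats h" using b1_q sub(2) sl_mats by blast
    have b2: "bracket h D (bracket h D (low X)) = (\<lambda>i j. (D i i - D j j) * bracket h D (low X) i j)"
      using D_diag b1_m by (rule bracket_diagonal)
    have "bracket h D (bracket h D (low X)) - bracket h D (low X) \<in> q"
      by (intro cmat.subspace_diff[OF sub(1)] br D_q b1_q low_q)
    \<comment> \<open>On the block, the eigenvalue \<open>D i i - D j j\<close> is 2 at \<open>(c, d)\<close>, and 0 or 1 elsewhere.\<close>
    moreover have "bracket h D (bracket h D (low X)) - bracket h D (low X)
        = scale_mat (2 * X c d) (unit_matrix c d)"
      unfolding b2 unfolding b1 using X(2)
      by (auto simp: fun_eq_iff low_def D_def unit_matrix_def scale_mat_def)
    ultimately have "scale_mat (inverse (2 * X c d)) (scale_mat (2 * X c d) (unit_matrix c d)) \<in> q"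
      using cmat.subspace_scale[OF sub(1)] by metis
    then have E_cd: "unit_matrix c d \<in> q"
      using X(3) by simp
    have E_ad: "unit_matrix a d \<in> q" if a: "a \<in> {r + 1..h}" for a
    proof (cases "a = c")
      case False
      have "bracket h (unit_matrix a c) (unit_matrix c d) \<in> q"
        using False a X(2) cd q(2) by (intro br E_cd subsetD[OF q(2)] unit_p) auto
      then show ?thesis
        using a X(2) cd by (subst (asm) bracket_units) auto
    qed (use E_cd in simp)
    have E_ab: "unit_matrix a b \<in> q" if a: "a \<in> {r + 1..h}" and b: "b \<in> {1..r}" for a b
    proof (cases "b = d")
      case False
      have "bracket h (unit_matrix a d) (unit_matrix d b) \<in> q"
        using False b X(2) cd r by (intro br E_ad[OF a] subsetD[OF q(2)] unit_p) auto
      then show ?thesis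
        using a b X(2) cd r by (subst (asm) bracket_units) auto
    qed (use E_ad[OF a] in simp)
    have "Y \<in> q" if Y: "Y \<in> sl h" for Y
    proof -
      have "low Y = (\<Sum>(a, b)\<in>?B. scale_mat (low Y a b) (unit_matrix a b))"
        by (rule matrix_eq_sum_units) (auto simp: low_def split: if_splits)
      also have "\<dots> \<in> q"
        using E_ab by (intro cmat.subspace_sum[OF sub(1)]) (auto intro: cmat.subspace_scale[OF sub(1)])
      finally have "(Y - low Y) + low Y \<in> q"
        using low_diff[OF Y] q(2) by (intro cmat.subspace_add[OF sub(1)]) auto
      then show ?thesis by simp
    qed
    then show ?thesis using sub(2) by blast
  qed
  ultimately show ?thesis
    unfolding maximal_parabolic_def by blast
qed

lemma base_point_in_grassmannian:
  assumes "r \<le> h"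
  shows "base_point r \<in> grassmannian r h"
proof -
  have inj: "inj_on unit_vector A" for A
  proof (rule inj_onI)
    fix i j assume "unit_vector i = unit_vector j"
    then have "unit_vector i i = unit_vector j i" by simp
    then show "i = j" by (simp add: unit_vector_def split: if_splits)
  qed
  have "cvec.independent (unit_vector ` {1..r})"
  proof (rule cvec.independent_if_scalars_zero)
    fix u x assume zero: "(\<Sum>v\<in>unit_vector ` {1..r}. scale_vec (u v) v) = 0"
      and "x \<in> unit_vector ` {1..r}"
    then obtain i where i: "i \<in> {1..r}" "x = unit_vector i" by blast
    have "0 = (\<Sum>j=1..r. scale_vec (u (unit_vector j)) (unit_vector j)) i"
      using zero by (simp add: sum.reindex[OF inj])
    also have "\<dots> = (\<Sum>j=1..r. if j = i then u x else 0)"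
      unfolding sum_vec_apply i(2)
      by (intro sum.cong) (auto simp: scale_vec_def unit_vector_def)
    also have "\<dots> = u x" using i by simp
    finally show "u x = 0" ..
  qed simp
  then have "cvec.dim (base_point r) = r"
    unfolding base_point_def coord_subspace_def
    by (simp add: cvec.dim_eq_card_independent card_image[OF inj])
  moreover have "base_point r \<subseteq> vecs h"
    using assms by (fastforce simp: base_point_eq vecs_def)
  moreover have "cvec.subspace (base_point r)"
    by (simp add: base_point_def coord_subspace_def)
  ultimately show ?thesis
    by (simp add: grassmannian_def)
qed

lemma base_point_in_lagrangian_grassmannian: "base_point r \<in> lagrangian_grassmannian r"
proof -
  have "base_point r = {v \<in> vecs (2 * r). \<forall>w\<in>base_point r. symplectic_form r v w = 0}"
  proof (intro set_eqI iffI)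
    fix v assume v: "v \<in> base_point r"
    have "v i * w (r + i) - v (r + i) * w i = 0" if "w \<in> base_point r" "i \<in> {1..r}" for w i
    proof -
      have "v (r + i) = 0" "w (r + i) = 0"
        using v that by (auto simp: base_point_eq)
      then show ?thesis by simp
    qed
    then have "symplectic_form r v w = 0" if "w \<in> base_point r" for w
      unfolding symplectic_form_def using that by (intro sum.neutral) blast
    moreover have "v \<in> vecs (2 * r)"
      using v by (fastforce simp: vecs_def base_point_eq)
    ultimately show "v \<in> {v \<in> vecs (2 * r). \<forall>w\<in>base_point r. symplectic_form r v w = 0}"
      by blast
  next
    fix v assume v: "v \<in> {v \<in> vecs (2 * r). \<forall>w\<in>base_point r. symplectic_form r v w = 0}"
    have "v (r + i) = 0" if i: "i \<in> {1..r}" for i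
    proof -
      have "0 = symplectic_form r v (unit_vector i)"
        using v i by (simp add: base_point_eq unit_vector_def)
      also have "\<dots> = (\<Sum>j=1..r. if j = i then - v (r + i) else 0)"
        unfolding symplectic_form_def
        using i by (intro sum.cong) (auto simp: unit_vector_def)
      also have "\<dots> = - v (r + i)" using i by simp
      finally show ?thesis by simp
    qed
    note zero = this
    have "i \<in> {1..r}" if "v i \<noteq> 0" for i
    proof (rule ccontr)
      assume "i \<notin> {1..r}"
      moreover have "i \<in> {1..2 * r}" using v that by (auto simp: vecs_def)
      ultimately have "v (r + (i - r)) = 0" by (intro zero) auto
      moreover have "r + (i - r) = i" using \<open>i \<notin> {1..r}\<close> \<open>i \<in> {1..2 * r}\<close> by auto
      ultimately show False using that by simp
    qed
    then show "v \<in> base_point r" by (simp add: base_point_eq)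
  qed
  moreover have "cvec.subspace (base_point r)"
    by (simp add: base_point_def coord_subspace_def)
  ultimately show ?thesis
    unfolding lagrangian_grassmannian_def by blast
qed

section \<open>Embeddings of the Lie algebras of the Grassmannians\<close>

text \<open>
  Moving the basis vectors along an injection \<open>\<iota>\<close> is multiplicative. Both embeddings are built from
  this operation: \<open>embed_sp\<close> is an instance of it, and \<open>embed_sl\<close> is the difference of its action on
  \<open>X\<close> and of its action, along the dual indices, on the transpose of \<open>X\<close>.
\<close>

definition relabel :: "nat \<Rightarrow> (nat \<Rightarrow> nat) \<Rightarrow> cmat \<Rightarrow> cmat" where
  "relabel h \<iota> X = (\<Sum>a=1..h. \<Sum>b=1..h. scale_mat (X a b) (unit_matrix (\<iota> a) (\<iota> b)))"

definition transp :: "cmat \<Rightarrow> cmat" where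
  "transp X = (\<lambda>i j. X j i)"

lemma transp_linear:
  "transp (X + Y) = transp X + transp Y" "transp (X - Y) = transp X - transp Y"
  "transp (scale_mat c X) = scale_mat c (transp X)"
  by (simp_all add: transp_def scale_mat_def fun_eq_iff)

lemma relabel_sum:
  "relabel h \<iota> X i j = (\<Sum>a=1..h. \<Sum>b=1..h. if i = \<iota> a \<and> j = \<iota> b then X a b else 0)"
  unfolding relabel_def sum_mat_apply
  by (intro sum.cong) (auto simp: scale_mat_def unit_matrix_def)

lemma relabel_image:
  assumes "inj_on \<iota> {1..h}" "a \<in> {1..h}" "b \<in> {1..h}"
  shows "relabel h \<iota> X (\<iota> a) (\<iota> b) = X a b"
proof -
  have "relabel h \<iota> X (\<iota> a) (\<iota> b) = (\<Sum>a'=1..h. \<Sum>b'=1..h. if a' = a \<and> b' = b then X a b else 0)"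
    unfolding relabel_sum using assms by (intro sum.cong) (auto simp: inj_on_eq_iff)
  also have "\<dots> = (\<Sum>a'=1..h. if a' = a then X a b else 0)"
    using assms(3) by (intro sum.cong) auto
  finally show ?thesis using assms(2) by simp
qed

lemma relabel_outside:
  assumes "i \<notin> \<iota> ` {1..h} \<or> j \<notin> \<iota> ` {1..h}"
  shows "relabel h \<iota> X i j = 0"
  unfolding relabel_sum using assms by (intro sum.neutral ballI) auto

lemma relabel_add: "relabel h \<iota> (X + Y) = relabel h \<iota> X + relabel h \<iota> Y"
  by (simp add: fun_eq_iff relabel_sum sum.distrib[symmetric]) (auto intro!: sum.cong)

lemma relabel_diff: "relabel h \<iota> (X - Y) = relabel h \<iota> X - relabel h \<iota> Y"
  by (simp add: fun_eq_iff relabel_sum sum_subtractf[symmetric]) (auto intro!: sum.cong)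

lemma relabel_scale: "relabel h \<iota> (scale_mat c X) = scale_mat c (relabel h \<iota> X)"
  by (auto simp: fun_eq_iff relabel_sum scale_mat_def sum_distrib_left intro!: sum.cong)

lemma relabel_support:
  "relabel h \<iota> X i j \<noteq> 0 \<Longrightarrow> \<exists>a\<in>{1..h}. \<exists>b\<in>{1..h}. i = \<iota> a \<and> j = \<iota> b"
  using relabel_outside[of i \<iota> h j X] by auto

lemma relabel_in_mats: "\<iota> ` {1..h} \<subseteq> {1..N} \<Longrightarrow> relabel h \<iota> X \<in> mats N"
  unfolding mats_def using relabel_support[of h \<iota> X] by blast

lemma mat_mult_relabel:
  assumes inj: "inj_on \<iota> {1..h}" and sub: "\<iota> ` {1..h} \<subseteq> {1..N}"
  shows "mat_mult N (relabel h \<iota> X) (relabel h \<iota> Y) = relabel h \<iota> (mat_mult h X Y)"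
proof (intro ext)
  fix i j
  show "mat_mult N (relabel h \<iota> X) (relabel h \<iota> Y) i j = relabel h \<iota> (mat_mult h X Y) i j"
  proof (cases "i \<in> \<iota> ` {1..h} \<and> j \<in> \<iota> ` {1..h}")
    case True
    then obtain a b where ab: "a \<in> {1..h}" "b \<in> {1..h}" "i = \<iota> a" "j = \<iota> b" by blast
    have "mat_mult N (relabel h \<iota> X) (relabel h \<iota> Y) i j
        = (\<Sum>k\<in>\<iota> ` {1..h}. relabel h \<iota> X i k * relabel h \<iota> Y k j)"
      unfolding mat_mult_def using sub by (intro sum.mono_neutral_right) (auto simp: relabel_outside)
    also have "\<dots> = (\<Sum>c=1..h. X a c * Y c b)"
      unfolding sum.reindex[OF inj] using ab by (intro sum.cong) (auto simp: relabel_image[OF inj])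
    finally show ?thesis
      using ab by (simp add: relabel_image[OF inj] mat_mult_def)
  next
    case False
    then have "relabel h \<iota> X i k * relabel h \<iota> Y k j = 0" for k
      using relabel_outside[of i \<iota> h k X] relabel_outside[of k \<iota> h j Y] by auto
    then have "mat_mult N (relabel h \<iota> X) (relabel h \<iota> Y) i j = 0"
      unfolding mat_mult_def by (intro sum.neutral ballI)
    moreover have "relabel h \<iota> (mat_mult h X Y) i j = 0"
      using False by (intro relabel_outside) blast
    ultimately show ?thesis by simp
  qed
qed

lemma mat_mult_relabel_disjoint:
  assumes "\<iota> ` {1..h} \<inter> \<kappa> ` {1..h} = {}"
  shows "mat_mult N (relabel h \<iota> X) (relabel h \<kappa> Y) = 0"
proof -
  have "relabel h \<iota> X i k * relabel h \<kappa> Y k j = 0" for i j k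
    using assms relabel_outside[of i \<iota> h k X] relabel_outside[of k \<kappa> h j Y] by (cases "k \<in> \<iota> ` {1..h}") auto
  then have "mat_mult N (relabel h \<iota> X) (relabel h \<kappa> Y) i j = 0" for i j
    unfolding mat_mult_def by (intro sum.neutral ballI)
  then show ?thesis
    by (simp add: fun_eq_iff)
qed

lemma mat_mult_transp: "mat_mult h (transp X) (transp Y) = transp (mat_mult h Y X)"
  by (simp add: mat_mult_def transp_def mult.commute)

lemma mat_mult_diff:
  "mat_mult N (A - B) (C - D) = mat_mult N A C - mat_mult N A D - (mat_mult N B C - mat_mult N B D)"
  by (simp add: mat_mult_def fun_eq_iff algebra_simps sum_subtractf sum.distrib)

lemma embed_sp_eq_relabel: "embed_sp r \<iota> X = relabel (2 * r) \<iota> X"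
  by (simp add: embed_sp_def relabel_def)

lemma embed_sl_eq_relabel:
  "embed_sl t l h \<iota> X = relabel h \<iota> X - relabel h (\<lambda>a. dual_index t l (\<iota> a)) (transp X)"
proof -
  have "relabel h (\<lambda>a. dual_index t l (\<iota> a)) (transp X)
      = (\<Sum>a=1..h. \<Sum>b=1..h. scale_mat (X a b) (unit_matrix (dual_index t l (\<iota> b)) (dual_index t l (\<iota> a))))"
    unfolding relabel_def transp_def by (rule sum.swap)
  then show ?thesis
    unfolding embed_sl_def relabel_def
    by (simp add: cmat.scale_right_diff_distrib sum_subtractf)
qed

text \<open>
  Mirroring exchanges the two summands of \<open>embed_sl\<close>, which enter with opposite signs; this is why
  the values of \<open>embed_sl\<close> are skew for the form.
\<close>

lemma relabel_dual:
  assumes \<iota>: "\<iota> ` {1..h} \<subseteq> {1..dim_V t l}" and ij: "i \<in> {1..dim_V t l}" "j \<in> {1..dim_V t l}"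
  shows "relabel h (\<lambda>a. dual_index t l (\<iota> a)) (transp X) (dual_index t l j) (dual_index t l i)
    = relabel h \<iota> X i j"
proof -
  have eq: "dual_index t l k = dual_index t l (\<iota> a) \<longleftrightarrow> k = \<iota> a"
    if "k \<in> {1..dim_V t l}" "a \<in> {1..h}" for k a
    using subsetD[OF \<iota> imageI[OF that(2)]] that(1) by (intro dual_index_inj)
  have "relabel h (\<lambda>a. dual_index t l (\<iota> a)) (transp X) (dual_index t l j) (dual_index t l i)
      = (\<Sum>a=1..h. \<Sum>b=1..h. if i = \<iota> b \<and> j = \<iota> a then X b a else 0)"
    unfolding relabel_sum transp_def using ij by (intro sum.cong) (auto simp: eq)
  also have "\<dots> = relabel h \<iota> X i j"
    unfolding relabel_sum by (rule sum.swap)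
  finally show ?thesis .
qed

text \<open>
  The hypotheses say that the basis vectors in the image of \<open>\<iota>\<close> span an isotropic subspace on which
  the form has constant sign, so that the contragredient action lives on a disjoint set of indices.
\<close>

locale isotropic_indices =
  fixes t :: lie_type and l h :: nat and \<iota> :: "nat \<Rightarrow> nat"
  assumes inj: "inj_on \<iota> {1..h}"
    and range: "\<iota> ` {1..h} \<subseteq> {1..dim_V t l}"
    and isotropic: "\<iota> ` {1..h} \<inter> (\<lambda>a. dual_index t l (\<iota> a)) ` {1..h} = {}"
    and sign: "\<And>a b. a \<in> {1..h} \<Longrightarrow> b \<in> {1..h} \<Longrightarrow> form_sign t l (\<iota> a) * form_sign t l (\<iota> b) = 1"
begin

abbreviation "\<kappa> \<equiv> \<lambda>a. dual_index t l (\<iota> a)"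
abbreviation "\<phi> \<equiv> embed_sl t l h \<iota>"

lemma index: "a \<in> {1..h} \<Longrightarrow> \<iota> a \<in> {1..dim_V t l}"
  by (rule subsetD[OF range imageI])

lemma inj_dual: "inj_on \<kappa> {1..h}"
proof (rule inj_onI)
  fix a b assume ab: "a \<in> {1..h}" "b \<in> {1..h}" "\<kappa> a = \<kappa> b"
  then have "\<iota> a = \<iota> b" by (simp add: dual_index_inj[OF index index])
  then show "a = b" using ab(1,2) by (rule inj_onD[OF inj])
qed

lemma isotropic_dual: "\<kappa> ` {1..h} \<inter> \<iota> ` {1..h} = {}"
  by (subst Int_commute) (rule isotropic)

lemma range_dual: "\<kappa> ` {1..h} \<subseteq> {1..dim_V t l}"
  by (intro image_subsetI dual_index_in index)

lemma embed_sl_image: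
  assumes "a \<in> {1..h}" "b \<in> {1..h}"
  shows "\<phi> X (\<iota> a) (\<iota> b) = X a b"
proof -
  have "\<iota> a \<notin> \<kappa> ` {1..h}" using isotropic assms by blast
  then show ?thesis
    by (simp add: embed_sl_eq_relabel relabel_image[OF inj assms] relabel_outside)
qed

lemma embed_sl_support:
  assumes "\<phi> X i j \<noteq> 0"
  shows "\<exists>a\<in>{1..h}. \<exists>b\<in>{1..h}. X a b \<noteq> 0 \<and> ((i, j) = (\<iota> a, \<iota> b) \<or> (i, j) = (\<kappa> b, \<kappa> a))"
proof -
  have "relabel h \<iota> X i j \<noteq> 0 \<or> relabel h \<kappa> (transp X) i j \<noteq> 0"
    using assms by (auto simp: embed_sl_eq_relabel)
  then show ?thesis
  proof
    assume nz: "relabel h \<iota> X i j \<noteq> 0"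
    then obtain a b where "a \<in> {1..h}" "b \<in> {1..h}" "i = \<iota> a" "j = \<iota> b"
      using relabel_support by blast
    then have "X a b \<noteq> 0" using nz relabel_image[OF inj] by simp
    then show ?thesis using \<open>a \<in> {1..h}\<close> \<open>b \<in> {1..h}\<close> \<open>i = \<iota> a\<close> \<open>j = \<iota> b\<close> by blast
  next
    assume nz: "relabel h \<kappa> (transp X) i j \<noteq> 0"
    then obtain a b where "a \<in> {1..h}" "b \<in> {1..h}" "i = \<kappa> a" "j = \<kappa> b"
      using relabel_support by blast
    then have "X b a \<noteq> 0" using nz relabel_image[OF inj_dual] by (simp add: transp_def)
    then show ?thesis using \<open>a \<in> {1..h}\<close> \<open>b \<in> {1..h}\<close> \<open>i = \<kappa> a\<close> \<open>j = \<kappa> b\<close> by blast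
  qed
qed

lemma embed_sl_in_classical_lie: "\<phi> X \<in> classical_lie t l"
  unfolding classical_lie_iff
proof (intro conjI ballI)
  show "\<phi> X \<in> mats (dim_V t l)"
    unfolding embed_sl_eq_relabel
    by (intro cmat.subspace_diff[OF subspace_mats] relabel_in_mats range range_dual)
next
  fix i j assume ij: "i \<in> {1..dim_V t l}" "j \<in> {1..dim_V t l}"
  have "relabel h \<iota> X (dual_index t l j) (dual_index t l i) = relabel h \<kappa> (transp X) i j"
    using relabel_dual[OF range dual_index_in[OF ij(2)] dual_index_in[OF ij(1)]] ij
    by (simp add: dual_index_dual)
  then have "\<phi> X (dual_index t l j) (dual_index t l i) = - \<phi> X i j"
    using relabel_dual[OF range ij] by (simp add: embed_sl_eq_relabel)
  moreover have "form_sign t l i * form_sign t l j = 1" if "\<phi> X i j \<noteq> 0"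
  proof -
    obtain a b where ab: "a \<in> {1..h}" "b \<in> {1..h}" and "(i, j) = (\<iota> a, \<iota> b) \<or> (i, j) = (\<kappa> b, \<kappa> a)"
      using embed_sl_support[OF \<open>\<phi> X i j \<noteq> 0\<close>] by blast
    then show ?thesis
      using sign[OF ab] sign[OF ab(2,1)] form_sign_dual[OF index[OF ab(2)] index[OF ab(1)]] by auto
  qed
  ultimately show "\<phi> X (dual_index t l j) (dual_index t l i)
      = - (form_sign t l i * form_sign t l j * \<phi> X i j)"
    by (cases "\<phi> X i j = 0") simp_all
qed

text \<open>
  The two summands act on disjoint sets of indices, so their products do not mix. Transposition
  reverses products, and the negative sign of the second summand turns the reversed commutator back.
\<close>

lemma lie_embedding_embed_sl: "lie_embedding h (sl h) (dim_V t l) (classical_lie t l) \<phi>"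
  unfolding lie_embedding_def
proof (intro conjI ballI)
  show "Vector_Spaces.linear scale_mat scale_mat \<phi>"
    unfolding Vector_Spaces.linear_iff
  proof (intro conjI allI cmat.vector_space_axioms)
    show "\<phi> (X + Y) = \<phi> X + \<phi> Y" for X Y
      by (simp add: embed_sl_eq_relabel transp_linear relabel_add)
    show "\<phi> (scale_mat c X) = scale_mat c (\<phi> X)" for c X
      by (simp add: embed_sl_eq_relabel transp_linear relabel_scale cmat.scale_right_diff_distrib)
  qed
  show "inj_on \<phi> (sl h)"
  proof (rule inj_onI, intro ext)
    fix X Y a b assume X: "X \<in> sl h" and Y: "Y \<in> sl h" and eq: "\<phi> X = \<phi> Y"
    show "X a b = Y a b"
    proof (cases "a \<in> {1..h} \<and> b \<in> {1..h}")
      case True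
      then show ?thesis using embed_sl_image[of a b X] embed_sl_image[of a b Y] eq by simp
    next
      case False
      then have "X a b = 0" "Y a b = 0" using X Y by (auto simp: sl_def mats_def)
      then show ?thesis by simp
    qed
  qed
  show "\<phi> ` sl h \<subseteq> classical_lie t l"
    using embed_sl_in_classical_lie by blast
  fix X Y
  have prod: "mat_mult (dim_V t l) (\<phi> X) (\<phi> Y)
      = relabel h \<iota> (mat_mult h X Y) + relabel h \<kappa> (transp (mat_mult h Y X))" for X Y
    unfolding embed_sl_eq_relabel mat_mult_diff mat_mult_relabel[OF inj range]
      mat_mult_relabel[OF inj_dual range_dual] mat_mult_relabel_disjoint[OF isotropic]
      mat_mult_relabel_disjoint[OF isotropic_dual] mat_mult_transp
    by simp
  show "\<phi> (bracket h X Y) = bracket (dim_V t l) (\<phi> X) (\<phi> Y)"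
    unfolding bracket_def prod by (simp add: embed_sl_eq_relabel relabel_diff transp_linear)
qed

lemma embed_sl_cartan: "\<phi> ` cartan (sl h) \<subseteq> cartan (classical_lie t l)"
proof
  fix Y assume "Y \<in> \<phi> ` cartan (sl h)"
  then obtain X where X: "X \<in> cartan (sl h)" "Y = \<phi> X" by blast
  have "i = j" if nz: "\<phi> X i j \<noteq> 0" for i j
  proof -
    obtain a b where "X a b \<noteq> 0" "(i, j) = (\<iota> a, \<iota> b) \<or> (i, j) = (\<kappa> b, \<kappa> a)"
      using embed_sl_support[OF nz] by blast
    moreover from this have "a = b" using X(1) by (auto simp: cartan_def)
    ultimately show ?thesis by auto
  qed
  then show "Y \<in> cartan (classical_lie t l)"
    using embed_sl_in_classical_lie X(2) by (auto simp: cartan_def)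
qed

text \<open>
  Surjectivity: an element supported in the target block is determined by its entries in the first
  half of the block, since the second half is the mirror image, and these entries can be prescribed.
\<close>

lemma embed_sl_block:
  assumes "r \<le> h"
  shows "\<phi> ` {X \<in> sl h. \<forall>i j. X i j \<noteq> 0 \<longrightarrow> (i, j) \<in> {r + 1..h} \<times> {1..r}}
    = supported_in t l (\<iota> ` {r + 1..h} \<times> \<iota> ` {1..r} \<union> \<kappa> ` {1..r} \<times> \<kappa> ` {r + 1..h})"
    (is "\<phi> ` ?U = supported_in t l ?P")
proof
  show "\<phi> ` ?U \<subseteq> supported_in t l ?P"
  proof
    fix Y assume "Y \<in> \<phi> ` ?U"
    then obtain X where X: "X \<in> ?U" "Y = \<phi> X" by blast
    have "(i, j) \<in> ?P" if "\<phi> X i j \<noteq> 0" for i j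
    proof -
      obtain a b where "X a b \<noteq> 0" and ij: "(i, j) = (\<iota> a, \<iota> b) \<or> (i, j) = (\<kappa> b, \<kappa> a)"
        using embed_sl_support[OF \<open>\<phi> X i j \<noteq> 0\<close>] by blast
      then have "a \<in> {r + 1..h}" "b \<in> {1..r}" using X(1) by auto
      then show ?thesis using ij by blast
    qed
    then show "Y \<in> supported_in t l ?P"
      using embed_sl_in_classical_lie X(2) by (simp add: supported_in_def)
  qed
  show "supported_in t l ?P \<subseteq> \<phi> ` ?U"
  proof
    fix Y assume Y: "Y \<in> supported_in t l ?P"
    then have Yg: "Y \<in> classical_lie t l" by (simp add: supported_in_def)
    define X where "X = (\<lambda>a b. if (a, b) \<in> {r + 1..h} \<times> {1..r} then Y (\<iota> a) (\<iota> b) else 0)"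
    have X: "X \<in> ?U"
      using assms by (auto simp: X_def sl_def mats_def intro!: sum.neutral)
    define D where "D = Y - \<phi> X"
    have "\<phi> X \<in> supported_in t l ?P"
      using X \<open>\<phi> ` ?U \<subseteq> supported_in t l ?P\<close> by blast
    then have D: "D \<in> supported_in t l ?P"
      unfolding D_def by (intro cmat.subspace_diff[OF subspace_supported_in] Y)
    then have Dg: "D \<in> classical_lie t l" by (simp add: supported_in_def)
    have D0: "D (\<iota> a) (\<iota> b) = 0" if "a \<in> {r + 1..h}" "b \<in> {1..r}" for a b
      using that assms embed_sl_image[of a b X] by (simp add: D_def X_def)
    have "D i j = 0" for i j
    proof (rule ccontr)
      assume nz: "D i j \<noteq> 0"
      then have "(i, j) \<in> ?P" using D by (auto simp: supported_in_def)
      then consider a b where "a \<in> {r + 1..h}" "b \<in> {1..r}" "(i, j) = (\<iota> a, \<iota> b)"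
        | a b where "a \<in> {r + 1..h}" "b \<in> {1..r}" "(i, j) = (\<kappa> b, \<kappa> a)"
        by blast
      then show False
      proof cases
        case 1
        then show False using D0[OF 1(1,2)] nz by simp
      next
        case 2
        have "a \<in> {1..h}" "b \<in> {1..h}" using 2 assms by auto
        then have "D (\<kappa> b) (\<kappa> a) = 0"
          using classical_lie_dual[OF Dg index index] D0[OF 2(1,2)] by simp
        then show False using 2 nz by simp
      qed
    qed
    then have "Y = \<phi> X" by (simp add: D_def fun_eq_iff)
    then show "Y \<in> \<phi> ` ?U" using X by (rule image_eqI)
  qed
qed

lemma tangent_grassmannian_A_embed_sl:
  assumes r: "r \<le> h"
  shows "tangent_grassmannian_A (dim_V t l) (classical_lie t l)
    (supported_in t l (\<iota> ` {r + 1..h} \<times> \<iota> ` {1..r} \<union> \<kappa> ` {1..r} \<times> \<kappa> ` {r + 1..h})) r h \<phi>"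
  unfolding tangent_grassmannian_A_def Let_def opposite_unipotent_radical_sl[OF r] embed_sl_block[OF r]
  by (intro conjI impI base_point_in_grassmannian[OF r] lie_embedding_embed_sl embed_sl_cartan refl
      maximal_parabolic_stabilizer) simp_all

end

text \<open>
  If \<open>\<iota>\<close> commutes with duality and preserves the sign of the form, then it embeds the smaller symplectic
  space isometrically, and relabelling carries skew matrices to skew matrices.
\<close>

lemma tangent_grassmannian_C_embed_sp:
  assumes inj: "inj_on \<iota> {1..2 * r}" and range: "\<iota> ` {1..2 * r} \<subseteq> {1..2 * l}"
    and dual: "\<And>a. a \<in> {1..2 * r} \<Longrightarrow> \<iota> (dual_index TypeC r a) = dual_index TypeC l (\<iota> a)"
    and sign: "\<And>a. a \<in> {1..2 * r} \<Longrightarrow> form_sign TypeC l (\<iota> a) = form_sign TypeC r a"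
  shows "tangent_grassmannian_C (2 * l) (classical_lie TypeC l)
    (supported_in TypeC l (\<iota> ` {r + 1..2 * r} \<times> \<iota> ` {1..r})) r (embed_sp r \<iota>)"
proof -
  let ?\<phi> = "relabel (2 * r) \<iota>" and ?sp = "classical_lie TypeC r" and ?g = "classical_lie TypeC l"
  let ?U = "{X \<in> ?sp. \<forall>i j. X i j \<noteq> 0 \<longrightarrow> (i, j) \<in> {r + 1..2 * r} \<times> {1..r}}"
  let ?P = "\<iota> ` {r + 1..2 * r} \<times> \<iota> ` {1..r}"
  have dim: "dim_V TypeC n = 2 * n" for n by simp
  have sp_mats: "?sp \<subseteq> mats (2 * r)"
    using classical_lie_mats[of TypeC r] by simp
  have \<iota>: "\<iota> a \<in> {1..2 * l}" if "a \<in> {1..2 * r}" for a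
    using that range by blast
  have phi_g: "?\<phi> X \<in> ?g" if X: "X \<in> ?sp" for X
    unfolding classical_lie_iff dim
  proof (intro conjI ballI)
    show "?\<phi> X \<in> mats (2 * l)" by (rule relabel_in_mats[OF range])
    fix i j assume ij: "i \<in> {1..2 * l}" "j \<in> {1..2 * l}"
    show "?\<phi> X (dual_index TypeC l j) (dual_index TypeC l i)
        = - (form_sign TypeC l i * form_sign TypeC l j * ?\<phi> X i j)"
    proof (cases "i \<in> \<iota> ` {1..2 * r} \<and> j \<in> \<iota> ` {1..2 * r}")
      case True
      then obtain a b where ab: "a \<in> {1..2 * r}" "b \<in> {1..2 * r}" "i = \<iota> a" "j = \<iota> b" by blast
      have ab': "dual_index TypeC r a \<in> {1..2 * r}" "dual_index TypeC r b \<in> {1..2 * r}"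
        using ab dual_index_in[of _ TypeC r] by auto
      have "?\<phi> X (dual_index TypeC l j) (dual_index TypeC l i)
          = X (dual_index TypeC r b) (dual_index TypeC r a)"
        using relabel_image[OF inj ab'(2,1)] ab by (simp add: dual)
      also have "\<dots> = - (form_sign TypeC r a * form_sign TypeC r b * X a b)"
        using ab by (intro classical_lie_dual[OF X]) auto
      finally show ?thesis
        using ab relabel_image[OF inj ab(1,2)] by (simp add: sign)
    next
      case False
      have "k \<in> \<iota> ` {1..2 * r}" if dk: "dual_index TypeC l k \<in> \<iota> ` {1..2 * r}" and k: "k \<in> {1..2 * l}" for k
      proof -
        obtain a where a: "a \<in> {1..2 * r}" "dual_index TypeC l k = \<iota> a" using dk by blast
        have "k = \<iota> (dual_index TypeC r a)"
          using dual[OF a(1)] a(2) dual_index_dual[of k TypeC l] k by simp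
        then show ?thesis using dual_index_in[of a TypeC r] a(1) by auto
      qed
      then have "dual_index TypeC l i \<notin> \<iota> ` {1..2 * r} \<or> dual_index TypeC l j \<notin> \<iota> ` {1..2 * r}"
        using False ij by blast
      then have "?\<phi> X (dual_index TypeC l j) (dual_index TypeC l i) = 0"
        by (intro relabel_outside) blast
      moreover have "?\<phi> X i j = 0" using False by (intro relabel_outside) blast
      ultimately show ?thesis by simp
    qed
  qed
  have support: "\<exists>a\<in>{1..2 * r}. \<exists>b\<in>{1..2 * r}. X a b \<noteq> 0 \<and> (i, j) = (\<iota> a, \<iota> b)"
    if nz: "?\<phi> X i j \<noteq> 0" for X i j
  proof -
    obtain a b where ab: "a \<in> {1..2 * r}" "b \<in> {1..2 * r}" "i = \<iota> a" "j = \<iota> b"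
      using relabel_support[OF nz] by blast
    moreover have "X a b \<noteq> 0"
      using nz relabel_image[OF inj ab(1,2), of X] unfolding ab by simp
    ultimately show ?thesis by blast
  qed
  have "lie_embedding (2 * r) ?sp (2 * l) ?g ?\<phi>"
    unfolding lie_embedding_def
  proof (intro conjI ballI)
    show "Vector_Spaces.linear scale_mat scale_mat ?\<phi>"
      unfolding Vector_Spaces.linear_iff
      by (intro conjI allI cmat.vector_space_axioms relabel_add relabel_scale)
    show "inj_on ?\<phi> ?sp"
    proof (rule inj_onI, intro ext)
      fix X Y a b assume X: "X \<in> ?sp" and Y: "Y \<in> ?sp" and eq: "?\<phi> X = ?\<phi> Y"
      show "X a b = Y a b"
      proof (cases "a \<in> {1..2 * r} \<and> b \<in> {1..2 * r}")
        case True
        then show ?thesis using relabel_image[OF inj, of a b X] relabel_image[OF inj, of a b Y] eq by simp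
      next
        case False
        then have "X a b = 0" "Y a b = 0" using X Y sp_mats unfolding mats_def by blast+
        then show ?thesis by simp
      qed
    qed
    show "?\<phi> ` ?sp \<subseteq> ?g" using phi_g by blast
    show "?\<phi> (bracket (2 * r) X Y) = bracket (2 * l) (?\<phi> X) (?\<phi> Y)" for X Y
      unfolding bracket_def by (simp add: mat_mult_relabel[OF inj range] relabel_diff)
  qed
  moreover have "?\<phi> ` cartan ?sp \<subseteq> cartan ?g"
  proof
    fix Y assume "Y \<in> ?\<phi> ` cartan ?sp"
    then obtain X where X: "X \<in> cartan ?sp" "Y = ?\<phi> X" by blast
    have "i = j" if nz: "?\<phi> X i j \<noteq> 0" for i j
    proof -
      obtain a b where "X a b \<noteq> 0" "(i, j) = (\<iota> a, \<iota> b)"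
        using support[OF nz] by blast
      moreover from this have "a = b" using X(1) by (auto simp: cartan_def)
      ultimately show ?thesis by simp
    qed
    then show "Y \<in> cartan ?g"
      using phi_g X by (auto simp: cartan_def)
  qed
  moreover have "?\<phi> ` ?U = supported_in TypeC l ?P"
  proof
    show "?\<phi> ` ?U \<subseteq> supported_in TypeC l ?P"
    proof
      fix Y assume "Y \<in> ?\<phi> ` ?U"
      then obtain X where X: "X \<in> ?U" "Y = ?\<phi> X" by blast
      have "(i, j) \<in> ?P" if "?\<phi> X i j \<noteq> 0" for i j
        using support[OF that] X(1) by auto
      then show "Y \<in> supported_in TypeC l ?P"
        using phi_g X by (simp add: supported_in_def)
    qed
    show "supported_in TypeC l ?P \<subseteq> ?\<phi> ` ?U"
    proof
      fix Y assume Y: "Y \<in> supported_in TypeC l ?P"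
      then have Yg: "Y \<in> ?g" and Y0: "\<And>i j. Y i j \<noteq> 0 \<Longrightarrow> (i, j) \<in> ?P"
        by (auto simp: supported_in_def)
      define X where "X = (\<lambda>a b. if a \<in> {1..2 * r} \<and> b \<in> {1..2 * r} then Y (\<iota> a) (\<iota> b) else 0)"
      have "X \<in> ?sp"
        unfolding classical_lie_iff dim
      proof (intro conjI ballI)
        show "X \<in> mats (2 * r)" by (auto simp: mats_def X_def)
        fix a b assume ab: "a \<in> {1..2 * r}" "b \<in> {1..2 * r}"
        have ab': "dual_index TypeC r a \<in> {1..2 * r}" "dual_index TypeC r b \<in> {1..2 * r}"
          using ab dual_index_in[of _ TypeC r] by auto
        have "Y (dual_index TypeC l (\<iota> b)) (dual_index TypeC l (\<iota> a))
            = - (form_sign TypeC l (\<iota> a) * form_sign TypeC l (\<iota> b) * Y (\<iota> a) (\<iota> b))"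
          using \<iota> ab by (intro classical_lie_dual[OF Yg]) auto
        then show "X (dual_index TypeC r b) (dual_index TypeC r a)
            = - (form_sign TypeC r a * form_sign TypeC r b * X a b)"
          using ab ab' by (simp add: X_def dual sign)
      qed
      moreover have "(a, b) \<in> {r + 1..2 * r} \<times> {1..r}" if "X a b \<noteq> 0" for a b
      proof -
        have ab: "a \<in> {1..2 * r}" "b \<in> {1..2 * r}" and nz: "Y (\<iota> a) (\<iota> b) \<noteq> 0"
          using that by (auto simp: X_def split: if_splits)
        then obtain a' b' where "a' \<in> {r + 1..2 * r}" "b' \<in> {1..r}" "\<iota> a = \<iota> a'" "\<iota> b = \<iota> b'"
          using Y0[OF nz] by blast
        moreover from this have "a = a'" "b = b'"
          using ab by (auto intro!: inj_onD[OF inj])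
        ultimately show ?thesis by simp
      qed
      ultimately have "X \<in> ?U" by blast
      moreover have "Y = ?\<phi> X"
      proof (intro ext)
        fix i j
        show "Y i j = ?\<phi> X i j"
        proof (cases "i \<in> \<iota> ` {1..2 * r} \<and> j \<in> \<iota> ` {1..2 * r}")
          case True
          then obtain a b where "a \<in> {1..2 * r}" "b \<in> {1..2 * r}" "i = \<iota> a" "j = \<iota> b" by blast
          then show ?thesis by (simp add: relabel_image[OF inj] X_def)
        next
          case False
          have "{r + 1..2 * r} \<subseteq> {1..2 * r}" "{1..r} \<subseteq> {1..2 * r}" by auto
          then have "Y i j = 0" using Y0[of i j] False by blast
          then show ?thesis using False relabel_outside[of i \<iota> "2 * r" j X] by auto
        qed
      qed
      ultimately show "Y \<in> ?\<phi> ` ?U" by blast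
    qed
  qed
  ultimately show ?thesis
    unfolding tangent_grassmannian_C_def Let_def opposite_unipotent_radical_sp
    using base_point_in_lagrangian_grassmannian by (simp add: embed_sp_eq_relabel[abs_def])
qed

lemma join_blocks_image:
  "join_blocks r p q ` {1..r} = {p + 1..p + r}"
  "join_blocks r p q ` {r + 1..r + r'} = {q + 1..q + r'}"
proof -
  have "join_blocks r p q ` {1..r} = (\<lambda>a. p + a) ` {1..r}"
    by (intro image_cong) (auto simp: join_blocks_def)
  then show "join_blocks r p q ` {1..r} = {p + 1..p + r}"
    by simp
  have "join_blocks r p q ` {r + 1..r + r'} = join_blocks r p q ` (\<lambda>a. r + a) ` {1..r'}"
    by (simp add: add.commute)
  also have "\<dots> = (\<lambda>a. q + a) ` {1..r'}"
    unfolding image_image by (intro image_cong) (auto simp: join_blocks_def)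
  finally show "join_blocks r p q ` {r + 1..r + r'} = {q + 1..q + r'}"
    by simp
qed

lemma join_blocks_range:
  "join_blocks r p q ` {1..r + r'} = {p + 1..p + r} \<union> {q + 1..q + r'}"
proof -
  have "{1..r + r'} = {1..r} \<union> {r + 1..r + r'}" by auto
  then show ?thesis
    using join_blocks_image[of r p q] join_blocks_image(2)[of r p q r'] by (simp only: image_Un)
qed

lemma join_blocks_inj:
  assumes "{p + 1..p + r} \<inter> {q + 1..q + r'} = {}"
  shows "inj_on (join_blocks r p q) {1..r + r'}"
proof (rule eq_card_imp_inj_on)
  show "card (join_blocks r p q ` {1..r + r'}) = card {1..r + r'}"
    unfolding join_blocks_range using assms by (subst card_Un_disjoint) auto
qed simp

lemma tangent_grassmannian_A_join_blocks:
  fixes t :: lie_type and l p q r r' :: nat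
  defines "J \<equiv> {p + 1..p + r}" and "K \<equiv> {q + 1..q + r'}"
  assumes disj: "J \<inter> K = {}" and range: "J \<union> K \<subseteq> {1..dim_V t l}"
    and isotropic: "(J \<union> K) \<inter> dual_index t l ` (J \<union> K) = {}"
    and sign: "\<And>i j. i \<in> J \<union> K \<Longrightarrow> j \<in> J \<union> K \<Longrightarrow> form_sign t l i * form_sign t l j = 1"
  shows "tangent_grassmannian_A (dim_V t l) (classical_lie t l)
    (supported_in t l (K \<times> J \<union> dual_index t l ` J \<times> dual_index t l ` K)) r (r + r')
    (embed_sl t l (r + r') (join_blocks r p q))"
proof -
  let ?\<iota> = "join_blocks r p q"
  have img: "?\<iota> ` {1..r} = J" "?\<iota> ` {r + 1..r + r'} = K" "?\<iota> ` {1..r + r'} = J \<union> K"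
    unfolding J_def K_def by (rule join_blocks_image join_blocks_range)+
  have dual_img: "(\<lambda>a. dual_index t l (?\<iota> a)) ` A = dual_index t l ` ?\<iota> ` A" for A
    by (simp add: image_image)
  interpret isotropic_indices t l "r + r'" ?\<iota>
  proof
    show "inj_on ?\<iota> {1..r + r'}"
      using disj unfolding J_def K_def by (rule join_blocks_inj)
    show "?\<iota> ` {1..r + r'} \<subseteq> {1..dim_V t l}"
      using range by (simp only: img)
    show "?\<iota> ` {1..r + r'} \<inter> (\<lambda>a. dual_index t l (?\<iota> a)) ` {1..r + r'} = {}"
      using isotropic by (simp only: img dual_img)
    show "form_sign t l (?\<iota> a) * form_sign t l (?\<iota> b) = 1"
      if "a \<in> {1..r + r'}" "b \<in> {1..r + r'}" for a b
      using that img(3) by (intro sign) blast+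
  qed
  show ?thesis
    using tangent_grassmannian_A_embed_sl[of r] by (simp only: img dual_img le_add1 simp_thms)
qed


section \<open>Direct sums of spaces of matrices with prescribed support\<close>

text \<open>
  A set of positions closed under the symmetry of the Lie algebra cuts out a summand: setting all
  other entries to 0 does not leave the Lie algebra.
\<close>

lemma direct_sum_supported_in:
  assumes disj: "sorted_wrt disjnt Ps"
    and range: "\<And>P. P \<in> set Ps \<Longrightarrow> P \<subseteq> {1..dim_V t l} \<times> {1..dim_V t l}"
    and sym: "\<And>P i j. P \<in> set Ps \<Longrightarrow> (i, j) \<in> P \<Longrightarrow> (dual_index t l j, dual_index t l i) \<in> P"
  shows "direct_sum (supported_in t l (\<Union>(set Ps))) (map (supported_in t l) Ps)"
proof -
  let ?n = "length Ps"
  define cut :: "cmat \<Rightarrow> nat \<Rightarrow> cmat" where "cut X k = (\<lambda>i j. if (i, j) \<in> Ps ! k then X i j else 0)" for X k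
  have unique: "k = k'" if "k < ?n" "k' < ?n" "p \<in> Ps ! k" "p \<in> Ps ! k'" for k k' p
    using disj that unfolding sorted_wrt_iff_nth_less disjnt_iff by (metis linorder_neqE_nat)
  have cut_in: "cut X k \<in> supported_in t l (Ps ! k)" if X: "X \<in> classical_lie t l" and k: "k < ?n" for X k
  proof -
    have P: "Ps ! k \<in> set Ps" using k by simp
    have iff: "(dual_index t l j, dual_index t l i) \<in> Ps ! k \<longleftrightarrow> (i, j) \<in> Ps ! k"
      if "i \<in> {1..dim_V t l}" "j \<in> {1..dim_V t l}" for i j
      using sym[OF P, of i j] sym[OF P, of "dual_index t l j" "dual_index t l i"] that
      by (auto simp: dual_index_dual)
    have "cut X k \<in> classical_lie t l"
      unfolding classical_lie_iff
    proof (intro conjI ballI)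
      show "cut X k \<in> mats (dim_V t l)"
        using X classical_lie_mats by (fastforce simp: cut_def mats_def)
      fix i j assume ij: "i \<in> {1..dim_V t l}" "j \<in> {1..dim_V t l}"
      show "cut X k (dual_index t l j) (dual_index t l i)
          = - (form_sign t l i * form_sign t l j * cut X k i j)"
        using classical_lie_dual[OF X ij] by (simp add: cut_def iff[OF ij])
    qed
    then show ?thesis by (simp add: supported_in_def cut_def)
  qed
  have entry: "(\<Sum>k<?n. x k) i j = x k0 i j"
    if x: "\<And>k. k < ?n \<Longrightarrow> x k \<in> supported_in t l (Ps ! k)" and k0: "k0 < ?n" "(i, j) \<in> Ps ! k0" for x i j k0
  proof -
    have "x k i j = 0" if "k < ?n" "k \<noteq> k0" for k
      using x[OF that(1)] unique[OF that(1) k0(1) _ k0(2)] that(2) by (auto simp: supported_in_def)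
    then have "(\<Sum>k<?n. x k) i j = (\<Sum>k<?n. if k = k0 then x k0 i j else 0)"
      unfolding sum_mat_apply by (intro sum.cong) auto
    then show ?thesis using k0(1) by simp
  qed
  have sub: "supported_in t l (Ps ! k) \<subseteq> supported_in t l (\<Union>(set Ps))" if "k < ?n" for k
  proof -
    have "Ps ! k \<subseteq> \<Union>(set Ps)" using that by (intro Union_upper) simp
    then show ?thesis unfolding supported_in_def by blast
  qed
  show ?thesis
    unfolding direct_sum_def length_map
  proof (intro conjI allI impI)
    show "cmat.subspace (map (supported_in t l) Ps ! k)" if "k < ?n" for k
      using that by (simp add: subspace_supported_in)
    show "supported_in t l (\<Union>(set Ps)) = {\<Sum>k<?n. x k | x. \<forall>k<?n. x k \<in> map (supported_in t l) Ps ! k}"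
    proof (intro set_eqI iffI)
      fix X assume X: "X \<in> supported_in t l (\<Union>(set Ps))"
      then have Xg: "X \<in> classical_lie t l" by (simp add: supported_in_def)
      have "X = (\<Sum>k<?n. cut X k)"
      proof (intro ext)
        fix i j
        show "X i j = (\<Sum>k<?n. cut X k) i j"
        proof (cases "X i j = 0")
          case True
          then show ?thesis by (simp add: sum_mat_apply cut_def cong: if_cong)
        next
          case False
          then obtain P where "P \<in> set Ps" "(i, j) \<in> P" using X by (auto simp: supported_in_def)
          then obtain k0 where k0: "k0 < ?n" "(i, j) \<in> Ps ! k0" by (auto simp: in_set_conv_nth)
          then show ?thesis
            using entry[of "cut X" k0 i j] cut_in[OF Xg] by (simp add: cut_def)
        qed
      qed
      moreover have "\<forall>k<?n. cut X k \<in> map (supported_in t l) Ps ! k"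
        using cut_in[OF Xg] by simp
      ultimately show "X \<in> {\<Sum>k<?n. x k | x. \<forall>k<?n. x k \<in> map (supported_in t l) Ps ! k}"
        by blast
    next
      fix X assume "X \<in> {\<Sum>k<?n. x k | x. \<forall>k<?n. x k \<in> map (supported_in t l) Ps ! k}"
      then obtain x where x: "X = (\<Sum>k<?n. x k)" "\<forall>k<?n. x k \<in> map (supported_in t l) Ps ! k"
        by blast
      have "x k \<in> supported_in t l (\<Union>(set Ps))" if "k < ?n" for k
        using x(2) that sub[OF that] by auto
      then show "X \<in> supported_in t l (\<Union>(set Ps))"
        unfolding x(1) by (intro cmat.subspace_sum[OF subspace_supported_in]) simp
    qed
  next
    fix x k
    assume x: "(\<forall>k<?n. x k \<in> map (supported_in t l) Ps ! k) \<and> (\<Sum>k<?n. x k) = 0" and k: "k < ?n"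
    have x': "x k \<in> supported_in t l (Ps ! k)" if "k < ?n" for k
      using x that by simp
    show "x k = 0"
    proof (rule ccontr)
      assume "x k \<noteq> 0"
      then obtain i j where nz: "x k i j \<noteq> 0" by (auto simp: fun_eq_iff)
      then have "(i, j) \<in> Ps ! k" using x'[OF k] by (auto simp: supported_in_def)
      then have "(\<Sum>k<?n. x k) i j = x k i j" using entry[of x] x' k by blast
      then show False using x nz by simp
    qed
  qed
qed


section \<open>The index sets of the Hodge decomposition\<close>

text \<open>
  The intervals are listed with even indices first; \<open>block_before\<close> is this order, and each
  interval starts after the total size of its predecessors.
\<close>

definition block_before :: "nat \<Rightarrow> nat \<Rightarrow> bool" where
  "block_before j k \<longleftrightarrow> (even j \<and> odd k) \<or> (even j = even k \<and> j < k)"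

lemma block_start_eq:
  assumes "k \<le> m"
  shows "block_start t m f k = (\<Sum>j | j \<le> m \<and> block_before j k. block_size t m f j)"
proof (cases "even k")
  case True
  have "{j. j < k \<and> even j} = {j. j \<le> m \<and> block_before j k}"
    using assms True by (auto simp: block_before_def)
  then show ?thesis using True by (simp add: block_start_def)
next
  case False
  have "{j. j \<le> m \<and> block_before j k} = {j. j \<le> m \<and> even j} \<union> {j. j < k \<and> odd j}"
    using assms False by (auto simp: block_before_def)
  moreover have "finite {j. j \<le> m \<and> even j}" "finite {j. j < k \<and> odd j}"
    by (auto intro: finite_subset[of _ "{..m}"] finite_subset[of _ "{..<k}"])
  moreover have "{j. j \<le> m \<and> even j} \<inter> {j. j < k \<and> odd j} = {}" by auto
  ultimately show ?thesis
    using False by (simp add: block_start_def sum.union_disjoint)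
qed

lemma block_end_le_start:
  assumes "j \<le> m" "k \<le> m" "block_before j k"
  shows "block_start t m f j + block_size t m f j \<le> block_start t m f k"
proof -
  have "block_start t m f j + block_size t m f j
      = (\<Sum>i\<in>insert j {i. i \<le> m \<and> block_before i j}. block_size t m f i)"
    using assms(1) by (subst sum.insert) (auto simp: block_start_eq block_before_def)
  also have "\<dots> \<le> (\<Sum>i | i \<le> m \<and> block_before i k. block_size t m f i)"
    using assms by (intro sum_mono2) (auto simp: block_before_def)
  finally show ?thesis using assms(2) by (simp add: block_start_eq)
qed

lemma block_end_le_total:
  assumes "k \<le> m"
  shows "block_start t m f k + block_size t m f k \<le> (\<Sum>j\<le>m. block_size t m f j)"
proof -
  have "block_start t m f k + block_size t m f k
      = (\<Sum>i\<in>insert k {i. i \<le> m \<and> block_before i k}. block_size t m f i)"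
    using assms by (subst sum.insert) (auto simp: block_start_eq block_before_def)
  also have "\<dots> \<le> (\<Sum>i\<le>m. block_size t m f i)"
    using assms by (intro sum_mono2) auto
  finally show ?thesis .
qed

text \<open>
  The Hodge numbers beyond the middle repeat those before it. In even weight the middle one
  contributes half of its value, rounded down in type (B) because one basis vector is self-dual.
\<close>

lemma sum_block_size:
  assumes "hodge_setting t l m f"
  shows "(\<Sum>j\<le>m. block_size t m f j) = l"
proof -
  have symm: "f (weight t m - i) = f i" if "i \<le> weight t m" for i
    using assms that by (simp add: hodge_setting_def)
  have total: "(\<Sum>i\<le>weight t m. f i) = dim_V t l"
    using assms by (simp add: hodge_setting_def)
  show ?thesis
  proof (cases "t = TypeC")
    case True
    have "(\<Sum>i=m + 1..2 * m + 1. f i) = (\<Sum>i\<le>m. f i)"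
      by (rule sum.reindex_bij_witness[of _ "\<lambda>i. 2 * m + 1 - i" "\<lambda>i. 2 * m + 1 - i"])
        (use symm True in auto)
    moreover have "{..2 * m + 1} = {..m} \<union> {m + 1..2 * m + 1}" by auto
    then have "(\<Sum>i\<le>2 * m + 1. f i) = (\<Sum>i\<le>m. f i) + (\<Sum>i=m + 1..2 * m + 1. f i)"
      by (simp only:) (subst sum.union_disjoint, auto)
    ultimately show ?thesis
      using total True by (simp add: block_size_def)
  next
    case False
    then have w: "weight t m = 2 * m" by (cases t) auto
    have "(\<Sum>i=m + 1..2 * m. f i) = (\<Sum>i<m. f i)"
      by (rule sum.reindex_bij_witness[of _ "\<lambda>i. 2 * m - i" "\<lambda>i. 2 * m - i"])
        (use symm w in auto)
    moreover have "{..2 * m} = {..<m} \<union> ({m} \<union> {m + 1..2 * m})" by auto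
    then have "(\<Sum>i\<le>2 * m. f i) = (\<Sum>i<m. f i) + (f m + (\<Sum>i=m + 1..2 * m. f i))"
      by (simp only:) (subst sum.union_disjoint, auto)+
    ultimately have eq: "2 * (\<Sum>i<m. f i) + f m = dim_V t l"
      using total w by simp
    have "{..m} = insert m {..<m}" by auto
    then have "(\<Sum>j\<le>m. block_size t m f j) = block_size t m f m + (\<Sum>j<m. block_size t m f j)"
      by simp
    also have "\<dots> = f m div 2 + (\<Sum>i<m. f i)"
      using False by (simp add: block_size_def)
    also have "\<dots> = l"
      using eq assms False by (cases t) (auto simp: hodge_setting_def elim!: evenE oddE)
    finally show ?thesis .
  qed
qed

text \<open>In all types duality exchanges \<open>{1..l}\<close> with the shifted indices.\<close>

lemma in_shifted_iff: "i \<in> shifted t l J \<longleftrightarrow> shift t l \<le> i \<and> i - shift t l \<in> J"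
  by (force simp: shifted_def)

lemma dual_index_image_Times:
  "(\<lambda>(a, b). (dual_index t l b, dual_index t l a)) ` (A \<times> B) = dual_index t l ` B \<times> dual_index t l ` A"
  by auto

lemma shift_bounds: "l \<le> shift t l" "l + shift t l = dim_V t l"
  by (cases t; simp)+

lemma dual_index_image_low:
  assumes "J \<subseteq> {1..l}"
  shows "dual_index t l ` J = shifted t l J"
  unfolding shifted_def by (rule image_cong) (use assms in \<open>auto simp: dual_index_def\<close>)

lemma dual_index_image_high:
  assumes "J \<subseteq> {1..l}"
  shows "dual_index t l ` shifted t l J = J"
proof -
  have "dual_index t l ` shifted t l J = (\<lambda>i. i) ` J"
    unfolding shifted_def image_image
    by (rule image_cong) (use assms shift_bounds(1)[of l t] in \<open>auto simp: dual_index_def\<close>)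
  then show ?thesis by simp
qed

locale hodge_frame =
  fixes t :: lie_type and l m :: nat and f :: "nat \<Rightarrow> nat"
  assumes setting: "hodge_setting t l m f"
    and m_pos: "t \<noteq> TypeC \<Longrightarrow> 1 \<le> m"
begin

abbreviation "n \<equiv> weight t m"
abbreviation "s \<equiv> shift t l"
abbreviation "N \<equiv> dim_V t l"
abbreviation "\<sigma> \<equiv> dual_index t l"
abbreviation "I \<equiv> index_set t l m f"
abbreviation "S \<equiv> shifted t l"

lemma index_set_eq:
  "k \<le> m \<Longrightarrow> I k = {block_start t m f k + 1..block_start t m f k + block_size t m f k}"
  by (simp add: index_set_def)

lemma index_set_range: "k \<le> m \<Longrightarrow> I k \<subseteq> {1..l}"
  using block_end_le_total[of k m t f] sum_block_size[OF setting] by (auto simp: index_set_eq)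

lemma index_set_unique:
  assumes "j \<le> m" "k \<le> m" "i \<in> I j" "i \<in> I k"
  shows "j = k"
proof (rule ccontr)
  assume "j \<noteq> k"
  then consider "block_before j k" | "block_before k j"
    unfolding block_before_def by (metis linorder_neqE_nat)
  then show False
    by cases (use assms block_end_le_start[of j m k t f] block_end_le_start[of k m j t f]
      in \<open>auto simp: index_set_eq\<close>)
qed

lemma index_set_disjoint: "j \<le> m \<Longrightarrow> k \<le> m \<Longrightarrow> j \<noteq> k \<Longrightarrow> I j \<inter> I k = {}"
  using index_set_unique by blast

text \<open>Disjoint intervals of total size \<open>l\<close> inside \<open>{1..l}\<close> leave no gap.\<close>

lemma index_set_cover: "(\<Union>k\<le>m. I k) = {1..l}"
proof (rule card_subset_eq)
  show "(\<Union>k\<le>m. I k) \<subseteq> {1..l}"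
    using index_set_range by (intro UN_least) simp
  have "card (\<Union>k\<le>m. I k) = (\<Sum>k\<le>m. card (I k))"
    using index_set_disjoint by (intro card_UN_disjoint) (auto simp: index_set_eq)
  also have "\<dots> = (\<Sum>k\<le>m. block_size t m f k)"
    by (intro sum.cong) (auto simp: index_set_eq)
  finally show "card (\<Union>k\<le>m. I k) = card {1..l}"
    using sum_block_size[OF setting] by simp
qed simp

lemma index_set_beyond: "k > m \<Longrightarrow> I k = (if k \<le> n then S (I (n - k)) else {})"
proof -
  assume k: "k > m"
  have "n - k \<le> m" if "k \<le> n" using k that by (cases t) auto
  then show ?thesis using k by (simp add: index_set_def shifted_def)
qed

text \<open>The basis vectors with these indices span \<open>hodge_space k\<close>.\<close>

definition hodge_indices :: "nat \<Rightarrow> nat set" where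
  "hodge_indices k = (if k = m \<and> t \<noteq> TypeC
      then I m \<union> S (I m) \<union> (if t = TypeB then {l + 1} else {}) else I k)"

abbreviation "D \<equiv> hodge_indices"

lemma hodge_space_eq: "hodge_space t l m f k = coord_subspace (D k)"
  by (simp add: hodge_space_def hodge_indices_def)

lemma weight_eq: "n = (if t = TypeC then 2 * m + 1 else 2 * m)"
  by (cases t) auto

lemma high_not_low: "i \<in> S (I k) \<Longrightarrow> k \<le> m \<Longrightarrow> s < i"
  using index_set_range[of k] by (force simp: in_shifted_iff)

text \<open>
  Duality reverses the Hodge index: an index in \<open>{1..l}\<close> lies in the interval \<open>I\<^sub>k\<close> of its own degree,
  and a shifted index of degree \<open>k\<close> comes from the interval \<open>I\<^bsub>n-k\<^esub>\<close>. These rules hold for all degrees,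
  including the middle one, so that later arguments need no case distinction on the degree.
\<close>

lemma hodge_indices_low:
  assumes "i \<le> l"
  shows "i \<in> D k \<longleftrightarrow> k \<le> m \<and> i \<in> I k"
proof -
  have not_high: "i \<notin> S (I k)" if "k \<le> m" for k
    using high_not_low[of i k] that assms shift_bounds(1)[of l t] by auto
  have "n - k \<le> m" if "m < k" using that by (auto simp: weight_eq)
  then show ?thesis
    using assms not_high index_set_beyond[of k] by (cases "m < k") (auto simp: hodge_indices_def)
qed

lemma hodge_indices_high:
  assumes "s < i"
  shows "i \<in> D k \<longleftrightarrow> k \<le> n \<and> n - k \<le> m \<and> i - s \<in> I (n - k)"
proof -
  have not_low: "i \<notin> I k" if "k \<le> m" for k
    using index_set_range[OF that] assms shift_bounds(1)[of l t] by auto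
  have "i \<noteq> l + 1" if "t = TypeB" using assms that by auto
  moreover have "n - k \<le> m" if "m < k" using that by (auto simp: weight_eq)
  ultimately show ?thesis
    using assms not_low index_set_beyond[of k]
    by (cases k m rule: linorder_cases) (auto simp: hodge_indices_def in_shifted_iff weight_eq)
qed

lemma hodge_indices_mid:
  assumes "t = TypeB"
  shows "l + 1 \<in> D k \<longleftrightarrow> k = m"
proof -
  have not_low: "l + 1 \<notin> I k" if "k \<le> m" for k
    using index_set_range[OF that] by auto
  have not_high: "l + 1 \<notin> S (I k)" if "k \<le> m" for k
    using high_not_low[of "l + 1" k] that assms by auto
  have "n - k \<le> m" if "m < k" using that by (auto simp: weight_eq)
  then show ?thesis
    unfolding hodge_indices_def using assms not_low not_high index_set_beyond[of k]
    by (cases k m rule: linorder_cases) auto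
qed

lemma index_cases:
  assumes "i \<in> {1..N}"
  obtains (low) "i \<in> {1..l}" | (mid) "t = TypeB" "i = l + 1" | (high) "s < i" "i - s \<in> {1..l}"
  using assms by (cases t) (auto simp: not_le, fastforce+)

lemma hodge_indices_range: "D k \<subseteq> {1..N}"
proof -
  have low: "I k \<subseteq> {1..N}" if "k \<le> m" for k
    using index_set_range[OF that] shift_bounds(2)[of l t] by auto
  have high: "S (I k) \<subseteq> {1..N}" if "k \<le> m" for k
  proof
    fix i assume i: "i \<in> S (I k)"
    then have "i - s \<in> {1..l}" using index_set_range[OF that] by (auto simp: in_shifted_iff)
    then show "i \<in> {1..N}" using shift_bounds(2)[of l t] by auto
  qed
  have mid: "l + 1 \<in> {1..N}" if "t = TypeB" using that by simp
  have "n - k \<le> m" if "m < k" using that by (auto simp: weight_eq)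
  then have "I k \<subseteq> {1..N}"
    using low[of k] high[of "n - k"] index_set_beyond[of k] by (cases "m < k") auto
  then show ?thesis
    using low[of m] high[of m] mid by (auto simp: hodge_indices_def)
qed

lemma hodge_indices_unique:
  assumes "i \<in> D j" "i \<in> D k"
  shows "j = k"
proof -
  have "i \<in> {1..N}" using assms(1) hodge_indices_range by blast
  then show ?thesis
  proof (cases rule: index_cases)
    case low
    then show ?thesis using assms hodge_indices_low[of i] index_set_unique by auto
  next
    case mid
    then show ?thesis using assms hodge_indices_mid by auto
  next
    case high
    then have "n - j = n - k" "j \<le> n" "k \<le> n"
      using assms hodge_indices_high[of i] index_set_unique by auto
    then show ?thesis by auto
  qed
qed

lemma hodge_indices_cover:
  assumes "i \<in> {1..N}"
  shows "\<exists>k\<le>n. i \<in> D k"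
  using assms
proof (cases rule: index_cases)
  case low
  then obtain k where "k \<le> m" "i \<in> I k" using index_set_cover by blast
  then show ?thesis
    using low hodge_indices_low[of i k] by (intro exI[of _ k]) (auto simp: weight_eq)
next
  case mid
  then show ?thesis
    using hodge_indices_mid by (intro exI[of _ m]) (auto simp: weight_eq)
next
  case high
  then obtain k where "k \<le> m" "i - s \<in> I k" using index_set_cover by blast
  moreover from this have "n - (n - k) = k" by (auto simp: weight_eq)
  ultimately show ?thesis
    using high hodge_indices_high[of i "n - k"] by (intro exI[of _ "n - k"]) auto
qed

text \<open>
  The \<open>j\<close>-th column of \<open>X\<close> is the image of \<open>e\<^sub>j\<close>, and every \<open>j\<close> has exactly one degree; so the condition
  on Hodge spaces is a condition on each single entry.
\<close>

lemma g_minus_eq_supported_in: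
  "g_minus t l m f = supported_in t l (\<Union>k\<le>n. D (k + 1) \<times> D k)"
proof (intro set_eqI iffI)
  have fin: "finite (D k)" for k
    using hodge_indices_range by (rule finite_subset) simp
  note space = hodge_space_eq coord_subspace_eq[OF fin]
  {
    fix X assume X: "X \<in> g_minus t l m f"
    then have Xg: "X \<in> classical_lie t l" by (simp add: g_minus_def)
    have "(i, j) \<in> (\<Union>k\<le>n. D (k + 1) \<times> D k)" if nz: "X i j \<noteq> 0" for i j
    proof -
      have j: "j \<in> {1..N}" using classical_lie_index[OF Xg nz] by simp
      then obtain k where k: "k \<le> n" "j \<in> D k" using hodge_indices_cover by blast
      have "unit_vector j \<in> hodge_space t l m f k"
        unfolding hodge_space_eq using k(2) by (rule unit_vector_in_coord_subspace)
      then have "mat_vec N X (unit_vector j) \<in> hodge_space t l m f (k + 1)"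
        using X k(1) by (simp add: g_minus_def)
      then have "i \<in> D (k + 1)"
        using nz unfolding mat_vec_unit_vector[OF j] space by simp
      then show ?thesis using k by blast
    qed
    then show "X \<in> supported_in t l (\<Union>k\<le>n. D (k + 1) \<times> D k)"
      using Xg unfolding supported_in_def by blast
  next
    fix X assume "X \<in> supported_in t l (\<Union>k\<le>n. D (k + 1) \<times> D k)"
    then have Xg: "X \<in> classical_lie t l"
      and supp: "\<And>i j. X i j \<noteq> 0 \<Longrightarrow> (i, j) \<in> (\<Union>k\<le>n. D (k + 1) \<times> D k)"
      unfolding supported_in_def by blast+
    have "mat_vec N X v \<in> hodge_space t l m f (k + 1)" if v: "v \<in> hodge_space t l m f k" for k v
      unfolding space mem_Collect_eq
    proof (intro allI impI)
      fix i assume "mat_vec N X v i \<noteq> 0"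
      then obtain j where "X i j * v j \<noteq> 0"
        unfolding mat_vec_def by (metis (no_types, lifting) sum.neutral)
      then have nz: "X i j \<noteq> 0" and "j \<in> D k" using v unfolding space by auto
      from supp[OF nz] obtain k' where "i \<in> D (k' + 1)" "j \<in> D k'" by blast
      then show "i \<in> D (k + 1)"
        using hodge_indices_unique \<open>j \<in> D k\<close> by blast
    qed
    then show "X \<in> g_minus t l m f" using Xg by (simp add: g_minus_def)
  }
qed


section \<open>The decomposition into blocks\<close>

abbreviation "u_positions k \<equiv> I (k + 1) \<times> I k \<union> S (I k) \<times> S (I (k + 1))"
abbreviation "uc_positions \<equiv> S (I m) \<times> I (m - 1) \<union> S (I (m - 1)) \<times> I m"
abbreviation "ucC_positions \<equiv> S (I m) \<times> I m"
abbreviation "y_positions \<equiv> {l + 1} \<times> I (m - 1) \<union> S (I (m - 1)) \<times> {l + 1}"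

lemma dual_index_images:
  assumes "k \<le> m"
  shows "\<sigma> ` I k = S (I k)" "\<sigma> ` S (I k) = I k"
  using index_set_range[OF assms] by (rule dual_index_image_low dual_index_image_high)+

lemma index_ranges:
  assumes "k \<le> m"
  shows "I k \<subseteq> {1..N}" "S (I k) \<subseteq> {1..N}"
proof -
  show "I k \<subseteq> {1..N}"
    using index_set_range[OF assms] shift_bounds(2)[of l t] by auto
  then have "\<sigma> ` I k \<subseteq> {1..N}"
    using dual_index_in by blast
  then show "S (I k) \<subseteq> {1..N}"
    by (simp only: dual_index_images[OF assms])
qed

lemma low_high_disjoint:
  assumes "j \<le> m" "k \<le> m"
  shows "I j \<inter> S (I k) = {}"
proof -
  have "i \<le> s" if "i \<in> I j" for i
    using that index_set_range[OF assms(1)] shift_bounds(1)[of l t] by auto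
  then show ?thesis
    using high_not_low[OF _ assms(2)] by (metis disjoint_iff not_le)
qed

lemma high_disjoint: "j \<le> m \<Longrightarrow> k \<le> m \<Longrightarrow> j \<noteq> k \<Longrightarrow> S (I j) \<inter> S (I k) = {}"
  using index_set_disjoint[of j k] by (auto simp: in_shifted_iff)

lemma mid_not_in:
  assumes "t = TypeB" "k \<le> m"
  shows "l + 1 \<notin> I k" "l + 1 \<notin> S (I k)"
  using index_set_range[OF assms(2)] high_not_low[OF _ assms(2), of "l + 1"] assms(1) by auto

lemma hodge_indices_contain:
  assumes "k \<le> m"
  shows "I k \<subseteq> D k" "S (I k) \<subseteq> D (n - k)"
proof -
  show "I k \<subseteq> D k"
    by (auto simp: hodge_indices_def)
  show "S (I k) \<subseteq> D (n - k)"
  proof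
    fix i assume i: "i \<in> S (I k)"
    have "n - (n - k) = k" using assms by (auto simp: weight_eq)
    then show "i \<in> D (n - k)"
      using hodge_indices_high[of i "n - k"] high_not_low[OF i assms] assms i
      by (simp add: in_shifted_iff)
  qed
qed

text \<open>
  One step along the Hodge decomposition: below the middle it leads from \<open>I\<^sub>k\<close> to \<open>I\<^bsub>k+1\<^esub>\<close>, above the
  middle it is dual to such a step, and the steps that meet the middle give the remaining blocks.
\<close>

lemma hodge_step_cases:
  assumes i: "i \<in> D (k + 1)" and j: "j \<in> D k"
  shows "(\<exists>k<m. (i, j) \<in> u_positions k) \<or> (t = TypeC \<and> (i, j) \<in> ucC_positions) \<or>
    (t \<noteq> TypeC \<and> (i, j) \<in> uc_positions) \<or> (t = TypeB \<and> (i, j) \<in> y_positions)"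
proof -
  have i_N: "i \<in> {1..N}" and j_N: "j \<in> {1..N}"
    using i j hodge_indices_range by blast+
  have high: "k \<le> n \<and> n - k \<le> m \<and> x \<in> S (I (n - k))" if "x \<in> D k" "s < x" for x k
    using that hodge_indices_high[of x k] by (simp add: in_shifted_iff)
  from j_N show ?thesis
  proof (cases rule: index_cases)
    case low
    then have jk: "k \<le> m" "j \<in> I k" using j hodge_indices_low[of j k] by auto
    from i_N show ?thesis
    proof (cases rule: index_cases)
      case low
      then have "k + 1 \<le> m" "i \<in> I (k + 1)" using i hodge_indices_low[of i "k + 1"] by auto
      then show ?thesis using jk by auto
    next
      case mid
      then have "k = m - 1" using i hodge_indices_mid[of "k + 1"] by auto
      then show ?thesis using mid jk by auto
    next
      case i_high: high
      then have ik: "k + 1 \<le> n" "n - (k + 1) \<le> m" "i \<in> S (I (n - (k + 1)))"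
        using high[OF i] by auto
      show ?thesis
      proof (cases "t = TypeC")
        case True
        then have "k = m" "n - (k + 1) = m" using ik(1,2) jk(1) by auto
        then show ?thesis using True ik(3) jk(2) by auto
      next
        case False
        then have "k = m \<and> n - (k + 1) = m - 1 \<or> k = m - 1 \<and> n - (k + 1) = m"
          using ik(1,2) jk(1) m_pos[OF False] by (auto simp: weight_eq)
        then show ?thesis using False ik(3) jk(2) by auto
      qed
    qed
  next
    case mid
    then have k: "k = m" using j hodge_indices_mid[of k] by auto
    have "s < i"
      using i_N
    proof (cases rule: index_cases)
      case low
      then show ?thesis using i hodge_indices_low[of i "k + 1"] k by auto
    next
      case mid
      then show ?thesis using i hodge_indices_mid[of "k + 1"] k by auto
    qed
    then have "i \<in> S (I (n - (m + 1)))"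
      using high[OF i] k by simp
    moreover have "n - (m + 1) = m - 1" using mid by simp
    ultimately show ?thesis using mid by auto
  next
    case j_high: high
    then have jk: "k \<le> n" "n - k \<le> m" "j \<in> S (I (n - k))" using high[OF j] by auto
    have "s < i"
      using i_N
    proof (cases rule: index_cases)
      case low
      then show ?thesis using i hodge_indices_low[of i "k + 1"] jk by (auto simp: weight_eq split: if_splits)
    next
      case mid
      then show ?thesis using i hodge_indices_mid[of "k + 1"] jk by auto
    qed
    then have ik: "k + 1 \<le> n" "i \<in> S (I (n - (k + 1)))"
      using high[OF i] by auto
    define k' where "k' = n - (k + 1)"
    have "n - k = k' + 1" "k' < m" using ik(1) jk(2) by (auto simp: k'_def)
    then show ?thesis using ik(2) jk(3) by (auto simp: k'_def)
  qed
qed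

lemma hodge_step_contains:
  assumes "k \<le> n" "A \<subseteq> D (k + 1)" "B \<subseteq> D k"
  shows "A \<times> B \<subseteq> (\<Union>k\<le>n. D (k + 1) \<times> D k)"
  using assms by blast

lemma u_positions_subset_steps:
  assumes "k < m"
  shows "u_positions k \<subseteq> (\<Union>k\<le>n. D (k + 1) \<times> D k)"
proof (rule Un_least)
  have k: "k \<le> m" "k + 1 \<le> m" using assms by auto
  show "I (k + 1) \<times> I k \<subseteq> (\<Union>k\<le>n. D (k + 1) \<times> D k)"
    using k by (intro hodge_step_contains[of k] hodge_indices_contain) (auto simp: weight_eq)
  have eq: "n - (k + 1) + 1 = n - k" using k by (auto simp: weight_eq)
  have "S (I k) \<subseteq> D (n - (k + 1) + 1)" "S (I (k + 1)) \<subseteq> D (n - (k + 1))"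
    unfolding eq using k by (intro hodge_indices_contain; simp)+
  then show "S (I k) \<times> S (I (k + 1)) \<subseteq> (\<Union>k\<le>n. D (k + 1) \<times> D k)"
    by (intro hodge_step_contains[of "n - (k + 1)"]) simp_all
qed

lemma hodge_steps_C:
  assumes C: "t = TypeC"
  shows "(\<Union>k\<le>n. D (k + 1) \<times> D k) = (\<Union>k<m. u_positions k) \<union> ucC_positions"
proof
  show "(\<Union>k\<le>n. D (k + 1) \<times> D k) \<subseteq> (\<Union>k<m. u_positions k) \<union> ucC_positions"
  proof
    fix p assume "p \<in> (\<Union>k\<le>n. D (k + 1) \<times> D k)"
    then obtain k i j where "p = (i, j)" "i \<in> D (k + 1)" "j \<in> D k" by blast
    then show "p \<in> (\<Union>k<m. u_positions k) \<union> ucC_positions"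
      using hodge_step_cases[of i k j] C by auto
  qed
  have "n - m = m + 1" using C by simp
  then have "S (I m) \<subseteq> D (m + 1)"
    using hodge_indices_contain(2)[of m] by simp
  moreover have "I m \<subseteq> D m" by (rule hodge_indices_contain) simp
  ultimately have "ucC_positions \<subseteq> (\<Union>k\<le>n. D (k + 1) \<times> D k)"
    by (intro hodge_step_contains[of m]) (simp_all add: weight_eq)
  then show "(\<Union>k<m. u_positions k) \<union> ucC_positions \<subseteq> (\<Union>k\<le>n. D (k + 1) \<times> D k)"
    using u_positions_subset_steps by (intro Un_least UN_least) simp_all
qed

lemma hodge_steps_BD:
  assumes BD: "t \<noteq> TypeC"
  shows "(\<Union>k\<le>n. D (k + 1) \<times> D k)
    = (\<Union>k<m. u_positions k) \<union> uc_positions \<union> (if t = TypeB then y_positions else {})"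
    (is "?L = ?R")
proof
  show "?L \<subseteq> ?R"
  proof
    fix p assume "p \<in> ?L"
    then obtain k i j where "p = (i, j)" "i \<in> D (k + 1)" "j \<in> D k" by blast
    then show "p \<in> ?R"
      using hodge_step_cases[of i k j] BD by auto
  qed
  have m: "m - 1 \<le> m" "m - 1 + 1 = m" "m \<le> n" "m - 1 \<le> n" "n - m = m" "n - (m - 1) = m + 1"
    using m_pos[OF BD] BD by (auto simp: weight_eq)
  have low: "I m \<subseteq> D m" "I (m - 1) \<subseteq> D (m - 1)"
    using m by (intro hodge_indices_contain; simp)+
  have high: "S (I m) \<subseteq> D m" "S (I (m - 1)) \<subseteq> D (m + 1)"
    using hodge_indices_contain(2)[of m] hodge_indices_contain(2)[OF m(1)] by (simp_all only: m(5,6) order_refl)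
  have "S (I m) \<times> I (m - 1) \<subseteq> ?L" "S (I (m - 1)) \<times> I m \<subseteq> ?L"
    using hodge_step_contains[of "m - 1"] hodge_step_contains[of m] low high m by simp_all
  moreover have "y_positions \<subseteq> ?L" if "t = TypeB"
  proof -
    have "{l + 1} \<subseteq> D m" using hodge_indices_mid[OF that, of m] by simp
    then have "{l + 1} \<times> I (m - 1) \<subseteq> ?L" "S (I (m - 1)) \<times> {l + 1} \<subseteq> ?L"
      using hodge_step_contains[of "m - 1" "{l + 1}" "I (m - 1)"]
        hodge_step_contains[of m "S (I (m - 1))" "{l + 1}"] low high m by simp_all
    then show ?thesis by (rule Un_least)
  qed
  moreover have "(\<Union>k<m. u_positions k) \<subseteq> ?L"
    using u_positions_subset_steps by (intro UN_least) simp
  ultimately show "?R \<subseteq> ?L"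
    by (intro Un_least) (simp_all split: if_split)
qed

lemma u_positions_disjoint:
  assumes "j < m" "k < m" "j \<noteq> k"
  shows "disjnt (u_positions j) (u_positions k)"
proof -
  have "I j \<inter> I k = {}" "S (I j) \<inter> S (I k) = {}" "I j \<inter> S (I (k + 1)) = {}" "S (I (j + 1)) \<inter> I k = {}"
    using assms index_set_disjoint[of j k] high_disjoint[of j k] low_high_disjoint[of j "k + 1"]
      low_high_disjoint[of k "j + 1"] by auto
  then show ?thesis unfolding disjnt_def by blast
qed

lemma u_uc_positions_disjoint:
  assumes "k < m"
  shows "disjnt (u_positions k) uc_positions" "disjnt (u_positions k) ucC_positions"
    "t = TypeB \<Longrightarrow> disjnt (u_positions k) y_positions"
proof -
  note low_high_disjoint[of "k + 1" m] low_high_disjoint[of m "k + 1"] low_high_disjoint[of "k + 1" "m - 1"]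
    low_high_disjoint[of "m - 1" "k + 1"]
  then have *: "I (k + 1) \<inter> S (I m) = {}" "I m \<inter> S (I (k + 1)) = {}" "I (k + 1) \<inter> S (I (m - 1)) = {}"
    "I (m - 1) \<inter> S (I (k + 1)) = {}"
    using assms by auto
  then show "disjnt (u_positions k) uc_positions" "disjnt (u_positions k) ucC_positions"
    unfolding disjnt_def by blast+
  assume "t = TypeB"
  then have "l + 1 \<notin> I (k + 1)" "l + 1 \<notin> S (I (k + 1))" "l + 1 \<notin> I k" "l + 1 \<notin> S (I k)"
    using assms mid_not_in[of "k + 1"] mid_not_in[of k] by auto
  then show "disjnt (u_positions k) y_positions"
    unfolding disjnt_def by blast
qed

lemma uc_y_positions_disjoint:
  assumes "t = TypeB"
  shows "disjnt uc_positions y_positions"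
  using mid_not_in[OF assms, of m] mid_not_in[OF assms, of "m - 1"] unfolding disjnt_def by auto

lemma positions_range:
  "k < m \<Longrightarrow> u_positions k \<subseteq> {1..N} \<times> {1..N}"
  "uc_positions \<subseteq> {1..N} \<times> {1..N}"
  "ucC_positions \<subseteq> {1..N} \<times> {1..N}"
  "t = TypeB \<Longrightarrow> y_positions \<subseteq> {1..N} \<times> {1..N}"
proof -
  show "u_positions k \<subseteq> {1..N} \<times> {1..N}" if "k < m"
    using index_ranges[of k] index_ranges[of "k + 1"] that by (intro Un_least Sigma_mono) auto
  show "uc_positions \<subseteq> {1..N} \<times> {1..N}" "ucC_positions \<subseteq> {1..N} \<times> {1..N}"
    using index_ranges[of m] index_ranges[of "m - 1"] by (intro Un_least Sigma_mono; simp)+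
  show "y_positions \<subseteq> {1..N} \<times> {1..N}" if "t = TypeB"
    using index_ranges[of "m - 1"] that by (intro Un_least Sigma_mono) auto
qed

lemma positions_symmetric:
  assumes "(i, j) \<in> P"
    and "(\<exists>k<m. P = u_positions k) \<or> P = uc_positions \<or> P = ucC_positions \<or> (t = TypeB \<and> P = y_positions)"
  shows "(\<sigma> j, \<sigma> i) \<in> P"
proof -
  have low: "\<sigma> x \<in> S (I k)" if "x \<in> I k" "k \<le> m" for x k
    using dual_index_images(1)[OF that(2)] that(1) by blast
  have high: "\<sigma> x \<in> I k" if "x \<in> S (I k)" "k \<le> m" for x k
    using dual_index_images(2)[OF that(2)] that(1) by blast
  have mid: "\<sigma> (l + 1) = l + 1" if "t = TypeB"
    using that by (simp add: dual_index_def)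
  from assms(2) show ?thesis
  proof (elim disjE exE conjE)
    fix k assume "k < m" "P = u_positions k"
    then show ?thesis using assms(1) low[of _ k] low[of _ "k + 1"] high[of _ k] high[of _ "k + 1"] by auto
  next
    assume "P = uc_positions"
    then show ?thesis using assms(1) low[of _ m] low[of _ "m - 1"] high[of _ m] high[of _ "m - 1"] by auto
  next
    assume "P = ucC_positions"
    then show ?thesis using assms(1) low[of _ m] high[of _ m] by auto
  next
    assume "t = TypeB" "P = y_positions"
    then show ?thesis using assms(1) mid low[of _ "m - 1"] high[of _ "m - 1"] by auto
  qed
qed

lemma sorted_wrt_upt_map:
  assumes "\<And>j k. j < k \<Longrightarrow> k < m \<Longrightarrow> R (g j) (g k)"
  shows "sorted_wrt R (map g [0..<m])"
  using assms by (simp add: sorted_wrt_map sorted_wrt_iff_nth_less)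

lemma u_positions_sorted: "sorted_wrt disjnt (map u_positions [0..<m])"
  by (rule sorted_wrt_upt_map) (rule u_positions_disjoint; simp)

lemma direct_sum_B:
  assumes "t = TypeB"
  shows "direct_sum (g_minus t l m f) (map (u_block t l m f) [0..<m] @ [uc_block t l m f, y_block t l m f])"
proof -
  let ?Ps = "map u_positions [0..<m] @ [uc_positions, y_positions]"
  have "direct_sum (supported_in t l (\<Union>(set ?Ps))) (map (supported_in t l) ?Ps)"
  proof (rule direct_sum_supported_in)
    show "sorted_wrt disjnt ?Ps"
      using u_positions_sorted u_uc_positions_disjoint(1) u_uc_positions_disjoint(3)[OF _ assms]
        uc_y_positions_disjoint[OF assms]
      by (simp add: sorted_wrt_append)
    fix P assume "P \<in> set ?Ps"
    then have P: "(\<exists>k<m. P = u_positions k) \<or> P = uc_positions \<or> P = y_positions" by auto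
    then show "P \<subseteq> {1..N} \<times> {1..N}"
      using positions_range(1,2) positions_range(4)[OF assms] by metis
    show "(\<sigma> j, \<sigma> i) \<in> P" if "(i, j) \<in> P" for i j
      using positions_symmetric[OF that] P assms by blast
  qed
  moreover have "\<Union>(set ?Ps) = (\<Union>k\<le>n. D (k + 1) \<times> D k)"
    using assms by (subst hodge_steps_BD) (simp, auto)
  ultimately show ?thesis
    unfolding g_minus_eq_supported_in by (simp add: u_block_def[abs_def] uc_block_def y_block_def comp_def)
qed

lemma direct_sum_C:
  assumes "t = TypeC"
  shows "direct_sum (g_minus t l m f) (map (u_block t l m f) [0..<m] @ [ucC_block t l m f])"
proof -
  let ?Ps = "map u_positions [0..<m] @ [ucC_positions]"
  have "direct_sum (supported_in t l (\<Union>(set ?Ps))) (map (supported_in t l) ?Ps)"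
  proof (rule direct_sum_supported_in)
    show "sorted_wrt disjnt ?Ps"
      using u_positions_sorted u_uc_positions_disjoint(2) by (simp add: sorted_wrt_append)
    fix P assume "P \<in> set ?Ps"
    then have P: "(\<exists>k<m. P = u_positions k) \<or> P = ucC_positions" by auto
    then show "P \<subseteq> {1..N} \<times> {1..N}"
      using positions_range(1,3) by metis
    show "(\<sigma> j, \<sigma> i) \<in> P" if "(i, j) \<in> P" for i j
      using positions_symmetric[OF that] P by blast
  qed
  moreover have "\<Union>(set ?Ps) = (\<Union>k\<le>n. D (k + 1) \<times> D k)"
    using assms by (subst hodge_steps_C) (simp, auto)
  ultimately show ?thesis
    unfolding g_minus_eq_supported_in by (simp add: u_block_def[abs_def] ucC_block_def comp_def)
qed

lemma direct_sum_D:
  assumes "t = TypeD"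
  shows "direct_sum (g_minus t l m f) (map (u_block t l m f) [0..<m] @ [uc_block t l m f])"
proof -
  let ?Ps = "map u_positions [0..<m] @ [uc_positions]"
  have "direct_sum (supported_in t l (\<Union>(set ?Ps))) (map (supported_in t l) ?Ps)"
  proof (rule direct_sum_supported_in)
    show "sorted_wrt disjnt ?Ps"
      using u_positions_sorted u_uc_positions_disjoint(1) by (simp add: sorted_wrt_append)
    fix P assume "P \<in> set ?Ps"
    then have P: "(\<exists>k<m. P = u_positions k) \<or> P = uc_positions" by auto
    then show "P \<subseteq> {1..N} \<times> {1..N}"
      using positions_range(1,2) by metis
    show "(\<sigma> j, \<sigma> i) \<in> P" if "(i, j) \<in> P" for i j
      using positions_symmetric[OF that] P by blast
  qed
  moreover have "\<Union>(set ?Ps) = (\<Union>k\<le>n. D (k + 1) \<times> D k)"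
    using assms by (subst hodge_steps_BD) (simp, auto)
  ultimately show ?thesis
    unfolding g_minus_eq_supported_in by (simp add: u_block_def[abs_def] uc_block_def comp_def)
qed

section \<open>The sets of roots and the Grassmannians of the blocks\<close>

lemma root_coordinates_u:
  assumes "k < m"
  shows "root_coordinates N (classical_lie t l) (theta t l m f k) (u_block t l m f k)"
proof -
  define \<omega> :: "nat \<times> nat \<Rightarrow> cmat \<Rightarrow> complex" where "\<omega> = (\<lambda>(a, b). - eps b + eps a)"
  have "root_coordinates N (classical_lie t l) (\<omega> ` (I (k + 1) \<times> I k))
    (supported_in t l (I (k + 1) \<times> I k \<union> (\<lambda>(a, b). (\<sigma> b, \<sigma> a)) ` (I (k + 1) \<times> I k)))"
  proof (rule root_coordinates_supported_in)
    show "I (k + 1) \<times> I k \<subseteq> {1..N} \<times> {1..N}"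
      using positions_range(1)[OF assms] by blast
  next
    fix a b assume ab: "(a, b) \<in> I (k + 1) \<times> I k"
    show "a \<noteq> b" using ab index_set_disjoint[of "k + 1" k] assms by auto
    have "\<sigma> b \<in> S (I k)" using ab dual_index_images(1)[of k] assms by auto
    then have "\<sigma> b \<notin> I (k + 1)" using low_high_disjoint[of "k + 1" k] assms by auto
    then show "t = TypeC" if "a = \<sigma> b" using that ab by auto
    show "\<omega> (\<sigma> b, \<sigma> a) = \<omega> (a, b)" if "(\<sigma> b, \<sigma> a) \<in> I (k + 1) \<times> I k"
      using that \<open>\<sigma> b \<notin> I (k + 1)\<close> by auto
    show "\<omega> (a, b) H = H a a - H b b" for H
      by (simp add: \<omega>_def eps_def)
  qed
  moreover have "\<omega> ` (I (k + 1) \<times> I k) = theta t l m f k"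
    by (auto simp: \<omega>_def theta_def)
  ultimately show ?thesis
    using assms by (simp add: u_block_def dual_index_image_Times dual_index_images)
qed

text \<open>
  For a shifted index \<open>a\<close>, the weight of the position \<open>(a, b)\<close> in terms of indices in \<open>{1..l}\<close>. As a
  function on all matrices it differs from \<open>eps a - eps b\<close>, with which it agrees on the Cartan subalgebra.
\<close>

definition dual_weight :: "nat \<times> nat \<Rightarrow> cmat \<Rightarrow> complex" where
  "dual_weight = (\<lambda>(a, b). - eps b - eps (\<sigma> a))"

lemma dual_weight_eq:
  assumes "H \<in> cartan (classical_lie t l)" "a \<in> {1..N}"
  shows "dual_weight (a, b) H = H a a - H b b"
  using cartan_dual[OF assms] by (simp add: dual_weight_def eps_def)

lemma dual_weight_image:
  assumes "j \<le> m"
  shows "dual_weight ` (S (I j) \<times> J) = {- eps i - eps i' | i i'. i \<in> J \<and> i' \<in> I j}"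
proof -
  have "dual_weight ` (S (I j) \<times> J) = (\<lambda>(a, b). - eps b - eps a) ` (\<sigma> ` S (I j) \<times> J)"
    by (force simp: dual_weight_def image_iff)
  then show ?thesis
    unfolding dual_index_images(2)[OF assms] by auto
qed

lemma root_coordinates_uc:
  assumes "t \<noteq> TypeC"
  shows "root_coordinates N (classical_lie t l) (theta_c t l m f) (uc_block t l m f)"
proof -
  have m: "m - 1 \<le> m" "m - 1 \<noteq> m" using m_pos assms by auto
  have "root_coordinates N (classical_lie t l) (dual_weight ` (S (I m) \<times> I (m - 1)))
    (supported_in t l (S (I m) \<times> I (m - 1) \<union> (\<lambda>(a, b). (\<sigma> b, \<sigma> a)) ` (S (I m) \<times> I (m - 1))))"
  proof (rule root_coordinates_supported_in)
    show "S (I m) \<times> I (m - 1) \<subseteq> {1..N} \<times> {1..N}"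
      using positions_range(2) by blast
  next
    fix a b assume ab: "(a, b) \<in> S (I m) \<times> I (m - 1)"
    show "a \<noteq> b" using ab low_high_disjoint[of "m - 1" m] by auto
    have "\<sigma> b \<in> S (I (m - 1))" using ab dual_index_images(1)[OF m(1)] by auto
    then have "\<sigma> b \<notin> S (I m)" using high_disjoint[of "m - 1" m] m by auto
    then show "t = TypeC" if "a = \<sigma> b" using that ab by auto
    show "dual_weight (\<sigma> b, \<sigma> a) = dual_weight (a, b)" if "(\<sigma> b, \<sigma> a) \<in> S (I m) \<times> I (m - 1)"
      using that \<open>\<sigma> b \<notin> S (I m)\<close> by auto
    show "dual_weight (a, b) H = H a a - H b b" if "H \<in> cartan (classical_lie t l)" for H
      using ab index_ranges(2)[of m] by (intro dual_weight_eq[OF that]) auto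
  qed
  moreover have "dual_weight ` (S (I m) \<times> I (m - 1)) = theta_c t l m f"
    unfolding theta_c_def by (rule dual_weight_image) simp
  ultimately show ?thesis
    by (simp add: uc_block_def dual_index_image_Times dual_index_images)
qed

text \<open>
  Here the set of positions is its own mirror image: the positions of \<open>- \<epsilon>\<^sub>i - \<epsilon>\<^sub>j\<close> and
  \<open>- \<epsilon>\<^sub>j - \<epsilon>\<^sub>i\<close> are mirror images, and the long roots sit at positions that are their own mirror image.
\<close>

lemma root_coordinates_ucC:
  assumes "t = TypeC"
  shows "root_coordinates N (classical_lie t l) (theta_cC t l m f) (ucC_block t l m f)"
proof -
  have "root_coordinates N (classical_lie t l) (dual_weight ` (S (I m) \<times> I m))
    (supported_in t l (S (I m) \<times> I m \<union> (\<lambda>(a, b). (\<sigma> b, \<sigma> a)) ` (S (I m) \<times> I m)))"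
  proof (rule root_coordinates_supported_in)
    show "S (I m) \<times> I m \<subseteq> {1..N} \<times> {1..N}"
      by (rule positions_range(3))
  next
    fix a b assume ab: "(a, b) \<in> S (I m) \<times> I m"
    show "a \<noteq> b" using ab low_high_disjoint[of m m] by auto
    show "t = TypeC" by (rule assms)
    have "b \<in> {1..N}" using ab index_ranges(1)[of m] by auto
    then show "dual_weight (\<sigma> b, \<sigma> a) = dual_weight (a, b)"
      by (simp add: dual_weight_def dual_index_dual)
    show "dual_weight (a, b) H = H a a - H b b" if "H \<in> cartan (classical_lie t l)" for H
      using ab index_ranges(2)[of m] by (intro dual_weight_eq[OF that]) auto
  qed
  moreover have "dual_weight ` (S (I m) \<times> I m) = theta_cC t l m f"
    unfolding theta_cC_def by (rule dual_weight_image) simp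
  ultimately show ?thesis
    by (simp add: ucC_block_def dual_index_image_Times dual_index_images)
qed

lemma root_coordinates_y:
  assumes "t = TypeB"
  shows "root_coordinates N (classical_lie t l) (theta_d t l m f) (y_block t l m f)"
proof -
  define \<omega> :: "nat \<times> nat \<Rightarrow> cmat \<Rightarrow> complex" where "\<omega> = (\<lambda>(a, b). - eps b)"
  have mid: "\<sigma> (l + 1) = l + 1" "l + 1 \<in> {1..N}" using assms by (simp_all add: dual_index_def)
  have "root_coordinates N (classical_lie t l) (\<omega> ` ({l + 1} \<times> I (m - 1)))
    (supported_in t l ({l + 1} \<times> I (m - 1) \<union> (\<lambda>(a, b). (\<sigma> b, \<sigma> a)) ` ({l + 1} \<times> I (m - 1))))"
  proof (rule root_coordinates_supported_in)
    show "{l + 1} \<times> I (m - 1) \<subseteq> {1..N} \<times> {1..N}"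
      using positions_range(4)[OF assms] by blast
  next
    fix a b assume ab: "(a, b) \<in> {l + 1} \<times> I (m - 1)"
    show "a \<noteq> b" using ab mid_not_in[OF assms, of "m - 1"] by auto
    have "\<sigma> b \<in> S (I (m - 1))" using ab dual_index_images(1)[of "m - 1"] by auto
    then have "\<sigma> b \<noteq> l + 1" using mid_not_in[OF assms, of "m - 1"] by auto
    then show "t = TypeC" if "a = \<sigma> b" using that ab by auto
    show "\<omega> (\<sigma> b, \<sigma> a) = \<omega> (a, b)" if "(\<sigma> b, \<sigma> a) \<in> {l + 1} \<times> I (m - 1)"
      using that \<open>\<sigma> b \<noteq> l + 1\<close> by auto
    show "\<omega> (a, b) H = H a a - H b b" if "H \<in> cartan (classical_lie t l)" for H
    proof -
      \<comment> \<open>The weight of the self-dual basis vector is its own negative.\<close>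
      have "H (l + 1) (l + 1) = 0"
        using cartan_dual[OF that mid(2)] unfolding mid(1) by simp
      then show ?thesis using ab by (simp add: \<omega>_def eps_def)
    qed
  qed
  moreover have "\<omega> ` ({l + 1} \<times> I (m - 1)) = theta_d t l m f"
    by (auto simp: \<omega>_def theta_d_def)
  ultimately show ?thesis
    by (simp add: y_block_def dual_index_image_Times dual_index_images mid del: One_nat_def)
qed

lemma tangent_u:
  assumes "k < m"
  shows "tangent_grassmannian_A N (classical_lie t l) (u_block t l m f k)
    (block_size t m f k) (block_size t m f k + block_size t m f (k + 1)) (u_embedding t l m f k)"
proof -
  have k: "k \<le> m" "k + 1 \<le> m" using assms by auto
  note eq = index_set_eq[OF k(1)] index_set_eq[OF k(2)]
  have disj: "I k \<inter> I (k + 1) = {}" using index_set_disjoint[OF k] by simp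
  have range: "I k \<union> I (k + 1) \<subseteq> {1..N}" using index_ranges(1)[OF k(1)] index_ranges(1)[OF k(2)] by blast
  have isotropic: "(I k \<union> I (k + 1)) \<inter> \<sigma> ` (I k \<union> I (k + 1)) = {}"
    unfolding image_Un dual_index_images(1)[OF k(1)] dual_index_images(1)[OF k(2)]
    using low_high_disjoint k by blast
  have sign: "form_sign t l i * form_sign t l j = 1" if "i \<in> I k \<union> I (k + 1)" "j \<in> I k \<union> I (k + 1)" for i j
    using that index_set_range[OF k(1)] index_set_range[OF k(2)] by (auto simp: form_sign_def)
  show ?thesis
    using tangent_grassmannian_A_join_blocks[OF disj[unfolded eq] range[unfolded eq]
        isotropic[unfolded eq] sign[unfolded eq], folded eq]
    unfolding u_block_def u_embedding_def dual_index_images(1)[OF k(1)] dual_index_images(1)[OF k(2)] .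
qed

lemma tangent_uc:
  assumes "t \<noteq> TypeC"
  shows "tangent_grassmannian_A N (classical_lie t l) (uc_block t l m f)
    (block_size t m f (m - 1)) (block_size t m f (m - 1) + block_size t m f m) (uc_embedding t l m f)"
proof -
  have k: "m - 1 \<le> m" "m \<le> m" "m - 1 \<noteq> m" using m_pos assms by auto
  have S: "S (I m) = {s + block_start t m f m + 1..s + block_start t m f m + block_size t m f m}"
    unfolding index_set_eq[OF k(2)] shifted_def by (simp add: add.commute add.left_commute)
  note eq = index_set_eq[OF k(1)] S
  have disj: "I (m - 1) \<inter> S (I m) = {}" using low_high_disjoint[OF k(1,2)] .
  have range: "I (m - 1) \<union> S (I m) \<subseteq> {1..N}" using index_ranges(1)[OF k(1)] index_ranges(2)[OF k(2)] by blast
  have isotropic: "(I (m - 1) \<union> S (I m)) \<inter> \<sigma> ` (I (m - 1) \<union> S (I m)) = {}"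
    unfolding image_Un dual_index_images(1)[OF k(1)] dual_index_images(2)[OF k(2)]
    using low_high_disjoint[OF k(1,1)] low_high_disjoint[OF k(2,2)] index_set_disjoint[OF k]
      high_disjoint[OF k] by blast
  have sign: "form_sign t l i * form_sign t l j = 1" for i j
    using assms by (simp add: form_sign_def)
  show ?thesis
    using tangent_grassmannian_A_join_blocks[OF disj[unfolded eq] range[unfolded eq]
        isotropic[unfolded eq] sign, folded eq]
    unfolding uc_block_def uc_embedding_def dual_index_images(1)[OF k(1)] dual_index_images(2)[OF k(2)] .
qed

lemma tangent_ucC:
  assumes "t = TypeC"
  shows "tangent_grassmannian_C N (classical_lie t l) (ucC_block t l m f)
    (block_size t m f m) (ucC_embedding t l m f)"
proof -
  let ?r = "block_size t m f m" and ?p = "block_start t m f m"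
  let ?\<iota> = "join_blocks ?r ?p (s + ?p)"
  have eq: "I m = {?p + 1..?p + ?r}" by (rule index_set_eq) simp
  have S: "S (I m) = {s + ?p + 1..s + ?p + ?r}"
    unfolding eq shifted_def by (simp add: add.commute add.left_commute)
  have le: "?p + ?r \<le> l" using block_end_le_total[of m m t f] sum_block_size[OF setting] by simp
  have sl: "s = l" using assms by simp
  have two: "{?r + 1..2 * ?r} = {?r + 1..?r + ?r}" "{1..2 * ?r} = {1..?r + ?r}" by (simp_all add: mult_2)
  have img: "?\<iota> ` {1..?r} = I m" "?\<iota> ` {?r + 1..2 * ?r} = S (I m)" "?\<iota> ` {1..2 * ?r} = I m \<union> S (I m)"
    unfolding S unfolding eq two by (rule join_blocks_image join_blocks_range)+
  have "tangent_grassmannian_C (2 * l) (classical_lie TypeC l)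
    (supported_in TypeC l (?\<iota> ` {?r + 1..2 * ?r} \<times> ?\<iota> ` {1..?r})) ?r (embed_sp ?r ?\<iota>)"
  proof (rule tangent_grassmannian_C_embed_sp)
    show "inj_on ?\<iota> {1..2 * ?r}"
      using low_high_disjoint[of m m] unfolding S unfolding eq two by (intro join_blocks_inj) simp
    show "?\<iota> ` {1..2 * ?r} \<subseteq> {1..2 * l}"
      unfolding img using index_ranges[of m] assms by simp
    fix a assume a: "a \<in> {1..2 * ?r}"
    show "?\<iota> (dual_index TypeC ?r a) = dual_index TypeC l (?\<iota> a)"
      using a le sl by (cases "a \<le> ?r") (auto simp: join_blocks_def dual_index_def)
    show "form_sign TypeC l (?\<iota> a) = form_sign TypeC ?r a"
      using a le sl by (cases "a \<le> ?r") (auto simp: join_blocks_def form_sign_def)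
  qed
  then show ?thesis
    unfolding img ucC_block_def ucC_embedding_def using assms by simp
qed

end

theorem proposition15:
  fixes t :: lie_type and l m :: nat and f :: "nat \<Rightarrow> nat"
  assumes setting: "hodge_setting t l m f"
    and m: "t \<noteq> TypeC \<Longrightarrow> 1 \<le> m"
  shows
    "(t = TypeB \<longrightarrow> direct_sum (g_minus t l m f)
        (map (u_block t l m f) [0..<m] @ [uc_block t l m f, y_block t l m f])) \<and>
     (t = TypeC \<longrightarrow> direct_sum (g_minus t l m f)
        (map (u_block t l m f) [0..<m] @ [ucC_block t l m f])) \<and>
     (t = TypeD \<longrightarrow> direct_sum (g_minus t l m f)
        (map (u_block t l m f) [0..<m] @ [uc_block t l m f])) \<and>
     (\<forall>k<m.
        root_coordinates (dim_V t l) (classical_lie t l)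
          (theta t l m f k) (u_block t l m f k) \<and>
        tangent_grassmannian_A (dim_V t l) (classical_lie t l) (u_block t l m f k)
          (block_size t m f k) (block_size t m f k + block_size t m f (k + 1))
          (u_embedding t l m f k)) \<and>
     (t \<noteq> TypeC \<longrightarrow>
        root_coordinates (dim_V t l) (classical_lie t l)
          (theta_c t l m f) (uc_block t l m f) \<and>
        tangent_grassmannian_A (dim_V t l) (classical_lie t l) (uc_block t l m f)
          (block_size t m f (m - 1)) (block_size t m f (m - 1) + block_size t m f m)
          (uc_embedding t l m f)) \<and>
     (t = TypeC \<longrightarrow>
        root_coordinates (dim_V t l) (classical_lie t l)
          (theta_cC t l m f) (ucC_block t l m f) \<and>
        tangent_grassmannian_C (dim_V t l) (classical_lie t l) (ucC_block t l m f)
          (block_size t m f m) (ucC_embedding t l m f)) \<and>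
     (t = TypeB \<longrightarrow>
        root_coordinates (dim_V t l) (classical_lie t l)
          (theta_d t l m f) (y_block t l m f))"
proof -
  interpret hodge_frame t l m f
    using setting m by unfold_locales
  show ?thesis
    by (intro conjI impI allI direct_sum_B direct_sum_C direct_sum_D root_coordinates_u tangent_u
        root_coordinates_uc tangent_uc root_coordinates_ucC tangent_ucC root_coordinates_y)
qed

end
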